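(* Let $\lambda$ be a composition of $n$. For $z\in Z(\lambda)$ set $D=D(z,\lambda)$ and $D'=D'_q$, where $q=q(D)$. Then there is a well-defined injective map $\theta_*$ from $Z(\lambda)$ to $Z(\lambda_* )$ in which $z\mapsto z'$, where $z'=w_{D'}$. Moreover, $\theta_*$ has the following properties. (i) For $z\in Z(\lambda)$ we have $z^{-1}(z\theta_* )\in\mathfrak{X}'$, and whenever $zx\in Z(\lambda_* )$ with $x\in\mathfrak{X}'$ we have that $x$ is a prefix of $z^{-1}(z\theta_* )$. (ii) $Y(\lambda)\theta_*\subseteq Y(\lambda_* )\subseteq Z(\lambda)\theta_*$.
   Context: Permutations. $S_n$ acts on $\{1,\dots,n\}$ on the right ($iw$ is the image of $i$ under $w$; $xy$ means first $x$, then $y$), and $S_n\subset S_{n+1}$ is the natural embedding (fixing $n+1$). $s_i=(i,i+1)$ and $l$ is the Coxeter length with respect to the $s_i$. An element $x$ is a prefix of $y$ if $l(y)=l(x)+l(x^{-1}y)$. The set $\mathfrak{X}'$ of minimum length representatives of the right cosets of $S_n$ in $S_{n+1}$ is $\mathfrak{X}'=\{x_i: 1\le i\le n+1\}$, $x_i=s_ns_{n-1}\cdots s_i$ ($x_{n+1}=1$). Maps are written on the right. Right cells. The row-form of $w\in S_n$ is $[1w,2w,\dots,nw]$; $\mathcal P(w),\mathcal Q(w)$ are the insertion and recording tableaux obtained by Robinson–Schensted row insertion of the row-form. $\sim_R$ denotes the Kazhdan–Lusztig right cell equivalence; in $S_n$, $x\sim_R y$ if and only if $\mathcal Q(x)=\mathcal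 Q(y)$ (known theorem, may be taken as the definition). Compositions. Compositions have no zero parts. For $\lambda=(\lambda_1,\dots,\lambda_r)$ a composition of $n$, $\lambda_*=(\lambda_1,\dots,\lambda_r,1)$, a composition of $n+1$; $\lambda'$ is the partition with $\lambda'_i=|\{j:\lambda_j\ge i\}|$; $J(\lambda)=\{s_1,\dots,s_{n-1}\}\setminus\{s_{\lambda_1},s_{\lambda_1+\lambda_2},\dots,s_{\lambda_1+\dots+\lambda_{r-1}}\}$; $w_{J(\lambda)}$ is the longest element of the parabolic subgroup $W_{J(\lambda)}=\langle J(\lambda)\rangle$; $\mathfrak X_{J(\lambda)}$ is the set of minimum length representatives of the right cosets of $W_{J(\lambda)}$ in $S_n$. Define $Z(\lambda)=\{e\in\mathfrak X_{J(\lambda)}: w_{J(\lambda)}e\sim_R w_{J(\lambda)}\}$ and $Y(\lambda)=\{x\in Z(\lambda): x$ is not a prefix of any other $y\in Z(\lambda)\}$; similarly for compositions of $n+1$ in $S_{n+1}$. Diagrams. A (principal) diagram $D$ is a finite subset of $\mathbb Z^2$ whose nodes $(a,b)$ (row $a$, column $b$) have rows indexed $1,\dots,r_D$ and columns indexed $1,\dots,c_D$, with no empty row or column; $\lambda_D$ is its row-composition ($\lambda_{D,k}$ is the number of nodes in row $k$). $\mathcal D^{(\lambda)}$ is the set of principal diagrams $D$ with $\lambda_D=\lambda$. For $D$ with $n$ nodes, $t^D$ and $t_D$ are the bijections $D\to\{1,\dots,n\}$ obtained by filling in $1,\dots,n$ row by row (top to bottom, left to right) and column by column (left to right, top to bottom),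 respectively, and $w_D\in S_n$ is defined by $t^Dw_D=t_D$. For $d\in\mathfrak X_{J(\lambda)}$ there are diagrams $D\in\mathcal D^{(\lambda)}$ with $w_D=d$, and among them exactly one with the minimum number of columns; it is denoted $D(d,\lambda)$. Admissibility. A path of length $m$ in $D$ is a sequence of nodes $((a_i,b_i))_{i=1}^m$ of $D$ with $a_i<a_{i+1}$ and $b_i\le b_{i+1}$; a $k$-path is a sequence of $k$ mutually disjoint paths and its length is the total number of its nodes. $D$ is of subsequence type $\nu=(\nu_1,\dots,\nu_s)\vdash n$ if for each $1\le k\le s$ the maximum length of a $k$-path in $D$ is $\nu_1+\dots+\nu_k$. $D$ is admissible if it is of subsequence type $\lambda_D'$. (For $z\in Z(\lambda)$ the diagram $D(z,\lambda)$ is admissible.) Extension. For $D\in\mathcal D^{(\lambda)}$ and $1\le i\le c_D$, $D'_i=D\cup\{(r_D+1,i)\}\in\mathcal D^{(\lambda_* )}$. If $D$ is admissible then $D'_{c_D}$ is admissible, and $q(D)=\min\{j: 1\le j\le c_D$ and $D'_j$ is admissible$\}$. *)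

theory Defs
  imports "HOL-Algebra.Sym_Groups"
begin

section \<open>Symmetric groups acting on the right\<close>

text \<open>
  An element \<open>w\<close> of $S_n$ is a function with \<open>w permutes {1..n}\<close>, and \<open>iw\<close> is \<open>w i\<close>.  Such a
  function fixes every number greater than \<open>n\<close>, so the natural embedding of $S_n$ in $S_{n+1}$ is
  the identity on functions.  Products are read from left to right: \<open>x \<cdot> y\<close> is first \<open>x\<close>,
  then \<open>y\<close>, the reverse of the multiplication of \<^const>\<open>sym_group\<close>.
\<close>

abbreviation (input) rprod :: "(nat \<Rightarrow> nat) \<Rightarrow> (nat \<Rightarrow> nat) \<Rightarrow> nat \<Rightarrow> nat"  (infixl "\<cdot>" 70)
  where "x \<cdot> y \<equiv> y \<circ> x"

definition simple_refl :: "nat \<Rightarrow> nat \<Rightarrow> nat"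
  where "simple_refl i = Transposition.transpose i (Suc i)"

fun word_prod :: "nat list \<Rightarrow> nat \<Rightarrow> nat" where
  "word_prod [] = id"
| "word_prod (i # is) = simple_refl i \<cdot> word_prod is"

definition cox_length :: "nat \<Rightarrow> (nat \<Rightarrow> nat) \<Rightarrow> nat"
  where "cox_length n w =
    (LEAST k. \<exists>is. set is \<subseteq> {1..<n} \<and> length is = k \<and> word_prod is = w)"

definition prefix_of :: "nat \<Rightarrow> (nat \<Rightarrow> nat) \<Rightarrow> (nat \<Rightarrow> nat) \<Rightarrow> bool"
  where "prefix_of n x y \<longleftrightarrow> cox_length n y = cox_length n x + cox_length n (inv' x \<cdot> y)"

text \<open>Minimum length representatives of the right cosets \<open>{u \<cdot> x | u. u \<in> H}\<close> in $S_n$.\<close>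

definition min_coset_reps :: "nat \<Rightarrow> (nat \<Rightarrow> nat) set \<Rightarrow> (nat \<Rightarrow> nat) set"
  where "min_coset_reps n H =
    {x. x permutes {1..n} \<and> (\<forall>u\<in>H. cox_length n x \<le> cox_length n (u \<cdot> x))}"

definition X' :: "nat \<Rightarrow> (nat \<Rightarrow> nat) set"
  where "X' n = min_coset_reps (Suc n) {u. u permutes {1..n}}"


section \<open>Robinson--Schensted and right cells\<close>

text \<open>
  Row insertion into a single row; the second component is the bumped entry, if there is one.
\<close>

fun row_insert :: "nat \<Rightarrow> nat list \<Rightarrow> nat list \<times> nat option" where
  "row_insert x [] = ([x], None)"
| "row_insert x (y # ys) =
    (if x < y then (x # ys, Some y)
     else (case row_insert x ys of (zs, b) \<Rightarrow> (y # zs, b)))"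

text \<open>
  Tableaux are lists of rows.  The second component is the index (from 0) of the row in which
  the new box appears.
\<close>

fun tab_insert :: "nat \<Rightarrow> nat list list \<Rightarrow> nat list list \<times> nat" where
  "tab_insert x [] = ([[x]], 0)"
| "tab_insert x (r # rs) =
    (case row_insert x r of
       (r', None) \<Rightarrow> (r' # rs, 0)
     | (r', Some y) \<Rightarrow> (case tab_insert y rs of (rs', i) \<Rightarrow> (r' # rs', Suc i)))"

definition add_box :: "nat \<Rightarrow> nat \<Rightarrow> nat list list \<Rightarrow> nat list list"
  where "add_box k i Q = (if i < length Q then Q[i := Q ! i @ [k]] else Q @ [[k]])"

definition rs_step :: "nat \<times> nat \<Rightarrow> nat list list \<times> nat list list \<Rightarrow> nat list list \<times> nat list list"
  where "rs_step kx PQ =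
    (case tab_insert (snd kx) (fst PQ) of (P', i) \<Rightarrow> (P', add_box (fst kx) i (snd PQ)))"

definition row_form :: "nat \<Rightarrow> (nat \<Rightarrow> nat) \<Rightarrow> nat list"
  where "row_form n w = map w [1..<Suc n]"

definition robinson_schensted :: "nat \<Rightarrow> (nat \<Rightarrow> nat) \<Rightarrow> nat list list \<times> nat list list"
  where "robinson_schensted n w = fold rs_step (List.enumerate 1 (row_form n w)) ([], [])"

definition Q_tab :: "nat \<Rightarrow> (nat \<Rightarrow> nat) \<Rightarrow> nat list list"
  where "Q_tab n w = snd (robinson_schensted n w)"

text \<open>
  The Kazhdan--Lusztig right cell equivalence on $S_n$.  That it amounts to equality of recording
  tableaux is a theorem of Kazhdan--Lusztig theory, taken here as the definition.
\<close>

definition right_cell_equiv :: "nat \<Rightarrow> (nat \<Rightarrow> nat) \<Rightarrow> (nat \<Rightarrow> nat) \<Rightarrow> bool"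
  where "right_cell_equiv n x y \<longleftrightarrow> Q_tab n x = Q_tab n y"


section \<open>Compositions\<close>

definition composition_of :: "nat \<Rightarrow> nat list \<Rightarrow> bool"
  where "composition_of n lam \<longleftrightarrow> (\<forall>a\<in>set lam. 0 < a) \<and> sum_list lam = n"

definition partition_of :: "nat \<Rightarrow> nat list \<Rightarrow> bool"
  where "partition_of n nu \<longleftrightarrow> composition_of n nu \<and> sorted_wrt (\<ge>) nu"

definition conj_partition :: "nat list \<Rightarrow> nat list"
  where "conj_partition lam =
    map (\<lambda>i. card {j. j < length lam \<and> i \<le> lam ! j}) [1..<Suc (Max (insert 0 (set lam)))]"

definition comp_star :: "nat list \<Rightarrow> nat list"
  where "comp_star lam = lam @ [1]"

text \<open>
  In the following definitions \<open>lam\<close> is a composition of \<open>n = sum_list lam\<close>, and the ambient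
  group is $S_n$ for this \<open>n\<close>.
\<close>

definition J_set :: "nat list \<Rightarrow> (nat \<Rightarrow> nat) set"
  where "J_set lam = simple_refl ` {1..<sum_list lam}
    - simple_refl ` {sum_list (take k lam) | k. 1 \<le> k \<and> k < length lam}"

definition W_J :: "nat list \<Rightarrow> (nat \<Rightarrow> nat) set"
  where "W_J lam = generate (sym_group (sum_list lam)) (J_set lam)"

definition w_J :: "nat list \<Rightarrow> nat \<Rightarrow> nat"
  where "w_J lam = (THE w. w \<in> W_J lam \<and>
    (\<forall>u\<in>W_J lam. cox_length (sum_list lam) u \<le> cox_length (sum_list lam) w))"

definition X_J :: "nat list \<Rightarrow> (nat \<Rightarrow> nat) set"
  where "X_J lam = min_coset_reps (sum_list lam) (W_J lam)"

definition Z_set :: "nat list \<Rightarrow> (nat \<Rightarrow> nat) set"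
  where "Z_set lam = {e \<in> X_J lam. right_cell_equiv (sum_list lam) (w_J lam \<cdot> e) (w_J lam)}"

definition Y_set :: "nat list \<Rightarrow> (nat \<Rightarrow> nat) set"
  where "Y_set lam = {x \<in> Z_set lam. \<forall>y\<in>Z_set lam. y \<noteq> x \<longrightarrow> \<not> prefix_of (sum_list lam) x y}"


section \<open>Diagrams\<close>

text \<open>
  A node is a pair (row, column).  The rows and columns of a principal diagram are indexed from
  1, so no nodes outside \<open>nat \<times> nat\<close> are needed.
\<close>

type_synonym diagram = "(nat \<times> nat) set"

definition num_rows :: "diagram \<Rightarrow> nat"
  where "num_rows D = card (fst ` D)"

definition num_cols :: "diagram \<Rightarrow> nat"
  where "num_cols D = card (snd ` D)"

definition principal_diagram :: "diagram \<Rightarrow> bool"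
  where "principal_diagram D \<longleftrightarrow>
    finite D \<and> fst ` D = {1..num_rows D} \<and> snd ` D = {1..num_cols D}"

definition row_comp :: "diagram \<Rightarrow> nat list"
  where "row_comp D = map (\<lambda>a. card {b. (a, b) \<in> D}) [1..<Suc (num_rows D)]"

definition diagrams :: "nat list \<Rightarrow> diagram set"
  where "diagrams lam = {D. principal_diagram D \<and> row_comp D = lam}"

definition row_filling :: "diagram \<Rightarrow> nat \<times> nat \<Rightarrow> nat"
  where "row_filling D p =
    card {q \<in> D. fst q < fst p \<or> (fst q = fst p \<and> snd q \<le> snd p)}"

definition col_filling :: "diagram \<Rightarrow> nat \<times> nat \<Rightarrow> nat"
  where "col_filling D p =
    card {q \<in> D. snd q < snd p \<or> (snd q = snd p \<and> fst q \<le> fst p)}"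

definition diagram_perm :: "diagram \<Rightarrow> nat \<Rightarrow> nat"
  where "diagram_perm D =
    (THE w. w permutes {1..card D} \<and> (\<forall>p\<in>D. w (row_filling D p) = col_filling D p))"

text \<open>
  \<open>is_min_diagram d lam D\<close>: among the diagrams with row-composition \<open>lam\<close> and permutation \<open>d\<close>,
  \<open>D\<close> has the minimum number of columns.
\<close>

definition is_min_diagram :: "(nat \<Rightarrow> nat) \<Rightarrow> nat list \<Rightarrow> diagram \<Rightarrow> bool"
  where "is_min_diagram d lam D \<longleftrightarrow> D \<in> diagrams lam \<and> diagram_perm D = d \<and>
    (\<forall>E\<in>diagrams lam. diagram_perm E = d \<longrightarrow> num_cols D \<le> num_cols E)"

definition min_diagram :: "(nat \<Rightarrow> nat) \<Rightarrow> nat list \<Rightarrow> diagram"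
  where "min_diagram d lam = (THE D. is_min_diagram d lam D)"


section \<open>Admissibility\<close>

definition is_path :: "diagram \<Rightarrow> (nat \<times> nat) list \<Rightarrow> bool"
  where "is_path D p \<longleftrightarrow>
    set p \<subseteq> D \<and> successively (\<lambda>(a, b) (a', b'). a < a' \<and> b \<le> b') p"

definition is_kpath :: "diagram \<Rightarrow> nat \<Rightarrow> (nat \<times> nat) list list \<Rightarrow> bool"
  where "is_kpath D k ps \<longleftrightarrow> length ps = k \<and> (\<forall>p\<in>set ps. is_path D p) \<and>
    (\<forall>i<k. \<forall>j<k. i \<noteq> j \<longrightarrow> set (ps ! i) \<inter> set (ps ! j) = {})"

definition kpath_length :: "(nat \<times> nat) list list \<Rightarrow> nat"
  where "kpath_length ps = sum_list (map length ps)"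

text \<open>
  For finite \<open>D\<close> this is the maximum of a finite nonempty set: a path has no repeated nodes, and
  empty paths are allowed.
\<close>

definition max_kpath_length :: "diagram \<Rightarrow> nat \<Rightarrow> nat"
  where "max_kpath_length D k = Max {kpath_length ps | ps. is_kpath D k ps}"

definition subsequence_type :: "diagram \<Rightarrow> nat list \<Rightarrow> bool"
  where "subsequence_type D nu \<longleftrightarrow> partition_of (card D) nu \<and>
    (\<forall>k\<in>{1..length nu}. max_kpath_length D k = sum_list (take k nu))"

definition admissible :: "diagram \<Rightarrow> bool"
  where "admissible D \<longleftrightarrow> subsequence_type D (conj_partition (row_comp D))"


section \<open>Extension of diagrams\<close>

definition ext_diagram :: "diagram \<Rightarrow> nat \<Rightarrow> diagram"
  where "ext_diagram D i = insert (num_rows D + 1, i) D"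

definition ext_cols :: "diagram \<Rightarrow> nat set"
  where "ext_cols D = {j \<in> {1..num_cols D}. admissible (ext_diagram D j)}"

definition q_col :: "diagram \<Rightarrow> nat"
  where "q_col D = Min (ext_cols D)"

definition theta_star :: "nat list \<Rightarrow> (nat \<Rightarrow> nat) \<Rightarrow> nat \<Rightarrow> nat"
  where "theta_star lam z =
    (let D = min_diagram z lam in diagram_perm (ext_diagram D (q_col D)))"

end

theory Submission
  imports Defs
begin

text \<open>
  By Greene's theorem, an element \<open>d\<close> that increases on the blocks of $\lambda$ lies in $Z(\lambda)$
  if and only if for each $k$ some union of $k$ increasing subsequences of the word of
  $w_{J(\lambda)} d$ meets each block $j$ in $\min(k, \lambda_j)$ letters: then all initial segments
  of blocks have the extremal shape, and the recording tableau is forced because decreasing blocks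
  add vertical strips.  On a diagram the same condition is admissibility, since paths correspond to
  increasing subsequences.

  Every element of $S_{n+1}$ is $z x_v$ with $z$ in $S_n$.  The condition for $z x_v$ implies the one
  for $z$ and becomes weaker as $v$ grows.  The diagrams $D'_j$ realise those $v$ that follow
  immediately after the last value of a column, and the least $v$ satisfying the condition is of
  this form; so $z\theta_*$ is $z x_v$ for that $v$.  As a smaller $v$ means a longer $x_v$, this
  gives (i), and (ii) follows because prefixes are compared by inclusion of inversion sets.
\<close>

section \<open>Greene's theorem\<close>

text \<open>Two obstacles shape the argument. Right cells compare recording tableaux, while Greene's
  theorem sees only shapes. The bridge is an extremal bound: a decreasing block is a clique of the
  inversion graph, so a set without cliques of \<open>k + 1\<close> vertices has at most
  \<open>min k l\<close> letters in a block of length \<open>l\<close>, and these bounds add up to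
  the sum of the first \<open>k\<close> parts of the conjugate partition. If that sum is attained on
  the whole word, it is attained on every initial run of blocks, since the remaining blocks obey the
  same bound. The other obstacle is that an optimal family of \<open>k\<close> subsequences has to
  be carried through Knuth moves. Forbidding large cliques instead of naming \<open>k\<close>
  subsequences makes a move the change of one edge, repaired by exchanging one vertex; a splitting
  into \<open>k\<close> chains is needed only for diagrams, where paths are named explicitly. The
  optimal sets for different \<open>k\<close> need not be nested, so every criterion quantifies over
  \<open>k\<close> outside the choice of the set.\<close>

text \<open>
  Unions of \<open>k\<close> increasing subsequences (or of \<open>k\<close> paths) enter as sets that contain no decreasing
  subsequence of length \<open>k + 1\<close>, that is, no clique with \<open>k + 1\<close> vertices in the graph of inversions.
\<close>

definition clique_le :: "('a \<Rightarrow> 'a \<Rightarrow> bool) \<Rightarrow> nat \<Rightarrow> 'a set \<Rightarrow> bool"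
  where "clique_le adj k A \<longleftrightarrow> finite A \<and> (\<forall>C\<subseteq>A. pairwise adj C \<longrightarrow> card C \<le> k)"

lemma clique_leD: "clique_le adj k A \<Longrightarrow> C \<subseteq> A \<Longrightarrow> pairwise adj C \<Longrightarrow> card C \<le> k"
  by (simp add: clique_le_def)

lemma clique_le_finite: "clique_le adj k A \<Longrightarrow> finite A"
  by (simp add: clique_le_def)

lemma clique_le_antimono:
  assumes "clique_le adj' k A" "\<And>a b. a \<in> A \<Longrightarrow> b \<in> A \<Longrightarrow> adj a b \<Longrightarrow> adj' a b"
  shows "clique_le adj k A"
  using assms unfolding clique_le_def pairwise_def by (meson subsetD)

lemma clique_le_subset: "clique_le adj k A \<Longrightarrow> B \<subseteq> A \<Longrightarrow> clique_le adj k B"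
  unfolding clique_le_def by (meson finite_subset subset_trans)

text \<open>A clique of the image pulls back to a clique of \<open>A\<close>, so \<open>f\<close>
  only has to reflect adjacency. The transports between letters, positions and nodes rest on
  this.\<close>

lemma clique_le_image:
  assumes "clique_le adj k A" "inj_on f A"
    and "\<And>a b. a \<in> A \<Longrightarrow> b \<in> A \<Longrightarrow> a \<noteq> b \<Longrightarrow> adj' (f a) (f b) \<Longrightarrow> adj a b"
  shows "clique_le adj' k (f ` A)"
  unfolding clique_le_def
proof (intro conjI allI impI)
  show "finite (f ` A)" using assms(1) by (simp add: clique_le_def)
  fix C assume C: "C \<subseteq> f ` A" "pairwise adj' C"
  define B where "B = {a\<in>A. f a \<in> C}"
  have B: "C = f ` B" "B \<subseteq> A" using C(1) by (auto simp: B_def)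
  have "pairwise adj B"
    using C(2) assms(2,3) unfolding pairwise_def B_def inj_on_def by (smt (verit) mem_Collect_eq)
  then have "card B \<le> k" using clique_leD[OF assms(1) B(2)] by blast
  moreover have "finite B" using B(2) assms(1) finite_subset by (auto simp: clique_le_def)
  ultimately show "card C \<le> k" using card_image_le[of B f] B(1) by simp
qed

text \<open>
  A Knuth move only adds or removes the edge between \<open>x\<close> and \<open>z\<close>; \<open>P\<close> and \<open>F\<close> hold for the letters on
  either side of the move.  If both \<open>A\<close> and the set with \<open>x\<close> exchanged for \<open>y\<close> violate the bound after
  the edge is added, then recombining the two offending cliques yields two old cliques in \<open>A\<close>
  with at least \<open>2 * k + 1\<close> vertices in total.
\<close>

lemma clique_le_exchange:
  assumes good: "clique_le adj k A"
    and sym: "\<And>a b. adj a b \<Longrightarrow> adj b a"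
    and adj': "\<And>a b. adj' a b \<longleftrightarrow> adj a b \<or> (a = x \<and> b = z) \<or> (a = z \<and> b = x)"
    and xyz: "x \<noteq> y" "y \<noteq> z" "x \<noteq> z" "adj x y" "\<not> adj y z"
    and PF: "\<And>c. c \<in> A - {x,y,z} \<Longrightarrow> P c \<or> F c"
    and P: "\<And>c. P c \<Longrightarrow> adj c z \<Longrightarrow> adj c y" "\<And>c. P c \<Longrightarrow> adj c y \<Longrightarrow> adj c x"
    and F: "\<And>c. F c \<Longrightarrow> adj c x \<Longrightarrow> adj c y" "\<And>c. F c \<Longrightarrow> adj c y \<Longrightarrow> adj c z"
    and PF1: "\<And>b a. P b \<Longrightarrow> F a \<Longrightarrow> adj b z \<Longrightarrow> adj a y \<Longrightarrow> adj a b"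
    and PF2: "\<And>b a. P b \<Longrightarrow> F a \<Longrightarrow> adj b y \<Longrightarrow> adj a x \<Longrightarrow> adj a b"
  shows "\<exists>A'\<subseteq>insert y A. card A' = card A \<and> clique_le adj' k A'"
proof (cases "clique_le adj' k A")
  case True
  then show ?thesis by blast
next
  case False
  have fin: "finite A" using good by (simp add: clique_le_def)
  obtain C where C: "C \<subseteq> A" "pairwise adj' C" "card C > k"
    using False fin by (auto simp: clique_le_def not_le)
  have pw: "pairwise adj E" if "pairwise adj' E" "x \<notin> E \<or> z \<notin> E" for E
    using that unfolding pairwise_def adj' by blast
  have xC: "x \<in> C" and zC: "z \<in> C"
    using pw[OF C(2)] clique_leD[OF good C(1)] C(3) by (meson leD)+
  have finC: "finite C" using C(1) fin finite_subset by blast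
  have "\<not> adj' y z" using xyz adj' by auto
  then have yC: "y \<notin> C" using C(2) zC xyz unfolding pairwise_def by blast
  have Cx: "adj c x" and Cz: "adj c z" if "c \<in> C - {x,z}" for c
    using that C(2) xC zC unfolding pairwise_def adj' by blast+
  have Cc: "adj c c'" if "c \<in> C - {x,z}" "c' \<in> C - {x,z}" "c \<noteq> c'" for c c'
    using that C(2) unfolding pairwise_def adj' by blast
  have PFC: "P c \<or> F c" if "c \<in> C - {x,z}" for c
    using that PF C(1) yC by blast
  show ?thesis
  proof (cases "y \<in> A")
    case True
    \<comment> \<open>Every other vertex of \<open>C\<close> is adjacent to \<open>y\<close>, so
      exchanging \<open>z\<close> for \<open>y\<close> turns \<open>C\<close> into an old clique of
      the same size inside \<open>A\<close>, which the bound excludes.\<close>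
    define E where "E = insert y (C - {z})"
    have cy: "adj c y" if "c \<in> C - {z}" for c
      using that PFC[of c] Cx[of c] Cz[of c] P(1) F(1) xyz(4) by blast
    have pC: "pairwise adj (C - {z})"
      using pw[of "C - {z}"] pairwise_subset[OF C(2), of "C - {z}"] by blast
    have "pairwise adj E"
      unfolding E_def pairwise_insert using pC cy sym by blast
    moreover have "E \<subseteq> A" using True C(1) by (auto simp: E_def)
    moreover have "card E = card C"
      unfolding E_def using yC zC finC card_Suc_Diff1[of C z] by simp
    ultimately show ?thesis using clique_leD[OF good, of E] C(3) by simp
  next
    case False
    define A' where "A' = insert y (A - {x})"
    have xA: "x \<in> A" and zA: "z \<in> A" using xC zC C(1) by auto
    have cA': "card A' = card A"
      unfolding A'_def using False xA fin card_Suc_Diff1[of A x] by simp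
    have "clique_le adj' k A'"
    proof (rule ccontr)
      assume "\<not> clique_le adj' k A'"
      then obtain C2 where C2: "C2 \<subseteq> A'" "pairwise adj' C2" "card C2 > k"
        using fin by (auto simp: clique_le_def A'_def not_le)
      have x2: "x \<notin> C2" using C2(1) xyz by (auto simp: A'_def)
      have y2: "y \<in> C2"
      proof (rule ccontr)
        assume "y \<notin> C2"
        then have "C2 \<subseteq> A" using C2(1) by (auto simp: A'_def)
        then show False using pw[OF C2(2)] x2 clique_leD[OF good, of C2] C2(3) by simp
      qed
      have z2: "z \<notin> C2" using \<open>\<not> adj' y z\<close> C2(2) y2 xyz unfolding pairwise_def by blast
      have fin2: "finite C2" using C2(1) fin finite_subset by (auto simp: A'_def)
      have C2y: "adj c y" if "c \<in> C2 - {y}" for c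
        using that C2(2) y2 xyz unfolding pairwise_def adj' by blast
      have C2c: "adj c c'" if "c \<in> C2 - {y}" "c' \<in> C2 - {y}" "c \<noteq> c'" for c c'
        using that C2(2) x2 unfolding pairwise_def adj' by blast
      have PF2': "P c \<or> F c" if "c \<in> C2 - {y}" for c
        using that PF[of c] C2(1) z2 x2 by (auto simp: A'_def)
      \<comment> \<open>\<open>C\<close> contains both \<open>x\<close> and \<open>z\<close>, while
        \<open>C2\<close> contains \<open>y\<close> and neither of them. Trading the halves
        \<open>D\<close> and \<open>D2\<close> and keeping one of \<open>x\<close>, \<open>z\<close>
        on each side loses only the vertex \<open>y\<close> in the total, so one of the two new
        cliques still exceeds \<open>k\<close>.\<close>
      define B where "B = {c \<in> C - {x,z}. P c}"
      define D where "D = {c \<in> C - {x,z}. \<not> P c}"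
      define B2 where "B2 = {c \<in> C2 - {y}. P c}"
      define D2 where "D2 = {c \<in> C2 - {y}. \<not> P c}"
      have fins: "finite B" "finite D" "finite B2" "finite D2"
        using finC fin2 by (auto simp: B_def D_def B2_def D2_def)
      have "C = insert x (insert z (B \<union> D))" using xC zC by (auto simp: B_def D_def)
      moreover have "x \<notin> B \<union> D" "z \<notin> B \<union> D" "B \<inter> D = {}" by (auto simp: B_def D_def)
      ultimately have cC: "card C = card B + card D + 2"
        using fins xyz by (simp add: card_Un_disjoint)
      have "C2 = insert y (B2 \<union> D2)" using y2 by (auto simp: B2_def D2_def)
      moreover have "y \<notin> B2 \<union> D2" "B2 \<inter> D2 = {}" by (auto simp: B2_def D2_def)
      ultimately have cC2: "card C2 = card B2 + card D2 + 1"
        using fins by (simp add: card_Un_disjoint)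
      have 1: "pairwise adj (insert z (B \<union> D2))"
      proof (rule pairwiseI)
        fix a b assume ab: "a \<in> insert z (B \<union> D2)" "b \<in> insert z (B \<union> D2)" "a \<noteq> b"
        have "adj c z" if "c \<in> B \<union> D2" for c
          using that Cz[of c] C2y[of c] F(2)[of c] PF2'[of c] unfolding B_def D2_def by blast
        moreover have "adj c c'" if "c \<in> B" "c' \<in> D2" for c c'
        proof -
          have "F c'" "P c" "adj c z" "adj c' y"
            using that PF2'[of c'] Cz[of c] C2y[of c'] unfolding B_def D2_def by blast+
          then show ?thesis using PF1 sym by blast
        qed
        moreover have "adj c c'" if "c \<in> B" "c' \<in> B" "c \<noteq> c'" for c c'
          using that Cc unfolding B_def by blast
        moreover have "adj c c'" if "c \<in> D2" "c' \<in> D2" "c \<noteq> c'" for c c'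
          using that C2c unfolding D2_def by blast
        ultimately show "adj a b" using ab sym by blast
      qed
      have 2: "pairwise adj (insert x (B2 \<union> D))"
      proof (rule pairwiseI)
        fix a b assume ab: "a \<in> insert x (B2 \<union> D)" "b \<in> insert x (B2 \<union> D)" "a \<noteq> b"
        have "adj c x" if "c \<in> B2 \<union> D" for c
          using that Cx[of c] C2y[of c] P(2)[of c] unfolding B2_def D_def by blast
        moreover have "adj c c'" if "c \<in> B2" "c' \<in> D" for c c'
        proof -
          have "F c'" "P c" "adj c y" "adj c' x"
            using that PFC[of c'] Cx[of c'] C2y[of c] unfolding B2_def D_def by blast+
          then show ?thesis using PF2 sym by blast
        qed
        moreover have "adj c c'" if "c \<in> B2" "c' \<in> B2" "c \<noteq> c'" for c c'
          using that C2c unfolding B2_def by blast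
        moreover have "adj c c'" if "c \<in> D" "c' \<in> D" "c \<noteq> c'" for c c'
          using that Cc unfolding D_def by blast
        ultimately show "adj a b" using ab sym by blast
      qed
      have s1: "insert z (B \<union> D2) \<subseteq> A" and s2: "insert x (B2 \<union> D) \<subseteq> A"
        using xA zA C(1) C2(1) by (auto simp: B_def D_def B2_def D2_def A'_def)
      have "z \<notin> B \<union> D2" "B \<inter> D2 = {}" "x \<notin> B2 \<union> D" "B2 \<inter> D = {}"
        using z2 x2 by (auto simp: B_def D_def B2_def D2_def)
      then have "card (insert z (B \<union> D2)) = card B + card D2 + 1"
        "card (insert x (B2 \<union> D)) = card B2 + card D + 1"
        using fins by (simp_all add: card_Un_disjoint)
      then show False
        using clique_leD[OF good s1 1] clique_leD[OF good s2 2] cC cC2 C(3) C2(3) by linarith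
    qed
    then show ?thesis using cA' by (intro exI[of _ A']) (auto simp: A'_def)
  qed
qed

section \<open>Words, inversions and Knuth moves\<close>

fun before :: "'a list \<Rightarrow> 'a \<Rightarrow> 'a \<Rightarrow> bool" where
  "before [] a b = False"
| "before (x # xs) a b = (x = a \<and> b \<in> set xs \<or> before xs a b)"

lemma before_append:
  "before (u @ v) a b \<longleftrightarrow> before u a b \<or> before v a b \<or> (a \<in> set u \<and> b \<in> set v)"
  by (induction u) auto

lemma before_set: "before w a b \<Longrightarrow> a \<in> set w \<and> b \<in> set w"
  by (induction w) auto

lemma before_asym: "distinct w \<Longrightarrow> before w a b \<Longrightarrow> \<not> before w b a"
  by (induction w) (auto dest: before_set)

lemma before_total: "a \<in> set w \<Longrightarrow> b \<in> set w \<Longrightarrow> a \<noteq> b \<Longrightarrow> before w a b \<or> before w b a"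
  by (induction w) auto

definition inverted :: "nat list \<Rightarrow> nat \<Rightarrow> nat \<Rightarrow> bool"
  where "inverted w a b \<longleftrightarrow> (b < a \<and> before w a b) \<or> (a < b \<and> before w b a)"

inductive knuth :: "nat list \<Rightarrow> nat list \<Rightarrow> bool" where
  knuth_refl: "knuth w w"
| knuth_1: "x < y \<Longrightarrow> y < z \<Longrightarrow> knuth (u @ [y,x,z] @ v) (u @ [y,z,x] @ v)"
| knuth_2: "x < y \<Longrightarrow> y < z \<Longrightarrow> knuth (u @ [x,z,y] @ v) (u @ [z,x,y] @ v)"
| knuth_sym: "knuth w w' \<Longrightarrow> knuth w' w"
| knuth_trans: "knuth w w' \<Longrightarrow> knuth w' w'' \<Longrightarrow> knuth w w''"

lemma knuth_append: "knuth w w' \<Longrightarrow> knuth (p @ w @ s) (p @ w' @ s)"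
proof (induction rule: knuth.induct)
  case (knuth_1 x y z u v)
  then show ?case using knuth.knuth_1[of x y z "p @ u" "v @ s"] by simp
next
  case (knuth_2 x y z u v)
  then show ?case using knuth.knuth_2[of x y z "p @ u" "v @ s"] by simp
qed (auto intro: knuth.intros)

lemma knuth_mset: "knuth w w' \<Longrightarrow> mset w = mset w'"
  by (induction rule: knuth.induct) auto

lemma knuth_distinct: "knuth w w' \<Longrightarrow> distinct w \<longleftrightarrow> distinct w'"
  by (metis knuth_mset mset_eq_imp_distinct_iff)

text \<open>The largest such \<open>m\<close> is Greene's invariant of \<open>w\<close>. Recording
  all attained sizes lets a single equivalence under Knuth moves carry both the lower and the upper
  bound.\<close>

definition good_card :: "nat list \<Rightarrow> nat \<Rightarrow> nat \<Rightarrow> bool"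
  where "good_card w k m \<longleftrightarrow> (\<exists>A\<subseteq>set w. clique_le (inverted w) k A \<and> card A = m)"

lemma inverted_sym: "inverted w a b \<Longrightarrow> inverted w b a"
  by (auto simp: inverted_def)

lemma inverted_around:
  assumes "distinct (u @ m @ v)" "t \<in> set m"
  shows "c \<in> set u \<Longrightarrow> inverted (u @ m @ v) c t \<longleftrightarrow> t < c"
    and "c \<in> set v \<Longrightarrow> inverted (u @ m @ v) c t \<longleftrightarrow> c < t"
  using assms by (auto simp: inverted_def before_append dest: before_set)

lemma inverted_outer:
  assumes "distinct (u @ m @ v)" "b \<in> set u" "a \<in> set v"
  shows "inverted (u @ m @ v) a b \<longleftrightarrow> a < b" "inverted (u @ m @ v) b a \<longleftrightarrow> a < b"
  using assms by (auto simp: inverted_def before_append dest: before_set)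

lemma before_outside:
  assumes "distinct (u @ m @ v)" "t \<in> set m"
  shows "\<not> before u t b" "\<not> before u b t" "\<not> before v t b" "\<not> before v b t"
  using assms by (auto dest: before_set)

text \<open>Covers both Knuth moves. The word with \<open>m'\<close> has exactly one inverted pair
  more, so a set for it serves the word with \<open>m\<close> unchanged; the other way is the
  exchange lemma. The second alternative of \<open>PF\<close> is the mirror image of the first, with
  the order of values and the two sides of the word reversed.\<close>

lemma good_card_exchange:
  assumes d: "distinct (u @ m @ v)" and m: "set m = {x, y, z}" "set m' = {x, y, z}"
    and adj': "\<And>a b. inverted (u @ m' @ v) a b \<longleftrightarrow>
      inverted (u @ m @ v) a b \<or> (a = x \<and> b = z) \<or> (a = z \<and> b = x)"
    and e: "inverted (u @ m @ v) x y" "\<not> inverted (u @ m @ v) y z"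
    and PF: "x < y \<and> y < z \<and> P = set u \<and> F = set v \<or> z < y \<and> y < x \<and> P = set v \<and> F = set u"
  shows "good_card (u @ m @ v) k c \<longleftrightarrow> good_card (u @ m' @ v) k c"
proof
  let ?w = "u @ m @ v" and ?w' = "u @ m' @ v"
  {
    assume "good_card ?w k c"
    then obtain A where A: "A \<subseteq> set ?w" "clique_le (inverted ?w) k A" "card A = c"
      by (auto simp: good_card_def)
    have xyz: "x \<in> set m" "y \<in> set m" "z \<in> set m" using m(1) by auto
    note ar = inverted_around[OF d xyz(1)] inverted_around[OF d xyz(2)] inverted_around[OF d xyz(3)]
      and io = inverted_outer[OF d]
    have "\<exists>A'\<subseteq>insert y A. card A' = card A \<and> clique_le (inverted ?w') k A'"
    proof (rule clique_le_exchange[OF A(2) inverted_sym adj' _ _ _ e,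
        where P = "\<lambda>c. c \<in> P" and F = "\<lambda>c. c \<in> F"])
      show "c \<in> P \<or> c \<in> F" if "c \<in> A - {x, y, z}" for c
        using that A(1) m(1) PF by auto
    qed (use PF in \<open>auto simp: ar io\<close>)
    then obtain A' where A': "A' \<subseteq> insert y A" "card A' = card A" "clique_le (inverted ?w') k A'"
      by blast
    have "A' \<subseteq> set ?w'" using A(1) A'(1) m by auto
    then show "good_card ?w' k c" unfolding good_card_def using A(3) A'(2,3) by blast
  }
  {
    assume "good_card ?w' k c"
    then obtain A where A: "A \<subseteq> set ?w'" "clique_le (inverted ?w') k A" "card A = c"
      by (auto simp: good_card_def)
    have "clique_le (inverted ?w) k A"
      using adj' by (blast intro: clique_le_antimono[OF A(2)])
    then show "good_card ?w k c" using A(1,3) m unfolding good_card_def by (intro exI[of _ A]) auto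
  }
qed

lemma good_card_knuth_1:
  assumes d: "distinct (u @ [y, x, z] @ v)" and lt: "x < y" "y < z"
  shows "good_card (u @ [y, x, z] @ v) k c \<longleftrightarrow> good_card (u @ [y, z, x] @ v) k c"
proof (rule good_card_exchange[OF d, where x = x and y = y and z = z and P = "set u" and F = "set v"])
  note bf = before_outside[OF d, of x] before_outside[OF d, of y] before_outside[OF d, of z]
  show "inverted (u @ [y, z, x] @ v) a b \<longleftrightarrow>
      inverted (u @ [y, x, z] @ v) a b \<or> (a = x \<and> b = z) \<or> (a = z \<and> b = x)" for a b
    using d lt bf by (auto simp: inverted_def before_append)
  show "inverted (u @ [y, x, z] @ v) x y" "\<not> inverted (u @ [y, x, z] @ v) y z"
    using d lt bf by (auto simp: inverted_def before_append)
qed (use lt in auto)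

text \<open>The pair \<open>x\<close>, \<open>z\<close> now gains its inversion in front of
  \<open>y\<close> instead of behind it, so the exchange is applied with these letters swapped and
  with prefix and suffix in each other's place.\<close>

lemma good_card_knuth_2:
  assumes d: "distinct (u @ [x, z, y] @ v)" and lt: "x < y" "y < z"
  shows "good_card (u @ [x, z, y] @ v) k c \<longleftrightarrow> good_card (u @ [z, x, y] @ v) k c"
proof (rule good_card_exchange[OF d, where x = z and y = y and z = x and P = "set v" and F = "set u"])
  note bf = before_outside[OF d, of x] before_outside[OF d, of y] before_outside[OF d, of z]
  show "inverted (u @ [z, x, y] @ v) a b \<longleftrightarrow>
      inverted (u @ [x, z, y] @ v) a b \<or> (a = z \<and> b = x) \<or> (a = x \<and> b = z)" for a b
    using d lt bf by (auto simp: inverted_def before_append)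
  show "inverted (u @ [x, z, y] @ v) z y" "\<not> inverted (u @ [x, z, y] @ v) y x"
    using d lt bf by (auto simp: inverted_def before_append)
qed (use lt in auto)

lemma good_card_knuth: "knuth w w' \<Longrightarrow> distinct w \<Longrightarrow> good_card w k m \<longleftrightarrow> good_card w' k m"
proof (induction rule: knuth.induct)
  case (knuth_1 x y z u v)
  then show ?case by (intro good_card_knuth_1)
next
  case (knuth_2 x y z u v)
  then show ?case by (intro good_card_knuth_2)
next
  case (knuth_sym w w')
  then show ?case using knuth_distinct by blast
next
  case (knuth_trans w w' w'')
  then show ?case using knuth_distinct by blast
qed simp

section \<open>Row insertion and tableaux\<close>

lemma row_insert_None: "row_insert x r = (r', None) \<Longrightarrow> r' = r @ [x]"
  by (induction r arbitrary: r') (auto split: if_splits prod.splits)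

lemma row_insert_less: "row_insert x r = (r', Some y) \<Longrightarrow> x < y"
  by (induction r arbitrary: r') (auto split: if_splits prod.splits)

lemma row_insert_length: "row_insert x r = (r', Some y) \<Longrightarrow> length r' = length r"
  by (induction r arbitrary: r') (auto split: if_splits prod.splits)

lemma row_insert_set: "row_insert x r = (r', b) \<Longrightarrow> set r' \<subseteq> insert x (set r)"
  by (induction r arbitrary: r') (fastforce split: if_splits prod.splits)+

lemma row_insert_mem: "row_insert x r = (r', Some y) \<Longrightarrow> y \<in> set r"
  by (induction r arbitrary: r') (auto split: if_splits prod.splits)

lemma row_insert_hd: "row_insert x r = (r', b) \<Longrightarrow> r' \<noteq> [] \<and> hd r' \<le> x"
  by (cases r) (auto split: if_splits prod.splits)

lemma row_insert_sorted:
  "row_insert x r = (r', b) \<Longrightarrow> sorted_wrt (<) r \<Longrightarrow> x \<notin> set r \<Longrightarrow> sorted_wrt (<) r'"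
proof (induction r arbitrary: r')
  case (Cons a r)
  show ?case
  proof (cases "x < a")
    case True
    then show ?thesis using Cons.prems by fastforce
  next
    case False
    obtain zs where zs: "row_insert x r = (zs, b)" "r' = a # zs"
      using Cons.prems(1) False by (auto split: prod.splits)
    have "sorted_wrt (<) zs" using Cons zs by auto
    then show ?thesis using row_insert_set[OF zs(1)] zs(2) Cons.prems(2,3) False by fastforce
  qed
qed auto

lemma knuth_Cons: "knuth w w' \<Longrightarrow> knuth (a # w) (a # w')"
  using knuth_append[of w w' "[a]" "[]"] by simp

text \<open>Each entry passed by \<open>x\<close> has a left neighbour whose value lies between
  \<open>x\<close> and that entry; this is the witness that the first Knuth relation asks
  for.\<close>

lemma knuth_insert_hd:
  "sorted_wrt (<) (y # ys) \<Longrightarrow> x < y \<Longrightarrow> knuth (y # ys @ [x]) (y # x # ys)"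
proof (induction ys arbitrary: y)
  case Nil
  show ?case by (simp add: knuth_refl)
next
  case (Cons y1 ys)
  have "knuth (y # (y1 # ys @ [x])) (y # (y1 # x # ys))"
    by (rule knuth_Cons, rule Cons.IH) (use Cons.prems in auto)
  moreover have "knuth (y # y1 # x # ys) (y # x # y1 # ys)"
    using knuth_sym[OF knuth_1[of x y y1 "[]" ys]] Cons.prems by simp
  ultimately show ?case using knuth_trans by auto
qed

text \<open>Once \<open>x\<close> has moved up to the entry \<open>y\<close> that it bumps,
  \<open>y\<close> travels left over each smaller entry \<open>a\<close>. The entry \<open>z\<close>
  then standing to the right of \<open>y\<close> satisfies \<open>a < z < y\<close> and is the
  witness for the second Knuth relation.\<close>

lemma row_insert_knuth:
  "row_insert x r = (r', Some y) \<Longrightarrow> sorted_wrt (<) r \<Longrightarrow> x \<notin> set r \<Longrightarrow> knuth (r @ [x]) (y # r')"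
proof (induction r arbitrary: r')
  case (Cons a r)
  show ?case
  proof (cases "x < a")
    case True
    then show ?thesis using Cons.prems knuth_insert_hd[of a r x] by auto
  next
    case False
    obtain zs where zs: "row_insert x r = (zs, Some y)" "r' = a # zs"
      using Cons.prems(1) False by (auto split: prod.splits)
    obtain z zs' where z: "zs = z # zs'" "z \<le> x"
      using row_insert_hd[OF zs(1)] by (cases zs) auto
    have "a < z" using row_insert_set[OF zs(1)] z(1) Cons.prems False by fastforce
    moreover have "z < y" using z(2) row_insert_less[OF zs(1)] by simp
    ultimately have "knuth (a # y # z # zs') (y # a # z # zs')"
      using knuth_2[of a z y "[]" zs'] by simp
    moreover have "knuth (a # r @ [x]) (a # y # zs)"
      by (rule knuth_Cons, rule Cons.IH) (use Cons.prems zs in auto)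
    ultimately show ?thesis using z(1) zs(2) knuth_trans by auto
  qed
qed auto

fun row_above :: "nat list \<Rightarrow> nat list \<Rightarrow> bool" where
  "row_above r [] = True"
| "row_above [] (b # s) = False"
| "row_above (a # r) (b # s) = (a < b \<and> row_above r s)"

lemma above_nth: "row_above r s \<longleftrightarrow> length s \<le> length r \<and> (\<forall>c<length s. r ! c < s ! c)"
  by (induction r s rule: row_above.induct) (auto simp: nth_Cons less_Suc_eq_0_disj split: nat.splits)

lemma above_trans: "row_above r s \<Longrightarrow> row_above s t \<Longrightarrow> row_above r t"
  unfolding above_nth by (meson less_trans less_le_trans le_trans)

lemma row_insert_above1: "row_insert x r = (r', b) \<Longrightarrow> row_above r s \<Longrightarrow> row_above r' s"
proof (induction r s arbitrary: r' rule: row_above.induct)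
  case (3 a r b' s)
  then show ?case by (auto split: if_splits prod.splits)
qed auto

text \<open>The entry below the place that \<open>y\<close> left is larger than \<open>y\<close>, so
  \<open>y\<close> lands in that column or further left, and the entries now above it are smaller
  than \<open>y\<close>.\<close>

lemma row_insert_above2:
  "row_insert x r = (r', Some y) \<Longrightarrow> row_above r s \<Longrightarrow> row_above r' (fst (row_insert y s))"
proof (induction r arbitrary: r' s)
  case (Cons a r)
  show ?case
  proof (cases "x < a")
    case True
    then show ?thesis using Cons.prems by (cases s) auto
  next
    case False
    obtain zs where zs: "row_insert x r = (zs, Some y)" "r' = a # zs"
      using Cons.prems(1) False by (auto split: prod.splits)
    have "a < y" using row_insert_less[OF zs(1)] False by simp
    then show ?thesis
      using Cons.prems(2) zs Cons.IH[OF zs(1), of "tl s"] row_insert_above1[OF zs(1)]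
      by (cases s) (auto split: prod.splits)
  qed
qed auto

definition reading_word :: "nat list list \<Rightarrow> nat list"
  where "reading_word T = concat (rev T)"

definition is_tableau :: "nat list list \<Rightarrow> bool"
  where "is_tableau T \<longleftrightarrow> (\<forall>r\<in>set T. sorted_wrt (<) r) \<and> successively row_above T \<and>
    distinct (reading_word T)"

lemma set_reading_word: "set (reading_word T) = \<Union> (set ` set T)"
  by (simp add: reading_word_def)

lemma reading_word_Cons: "reading_word (r # T) = reading_word T @ r"
  by (simp add: reading_word_def)

text \<open>A missing row behaves like an empty one, so the first two rows after a bump can be
  compared without asking whether the second existed before.\<close>

lemma tab_insert_hd:
  "fst (tab_insert x T) \<noteq> [] \<and>
   hd (fst (tab_insert x T)) = fst (row_insert x (if T = [] then [] else hd T))"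
  by (cases T) (auto split: prod.splits option.splits)

lemma tab_insert_shape:
  "tab_insert x T = (T', i) \<Longrightarrow> i \<le> length T \<and> map length T' =
     (if i < length T then (map length T)[i := Suc (length (T ! i))] else map length T @ [1])"
proof (induction T arbitrary: x T' i)
  case (Cons r T)
  show ?case
  proof (cases "snd (row_insert x r)")
    case None
    then obtain r' where "row_insert x r = (r', None)" by (metis prod.collapse)
    then show ?thesis using Cons.prems row_insert_None[of x r r'] by auto
  next
    case (Some y)
    then obtain r' where r': "row_insert x r = (r', Some y)" by (metis prod.collapse)
    obtain T1 j where T1: "tab_insert y T = (T1, j)" by fastforce
    show ?thesis using Cons.prems Cons.IH[OF T1] r' T1 row_insert_length[OF r'] by (auto split: if_splits)
  qed
qed auto

text \<open>Lower rows come first in the reading word, so an entry bumped to the front of its row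
  stands directly behind the word of the rows below, ready for insertion there.\<close>

lemma tab_insert_knuth:
  "tab_insert x T = (T', i) \<Longrightarrow> is_tableau T \<Longrightarrow> x \<notin> set (reading_word T) \<Longrightarrow>
    knuth (reading_word T @ [x]) (reading_word T') \<and>
    (\<forall>r\<in>set T'. sorted_wrt (<) r) \<and> successively row_above T'"
proof (induction T arbitrary: x T' i)
  case Nil
  then show ?case by (auto simp: reading_word_def knuth_refl)
next
  case (Cons r T)
  have tT: "is_tableau T" and sr: "sorted_wrt (<) r" and xr: "x \<notin> set r"
    using Cons.prems(2,3) by (cases T; auto simp: is_tableau_def reading_word_Cons)+
  show ?case
  proof (cases "snd (row_insert x r)")
    case None
    then obtain r' where r': "row_insert x r = (r', None)" by (metis prod.collapse)
    then have T': "T' = r' # T" "r' = r @ [x]" using Cons.prems(1) row_insert_None by auto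
    have "sorted_wrt (<) r'" using row_insert_sorted[OF r' sr xr] .
    moreover have "successively row_above T'"
      using Cons.prems(2) T'(1) row_insert_above1[OF r'] by (cases T) (auto simp: is_tableau_def)
    ultimately show ?thesis using T' Cons.prems(2)
      by (auto simp: reading_word_Cons is_tableau_def knuth_refl)
  next
    case (Some y)
    then obtain r' where r': "row_insert x r = (r', Some y)" by (metis prod.collapse)
    obtain T1 j where T1: "tab_insert y T = (T1, j)" by fastforce
    have T': "T' = r' # T1" using Cons.prems(1) r' T1 by auto
    have yT: "y \<notin> set (reading_word T)"
      using row_insert_mem[OF r'] Cons.prems(2) by (auto simp: is_tableau_def reading_word_Cons)
    note IH = Cons.IH[OF T1 tT yT]
    have "knuth (reading_word T @ (r @ [x])) (reading_word T @ (y # r'))"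
      using knuth_append[OF row_insert_knuth[OF r' sr xr], of "reading_word T" "[]"] by simp
    moreover have "knuth (reading_word T @ [y] @ r') (reading_word T1 @ r')"
      using knuth_append[OF conjunct1[OF IH], of "[]" r'] by simp
    ultimately have "knuth (reading_word (r # T) @ [x]) (reading_word T')"
      using T' knuth_trans by (simp add: reading_word_Cons)
    moreover have "successively row_above T'"
    proof -
      have "row_above r (if T = [] then [] else hd T)"
        using Cons.prems(2) by (cases T) (auto simp: is_tableau_def)
      from row_insert_above2[OF r' this] have "row_above r' (hd T1)" "T1 \<noteq> []"
        using tab_insert_hd[of y T] T1 by auto
      then show ?thesis using IH T' by (cases T1) auto
    qed
    ultimately show ?thesis using IH T' row_insert_sorted[OF r' sr xr] by auto
  qed
qed

lemma tab_insert_tableau: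
  assumes "tab_insert x T = (T', i)" "is_tableau T" "x \<notin> set (reading_word T)"
  shows "is_tableau T'"
proof -
  have "distinct (reading_word T @ [x])" using assms by (auto simp: is_tableau_def)
  then show ?thesis using tab_insert_knuth[OF assms] knuth_distinct[of "reading_word T @ [x]" "reading_word T'"] by (auto simp: is_tableau_def)
qed

lemma before_sorted_wrt: "sorted_wrt R xs \<Longrightarrow> before xs a b \<Longrightarrow> R a b"
  by (induction xs) (auto dest: before_set)

lemma before_concat: "r \<in> set rs \<Longrightarrow> before r a b \<Longrightarrow> before (concat rs) a b"
  by (induction rs) (auto simp: before_append)

lemma before_concat_nth:
  "i < j \<Longrightarrow> j < length rs \<Longrightarrow> a \<in> set (rs ! i) \<Longrightarrow> b \<in> set (rs ! j) \<Longrightarrow> before (concat rs) a b"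
proof (induction rs arbitrary: i j)
  case (Cons r rs)
  then show ?case
    by (cases i; cases j) (auto simp: before_append)
qed auto

lemma tableau_row_not_inverted:
  assumes T: "is_tableau T" and r: "r \<in> set T" and ab: "a \<in> set r" "b \<in> set r" "a \<noteq> b"
  shows "\<not> inverted (reading_word T) a b"
proof -
  have *: "\<not> inverted (reading_word T) a b" if ab: "a \<in> set r" "b \<in> set r" "a < b" for a b
  proof -
    have "before r a b"
      using before_total[of a r b] before_sorted_wrt[of "(<)" r b a] ab T r by (auto simp: is_tableau_def)
    then have "before (reading_word T) a b"
      using before_concat[of r "rev T"] r by (auto simp: reading_word_def)
    then show ?thesis
      using before_asym[of "reading_word T"] T ab(3) by (auto simp: is_tableau_def inverted_def)
  qed
  show ?thesis using *[OF ab(1,2)] *[OF ab(2,1)] inverted_sym ab(3) by (meson nat_neq_iff)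
qed

lemma tableau_above:
  assumes "is_tableau T" "i < j" "j < length T"
  shows "row_above (T ! i) (T ! j)"
proof -
  have "transp row_above" using above_trans by (rule transpI)
  then have "sorted_wrt row_above T"
    using assms(1) successively_conv_sorted_wrt[of row_above T] by (auto simp: is_tableau_def)
  then show ?thesis using assms by (simp add: sorted_wrt_nth_less)
qed

lemma tableau_col_inverted:
  assumes T: "is_tableau T" and ij: "i < j" "j < length T" "c < length (T ! j)"
  shows "inverted (reading_word T) (T ! i ! c) (T ! j ! c)"
proof -
  have ab: "row_above (T ! i) (T ! j)" using tableau_above[OF T ij(1,2)] .
  then have "T ! i ! c < T ! j ! c" "c < length (T ! i)" using ij(3) by (auto simp: above_nth)
  moreover have "before (reading_word T) (T ! j ! c) (T ! i ! c)"
    unfolding reading_word_def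
    by (rule before_concat_nth[of "length T - Suc j" "length T - Suc i"])
       (use ij ab in \<open>auto simp: rev_nth above_nth\<close>)
  ultimately show ?thesis by (simp add: inverted_def)
qed

text \<open>A row contains no inverted pair, so a clique takes at most one entry from each of the
  first \<open>k\<close> rows.\<close>

lemma tableau_good_card:
  assumes T: "is_tableau T"
  shows "good_card (reading_word T) k (sum_list (map length (take k T)))"
proof -
  define A where "A = set (reading_word (take k T))"
  have dist: "distinct (reading_word T)" using T by (simp add: is_tableau_def)
  have "reading_word T = reading_word (drop k T) @ reading_word (take k T)"
    using append_take_drop_id[of k T] by (metis concat_append reading_word_def rev_append)
  then have "distinct (reading_word (take k T))" using dist by simp
  then have "card A = length (reading_word (take k T))" by (simp add: A_def distinct_card)
  also have "\<dots> = sum_list (map length (take k T))"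
    by (simp add: reading_word_def length_concat rev_map[symmetric])
  finally have cA: "card A = sum_list (map length (take k T))" .
  have "clique_le (inverted (reading_word T)) k A"
    unfolding clique_le_def
  proof (intro conjI allI impI)
    show "finite A" by (simp add: A_def)
    fix C assume C: "C \<subseteq> A" "pairwise (inverted (reading_word T)) C"
    have "C = (\<Union>r\<in>set (take k T). C \<inter> set r)"
      using C(1) by (auto simp: A_def set_reading_word)
    then have "card C \<le> (\<Sum>r\<in>set (take k T). card (C \<inter> set r))"
      by (metis card_UN_le finite_set)
    also have "\<dots> \<le> (\<Sum>r\<in>set (take k T). 1)"
    proof (rule sum_mono)
      fix r assume "r \<in> set (take k T)"
      then have "r \<in> set T" by (meson in_set_takeD)
      then have "\<forall>a\<in>C \<inter> set r. \<forall>b\<in>C \<inter> set r. a = b"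
        using C(2) tableau_row_not_inverted[OF T] unfolding pairwise_def by blast
      then show "card (C \<inter> set r) \<le> 1"
        using card_le_Suc0_iff_eq[of "C \<inter> set r"] by simp
    qed
    also have "\<dots> \<le> k" by (simp add: card_length le_trans[OF card_length])
    finally show "card C \<le> k" .
  qed
  moreover have "A \<subseteq> set (reading_word T)"
    by (auto simp: A_def set_reading_word dest: in_set_takeD)
  ultimately show ?thesis using cA unfolding good_card_def by blast
qed

text \<open>Columns are cliques, so \<open>A\<close> takes from each at most \<open>k\<close>
  entries, which is also the most that the first \<open>k\<close> rows can contain of it. Counting
  the cells of these rows first by columns and then by rows gives the bound.\<close>

lemma tableau_good_card_le:
  assumes T: "is_tableau T" and g: "good_card (reading_word T) k m"
  shows "m \<le> sum_list (map length (take k T))"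
proof -
  obtain A where A: "A \<subseteq> set (reading_word T)" "clique_le (inverted (reading_word T)) k A" "card A = m"
    using g by (auto simp: good_card_def)
  \<comment> \<open>The total number of entries, a crude bound on the number of columns.\<close>
  define L where "L = (\<Sum>r\<leftarrow>T. length r)"
  define H where "H c = {i. i < length T \<and> c < length (T ! i)}" for c
  define col where "col c = (\<lambda>i. T ! i ! c) ` H c" for c
  have finA: "finite A" using A(2) by (simp add: clique_le_def)
  have L: "length (T ! i) \<le> L" if "i < length T" for i
    unfolding L_def using that by (simp add: elem_le_sum_list member_le_sum_list)
  have "A \<subseteq> (\<Union>c<L. A \<inter> col c)"
  proof
    fix a assume a: "a \<in> A"
    then obtain r where "r \<in> set T" "a \<in> set r" using A(1) by (auto simp: set_reading_word)
    then obtain i c where ic: "i < length T" "c < length (T ! i)" "a = T ! i ! c"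
      by (metis in_set_conv_nth)
    then have "a \<in> col c" by (auto simp: col_def H_def)
    moreover have "c < L" using L[OF ic(1)] ic(2) by simp
    ultimately show "a \<in> (\<Union>c<L. A \<inter> col c)" using a by blast
  qed
  then have "m \<le> card (\<Union>c<L. A \<inter> col c)"
    using A(3) finA by (metis (no_types, lifting) card_mono finite_Int finite_UN finite_lessThan)
  also have "\<dots> \<le> (\<Sum>c<L. card (A \<inter> col c))" by (rule card_UN_le) simp
  also have "\<dots> \<le> (\<Sum>c<L. card ({..<k} \<inter> H c))"
  proof (rule sum_mono)
    fix c
    have fH: "finite (H c)" by (simp add: H_def)
    have down: "i \<in> H c" if "j \<in> H c" "i < j" for i j
      using that tableau_above[OF T, of i j] by (auto simp: H_def above_nth)
    show "card (A \<inter> col c) \<le> card ({..<k} \<inter> H c)"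
    proof (cases "H c \<subseteq> {..<k}")
      case True
      then have "{..<k} \<inter> H c = H c" by blast
      then show ?thesis
        using card_image_le[OF fH, of "\<lambda>i. T ! i ! c"] card_mono[of "col c" "A \<inter> col c"] fH
        by (simp add: col_def)
    next
      case False
      \<comment> \<open>Columns have no gaps, so a column with a cell in some row \<open>j\<close>
        with \<open>k \<le> j\<close> meets all of the first \<open>k\<close> rows, and the clique
        bound suffices.\<close>
      then obtain j where "j \<in> H c" "k \<le> j" by (meson lessThan_iff not_less subsetI)
      then have "{..<k} \<inter> H c = {..<k}" using down by auto
      moreover have "pairwise (inverted (reading_word T)) (col c)"
        unfolding col_def
      proof (rule pairwise_imageI)
        fix i j assume "i \<in> H c" "j \<in> H c" "i \<noteq> j"
        then show "inverted (reading_word T) (T ! i ! c) (T ! j ! c)"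
          using tableau_col_inverted[OF T, of i j c] tableau_col_inverted[OF T, of j i c] inverted_sym
          by (cases "i < j") (auto simp: H_def)
      qed
      then have "card (A \<inter> col c) \<le> k"
        using clique_leD[OF A(2) Int_lower1] pairwise_subset[OF _ Int_lower2] by blast
      ultimately show ?thesis by simp
    qed
  qed
  also have "\<dots> = (\<Sum>c<L. \<Sum>i\<in>{..<k} \<inter> {..<length T}. if c < length (T ! i) then 1 else 0)"
  proof (rule sum.cong[OF refl])
    fix c
    have "{..<k} \<inter> H c = {i \<in> {..<k} \<inter> {..<length T}. c < length (T ! i)}" by (auto simp: H_def)
    then show "card ({..<k} \<inter> H c) = (\<Sum>i\<in>{..<k} \<inter> {..<length T}. if c < length (T ! i) then 1 else 0)"
      by (simp add: sum.inter_filter[symmetric])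
  qed
  also have "\<dots> = (\<Sum>i\<in>{..<k} \<inter> {..<length T}. \<Sum>c<L. if c < length (T ! i) then 1 else 0)"
    by (rule sum.swap)
  also have "\<dots> = (\<Sum>i\<in>{..<k} \<inter> {..<length T}. length (T ! i))"
  proof (rule sum.cong[OF refl])
    fix i assume "i \<in> {..<k} \<inter> {..<length T}"
    then have "{c \<in> {..<L}. c < length (T ! i)} = {..<length (T ! i)}" using L[of i] by auto
    then show "(\<Sum>c<L. if c < length (T ! i) then 1 else 0) = length (T ! i)"
      by (simp add: sum.inter_filter[symmetric])
  qed
  also have "{..<k} \<inter> {..<length T} = {0..<length (take k T)}" by auto
  also have "(\<Sum>i\<in>\<dots>. length (T ! i)) = sum_list (map length (take k T))"
    by (simp add: sum_list_sum_nth)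
  finally show ?thesis .
qed

section \<open>Insertion of whole words and the sequence of new boxes\<close>

definition insert_word :: "nat list list \<Rightarrow> nat list \<Rightarrow> nat list list"
  where "insert_word = foldl (\<lambda>T x. fst (tab_insert x T))"

text \<open>The recording tableau is a function of the rows in which new boxes appear, so equal
  lists of boxes give equal recording tableaux and the entries of \<open>Q\<close> need not be
  inspected.\<close>

fun boxes :: "nat list list \<Rightarrow> nat list \<Rightarrow> nat list" where
  "boxes T [] = []"
| "boxes T (x # w) = snd (tab_insert x T) # boxes (fst (tab_insert x T)) w"

fun add_boxes :: "nat \<Rightarrow> nat list \<Rightarrow> nat list list \<Rightarrow> nat list list" where
  "add_boxes k [] Q = Q"
| "add_boxes k (i # is) Q = add_boxes (Suc k) is (add_box k i Q)"

text \<open>The default 0 below the last row lets shapes with different numbers of rows be compared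
  pointwise.\<close>

definition row_length :: "nat list list \<Rightarrow> nat \<Rightarrow> nat"
  where "row_length T i = (if i < length T then length (T ! i) else 0)"

lemma insert_word_simps [simp]:
  "insert_word T [] = T" "insert_word T (x # w) = insert_word (fst (tab_insert x T)) w"
  "insert_word T (u @ v) = insert_word (insert_word T u) v"
  by (simp_all add: insert_word_def)

lemma boxes_append: "boxes T (u @ v) = boxes T u @ boxes (insert_word T u) v"
  by (induction u arbitrary: T) auto

lemma fold_rs_step:
  "fold rs_step (List.enumerate k w) (T, Q) = (insert_word T w, add_boxes k (boxes T w) Q)"
  by (induction w arbitrary: k T Q) (auto simp: rs_step_def split: prod.splits)

lemma row_length_tab_insert:
  "row_length (fst (tab_insert x T)) i = row_length T i + (if i = snd (tab_insert x T) then 1 else 0)"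
proof -
  obtain T' j where T': "tab_insert x T = (T', j)" by fastforce
  have row: "row_length U i = (if i < length (map length U) then map length U ! i else 0)" for U i
    by (simp add: row_length_def)
  show ?thesis
    using tab_insert_shape[OF T'] T' unfolding row
    by (auto simp: nth_list_update nth_append)
qed

lemma count_boxes: "count_list (boxes T w) i + row_length T i = row_length (insert_word T w) i"
proof (induction w arbitrary: T)
  case (Cons x w)
  show ?case
    using Cons.IH[of "fst (tab_insert x T)"] by (simp add: row_length_tab_insert split: if_splits)
qed simp

text \<open>Insertion tableau and recording tableau grow by the same box, so equal recording
  tableaux belong to insertion tableaux of equal shape.\<close>

lemma map_length_add_boxes:
  "map length Q = map length T \<Longrightarrow> map length (add_boxes k (boxes T w) Q) = map length (insert_word T w)"
proof (induction w arbitrary: k T Q)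
  case (Cons x w)
  obtain T' i where T': "tab_insert x T = (T', i)" by fastforce
  have "length Q = length T" "\<forall>i<length T. length (Q ! i) = length (T ! i)"
    using Cons.prems by (auto simp: list_eq_iff_nth_eq)
  then have "map length (add_box k i Q) = map length T'"
    using tab_insert_shape[OF T'] Cons.prems
    by (auto simp: add_box_def map_update)
  then show ?case using Cons.IH T' by simp
qed simp

lemma insert_word_knuth:
  "is_tableau T \<Longrightarrow> distinct (reading_word T @ w) \<Longrightarrow>
    is_tableau (insert_word T w) \<and> knuth (reading_word T @ w) (reading_word (insert_word T w))"
proof (induction w arbitrary: T)
  case Nil
  then show ?case by (simp add: knuth_refl)
next
  case (Cons x w)
  obtain T' i where T': "tab_insert x T = (T', i)" by fastforce
  have x: "x \<notin> set (reading_word T)" using Cons.prems(2) by auto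
  have "knuth ((reading_word T @ [x]) @ w) (reading_word T' @ w)"
    using knuth_append[of "reading_word T @ [x]" "reading_word T'" "[]" w]
      tab_insert_knuth[OF T' Cons.prems(1) x] by auto
  then have k: "knuth (reading_word T @ x # w) (reading_word T' @ w)" by simp
  then have "distinct (reading_word T' @ w)" using Cons.prems(2) knuth_distinct by blast
  then show ?case
    using Cons.IH[OF tab_insert_tableau[OF T' Cons.prems(1) x]] T' knuth_trans[OF k] by auto
qed

text \<open>This is Greene's theorem for unions of increasing subsequences.\<close>

lemma greene:
  assumes "distinct w"
  shows "good_card w k (sum_list (map length (take k (insert_word [] w))))"
    and "good_card w k m \<Longrightarrow> m \<le> sum_list (map length (take k (insert_word [] w)))"
proof -
  have "is_tableau []" by (simp add: is_tableau_def reading_word_def)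
  then have T: "is_tableau (insert_word [] w)" and k: "knuth w (reading_word (insert_word [] w))"
    using insert_word_knuth[of "[]" w] assms by (auto simp: reading_word_def)
  show "good_card w k (sum_list (map length (take k (insert_word [] w))))"
    using tableau_good_card[OF T] good_card_knuth[OF k assms] by simp
  show "m \<le> sum_list (map length (take k (insert_word [] w)))" if "good_card w k m"
    using tableau_good_card_le[OF T] good_card_knuth[OF k assms] that by simp
qed

section \<open>Growth of the shape along decreasing blocks\<close>

lemma row_length_sum_take:
  "row_length T i = sum_list (map length (take (Suc i) T)) - sum_list (map length (take i T))"
  by (cases "i < length T") (auto simp: row_length_def take_Suc_conv_app_nth)

lemma row_insert_bump:
  "x' < x \<Longrightarrow> row_insert x r = (r', b) \<Longrightarrow> \<exists>r'' y'. row_insert x' r' = (r'', Some y') \<and> y' \<le> x"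
  by (induction r arbitrary: r') (auto split: if_splits prod.splits)

text \<open>As \<open>x\<close> sits in its row when the smaller \<open>x'\<close> arrives,
  \<open>x'\<close> bumps an entry that is at most \<open>x\<close>, hence smaller than whatever
  \<open>x\<close> bumped. The same situation recurs in the next row until the insertion of
  \<open>x\<close> comes to rest.\<close>

lemma tab_insert_bump:
  "x' < x \<Longrightarrow> tab_insert x T = (T', i) \<Longrightarrow> i < snd (tab_insert x' T')"
proof (induction T arbitrary: x x' T' i)
  case (Cons r T)
  obtain r' b where r': "row_insert x r = (r', b)" by fastforce
  obtain r'' y' where r'': "row_insert x' r' = (r'', Some y')" "y' \<le> x"
    using row_insert_bump[OF Cons.prems(1) r'] by blast
  show ?case
  proof (cases b)
    case None
    then show ?thesis using Cons.prems r' r'' by (auto split: prod.splits)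
  next
    case (Some y)
    obtain T1 j where T1: "tab_insert y T = (T1, j)" by fastforce
    have "y' < y" using row_insert_less r' Some r''(2) by fastforce
    from Cons.IH[OF this T1] show ?thesis
      using Cons.prems r' Some T1 r'' by (auto split: prod.splits)
  qed
qed auto

lemma boxes_decreasing:
  assumes "sorted_wrt (>) w"
  shows "sorted_wrt (<) (boxes T w)"
proof -
  have "successively (<) (boxes T w)"
    using assms
  proof (induction w arbitrary: T)
    case (Cons x w)
    then show ?case
      using tab_insert_bump[of _ x T "fst (tab_insert x T)" "snd (tab_insert x T)"]
      by (cases w) auto
  qed simp
  then show ?thesis by (simp add: successively_conv_sorted_wrt)
qed

text \<open>The new boxes of a decreasing block lie in strictly increasing rows, so their list is
  determined by its set, and the set can be read off from the growth of the shape over that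
  block.\<close>

lemma boxes_eqI:
  assumes dec: "\<And>b. b \<in> set bs \<Longrightarrow> sorted_wrt (>) b" "\<And>b. b \<in> set bs' \<Longrightarrow> sorted_wrt (>) b"
    and len: "length bs = length bs'"
    and eq: "\<And>t i. row_length (insert_word [] (concat (take t bs))) i =
      row_length (insert_word [] (concat (take t bs'))) i"
  shows "boxes [] (concat bs) = boxes [] (concat bs')"
proof -
  have "boxes [] (concat (take t bs)) = boxes [] (concat (take t bs'))" if "t \<le> length bs" for t
    using that
  proof (induction t)
    case (Suc t)
    let ?T = "insert_word [] (concat (take t bs))" and ?T' = "insert_word [] (concat (take t bs'))"
    have tk: "take (Suc t) bs = take t bs @ [bs ! t]" "take (Suc t) bs' = take t bs' @ [bs' ! t]"
      using Suc.prems len by (auto simp: take_Suc_conv_app_nth)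
    have "count_list (boxes ?T (bs ! t)) i = count_list (boxes ?T' (bs' ! t)) i" for i
      using count_boxes[of ?T "bs ! t" i] count_boxes[of ?T' "bs' ! t" i] eq[of t i] eq[of "Suc t" i]
      by (simp add: tk)
    then have "set (boxes ?T (bs ! t)) = set (boxes ?T' (bs' ! t))"
      by (metis count_list_0_iff subsetI subset_antisym)
    then have "boxes ?T (bs ! t) = boxes ?T' (bs' ! t)"
      using boxes_decreasing dec Suc.prems len strict_sorted_equal by (metis Suc_le_lessD nth_mem)
    then show ?case using Suc by (simp add: tk boxes_append)
  qed simp
  from this[of "length bs"] show ?thesis using len by simp
qed

text \<open>For a composition \<open>ls\<close> this is the sum of the first \<open>k\<close> parts
  of the conjugate partition.\<close>

definition min_sum :: "nat \<Rightarrow> nat list \<Rightarrow> nat"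
  where "min_sum k ls = (\<Sum>l\<leftarrow>ls. min k l)"

lemma decreasing_block_clique:
  assumes "distinct (concat bs)" "b \<in> set bs" "sorted_wrt (>) b"
  shows "pairwise (inverted (concat bs)) (set b)"
proof -
  have *: "inverted (concat bs) x y" if "x \<in> set b" "y \<in> set b" "x < y" for x y
  proof -
    have "before b y x"
      using before_total[of x b y] before_sorted_wrt[of "(>)" b x y] that assms(3) by auto
    then show ?thesis using before_concat[OF assms(2)] that by (simp add: inverted_def)
  qed
  show ?thesis unfolding pairwise_def using * inverted_sym by (metis nat_neq_iff)
qed

text \<open>Each decreasing block is a clique and therefore contributes at most \<open>k\<close>
  letters.\<close>

lemma good_card_blocks_le:
  assumes d: "distinct (concat bs)" and dec: "\<And>b. b \<in> set bs \<Longrightarrow> sorted_wrt (>) b"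
    and g: "good_card (concat bs) k m"
  shows "m \<le> min_sum k (map length bs)"
proof -
  obtain A where A: "A \<subseteq> set (concat bs)" "clique_le (inverted (concat bs)) k A" "card A = m"
    using g by (auto simp: good_card_def)
  have "A = (\<Union>i<length bs. A \<inter> set (bs ! i))"
    using A(1) by (auto simp: set_conv_nth[of bs])
  then have "m \<le> (\<Sum>i<length bs. card (A \<inter> set (bs ! i)))"
    using A(3) card_UN_le[of "{..<length bs}" "\<lambda>i. A \<inter> set (bs ! i)"] by simp
  also have "\<dots> \<le> (\<Sum>i<length bs. min k (length (bs ! i)))"
  proof (rule sum_mono)
    fix i assume i: "i \<in> {..<length bs}"
    have "pairwise (inverted (concat bs)) (A \<inter> set (bs ! i))"
      using decreasing_block_clique[OF d, of "bs ! i"] dec i pairwise_subset by (meson Int_lower2 lessThan_iff nth_mem)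
    then have "card (A \<inter> set (bs ! i)) \<le> k" using clique_leD[OF A(2)] by blast
    moreover have "card (A \<inter> set (bs ! i)) \<le> length (bs ! i)"
      using card_mono[of "set (bs ! i)" "A \<inter> set (bs ! i)"] card_length[of "bs ! i"] by simp
    ultimately show "card (A \<inter> set (bs ! i)) \<le> min k (length (bs ! i))" by simp
  qed
  also have "\<dots> = min_sum k (map length bs)"
    by (simp add: min_sum_def sum_list_sum_nth atLeast0LessThan)
  finally show ?thesis .
qed

text \<open>The upper bound applies to the first \<open>t\<close> blocks and to the remaining ones
  separately, and the two bounds add up to the bound for the whole word; equality there leaves no
  slack in either part.\<close>

lemma good_card_blocks_take:
  assumes d: "distinct (concat bs)" and dec: "\<And>b. b \<in> set bs \<Longrightarrow> sorted_wrt (>) b"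
    and g: "good_card (concat bs) k (min_sum k (map length bs))"
  shows "good_card (concat (take t bs)) k (min_sum k (map length (take t bs)))"
proof -
  let ?u = "concat (take t bs)" and ?v = "concat (drop t bs)"
  have uv: "concat bs = ?u @ ?v" by (metis append_take_drop_id concat_append)
  obtain A where A: "A \<subseteq> set (concat bs)" "clique_le (inverted (concat bs)) k A"
      "card A = min_sum k (map length bs)"
    using g by (auto simp: good_card_def)
  have fin: "finite A" using A(2) by (simp add: clique_le_def)
  have du: "distinct ?u" "distinct ?v" using d unfolding uv by simp_all
  have "clique_le (inverted ?u) k (A \<inter> set ?u)" "clique_le (inverted ?v) k (A \<inter> set ?v)"
    using clique_le_subset[OF A(2) Int_lower1]
    by (rule clique_le_antimono; auto simp: uv inverted_def before_append)+
  then have gu: "good_card ?u k (card (A \<inter> set ?u))" and gv: "good_card ?v k (card (A \<inter> set ?v))"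
    unfolding good_card_def by blast+
  have "card (A \<inter> set ?u) \<le> min_sum k (map length (take t bs))"
    by (rule good_card_blocks_le[OF du(1) _ gu]) (use dec in_set_takeD in fast)
  moreover have "card (A \<inter> set ?v) \<le> min_sum k (map length (drop t bs))"
    by (rule good_card_blocks_le[OF du(2) _ gv]) (use dec in_set_dropD in fast)
  moreover have "min_sum k (map length bs) =
      min_sum k (map length (take t bs)) + min_sum k (map length (drop t bs))"
    unfolding min_sum_def by (metis append_take_drop_id map_append sum_list_append)
  moreover have "A = (A \<inter> set ?u) \<union> (A \<inter> set ?v)" using A(1) unfolding uv by auto
  then have "card A \<le> card (A \<inter> set ?u) + card (A \<inter> set ?v)" by (metis card_Un_le)
  ultimately have "card (A \<inter> set ?u) = min_sum k (map length (take t bs))" using A(3) by linarith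
  then show ?thesis using gu by simp
qed

text \<open>\<open>bs'\<close> is the reference word, known to be extremal. From equal tableaux only
  the common shape is used; conversely, both words are extremal on every initial run of blocks, so
  all these shapes agree and \<open>boxes_eqI\<close> applies.\<close>

theorem recording_tableau_eq_iff:
  assumes d: "distinct (concat bs)" "distinct (concat bs')"
    and dec: "\<And>b. b \<in> set bs \<Longrightarrow> sorted_wrt (>) b" "\<And>b. b \<in> set bs' \<Longrightarrow> sorted_wrt (>) b"
    and len: "map length bs = map length bs'"
    and full: "\<And>k. good_card (concat bs') k (min_sum k (map length bs'))"
  shows "add_boxes 1 (boxes [] (concat bs)) [] = add_boxes 1 (boxes [] (concat bs')) [] \<longleftrightarrow>
    (\<forall>k. good_card (concat bs) k (min_sum k (map length bs)))"
proof
  assume "add_boxes 1 (boxes [] (concat bs)) [] = add_boxes 1 (boxes [] (concat bs')) []"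
  then have eq: "map length (insert_word [] (concat bs)) = map length (insert_word [] (concat bs'))"
    using map_length_add_boxes[of "[]" "[]"] by metis
  show "\<forall>k. good_card (concat bs) k (min_sum k (map length bs))"
  proof
    fix k
    let ?s = "\<lambda>bs. sum_list (map length (take k (insert_word [] (concat bs))))"
    have "?s bs = ?s bs'" using eq by (simp add: take_map[symmetric])
    moreover have "?s bs' = min_sum k (map length bs')"
      using greene(2)[OF d(2) full] good_card_blocks_le[OF d(2) dec(2) greene(1)[OF d(2)]]
      by (simp add: le_antisym)
    ultimately show "good_card (concat bs) k (min_sum k (map length bs))"
      using greene(1)[OF d(1), of k] len by simp
  qed
next
  assume full1: "\<forall>k. good_card (concat bs) k (min_sum k (map length bs))"
  have s: "sum_list (map length (take k (insert_word [] (concat (take t bs))))) =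
      min_sum k (map length (take t bs))"
    if d: "distinct (concat bs)" and dec: "\<And>b. b \<in> set bs \<Longrightarrow> sorted_wrt (>) b"
      and full: "\<And>k. good_card (concat bs) k (min_sum k (map length bs))" for k t bs
  proof -
    have d': "distinct (concat (take t bs))"
      using d by (metis append_take_drop_id concat_append distinct_append)
    show ?thesis
      using greene(2)[OF d' good_card_blocks_take[OF d dec full]]
        good_card_blocks_le[OF d' _ greene(1)[OF d']] dec in_set_takeD
      by (metis (no_types, lifting) le_antisym)
  qed
  have "take t (map length bs) = take t (map length bs')" for t using len by simp
  then have tk: "map length (take t bs) = map length (take t bs')" for t by (simp add: take_map)
  have "boxes [] (concat bs) = boxes [] (concat bs')"
  proof (rule boxes_eqI[OF dec])
    show "length bs = length bs'" using len map_eq_imp_length_eq by blast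
    show "row_length (insert_word [] (concat (take t bs))) i =
      row_length (insert_word [] (concat (take t bs'))) i" for t i
      using s[of bs] s[of bs'] d dec full full1 by (simp add: row_length_sum_take tk)
  qed
  then show "add_boxes 1 (boxes [] (concat bs)) [] = add_boxes 1 (boxes [] (concat bs')) []" by simp
qed

section \<open>Inversions and parabolic subgroups\<close>

definition invs :: "nat \<Rightarrow> (nat \<Rightarrow> nat) \<Rightarrow> (nat \<times> nat) set"
  where "invs n w = {(i, j). 1 \<le> i \<and> i < j \<and> j \<le> n \<and> w j < w i}"

lemma finite_invs [simp]: "finite (invs n w)"
  by (rule finite_subset[of _ "{1..n} \<times> {1..n}"]) (auto simp: invs_def)

lemma invs_id [simp]: "invs n id = {}"
  by (auto simp: invs_def)

lemma invs_ident [simp]: "invs n (\<lambda>i. i) = {}"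
  by (auto simp: invs_def)

lemma simple_refl_permutes: "1 \<le> i \<Longrightarrow> i < n \<Longrightarrow> simple_refl i permutes {1..n}"
  unfolding simple_refl_def by (rule permutes_swap_id) auto

lemma simple_refl_involution [simp]: "simple_refl i (simple_refl i k) = k"
  by (simp add: simple_refl_def)

lemma simple_refl_comp [simp]: "simple_refl i \<circ> simple_refl i = id"
  by (simp add: fun_eq_iff)

lemma inv_simple_refl [simp]: "inv' (simple_refl i) = simple_refl i"
  by (rule inv_unique_comp) simp_all

lemma permutes_strict_imp_id:
  assumes w: "w permutes {1..n}" and less: "\<And>i. 1 \<le> i \<Longrightarrow> i < n \<Longrightarrow> w i < w (Suc i)"
  shows "w = id"
proof -
  have "i \<le> w i" if "i \<in> {1..n}" for i
    using that
  proof (induction i)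
    case (Suc i)
    then show ?case using less[of i] by (cases "i = 0") (use permutes_in_image[OF w, of 1] in auto)
  qed simp
  then show ?thesis using permutes_natset_ge[OF w] by blast
qed

text \<open>A pair of arguments of the quotient corresponds to the pair of positions that
  \<open>x\<close> sends to it; the quotient inverts it exactly if \<open>x\<close> and
  \<open>y\<close> order these positions differently.\<close>

lemma card_invs_quotient:
  assumes x: "x permutes {1..n}" and y: "y permutes {1..n}"
  shows "card (invs n (inv' x \<cdot> y)) = card (invs n x - invs n y) + card (invs n y - invs n x)"
proof -
  let ?u = "y \<circ> inv' x"
  let ?D = "(invs n x - invs n y) \<union> (invs n y - invs n x)"
  \<comment> \<open>\<open>f z\<close> moves a pair by \<open>z\<close> and sorts the result;
    \<open>f x\<close> and \<open>f (inv' x)\<close> are inverse to each other on increasing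
    pairs.\<close>
  define f where "f z = (\<lambda>(i, j). (min (z i) (z j), max (z i) (z j :: nat)))" for z :: "nat \<Rightarrow> nat"
  have ux: "?u (x i) = y i" for i by (simp add: permutes_inverses[OF x])
  have injx: "x i = x j \<longleftrightarrow> i = j" and injy: "y i = y j \<longleftrightarrow> i = j" for i j
    by (simp_all add: inj_eq permutes_inj[OF x] permutes_inj[OF y])
  have ix: "x (inv' x i) = i" "inv' x (x i) = i" for i by (simp_all add: permutes_inverses[OF x])
  have inx: "1 \<le> x i \<and> x i \<le> n \<longleftrightarrow> 1 \<le> i \<and> i \<le> n" for i
    using permutes_in_image[OF x, of i] by simp
  have inx': "1 \<le> inv' x i \<and> inv' x i \<le> n \<longleftrightarrow> 1 \<le> i \<and> i \<le> n" for i
    using permutes_in_image[OF permutes_inv[OF x], of i] by simp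
  have ff: "f (inv' x) (f x (i, j)) = (i, j)" "f x (f (inv' x) (i, j)) = (i, j)" if "i < j" for i j
    using that by (cases "x i \<le> x j"; cases "inv' x i \<le> inv' x j"; simp add: f_def ix min_def max_def)+
  have "bij_betw (f x) ?D (invs n ?u)"
  proof (rule bij_betw_byWitness[where f' = "f (inv' x)"])
    show "\<forall>p\<in>?D. f (inv' x) (f x p) = p" using ff(1) by (auto simp: invs_def)
    show "\<forall>p\<in>invs n ?u. f x (f (inv' x) p) = p" using ff(2) by (auto simp: invs_def)
    show "f x ` ?D \<subseteq> invs n ?u"
    proof
      fix q assume "q \<in> f x ` ?D"
      then obtain i j where ij: "(i, j) \<in> ?D" "q = f x (i, j)" by auto
      then have b: "1 \<le> i" "i < j" "j \<le> n" "(x j < x i) \<noteq> (y j < y i)" by (auto simp: invs_def)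
      then have "x i \<noteq> x j" "y i \<noteq> y j" by (simp_all add: injx injy)
      then show "q \<in> invs n ?u"
        using b ij(2) inx[of i] inx[of j] by (auto simp: f_def invs_def min_def max_def ix)
    qed
    show "f (inv' x) ` invs n ?u \<subseteq> ?D"
    proof
      fix q assume "q \<in> f (inv' x) ` invs n ?u"
      then obtain a b where ab: "(a, b) \<in> invs n ?u" "q = f (inv' x) (a, b)" by auto
      define i j where "i = inv' x a" and "j = inv' x b"
      have "a = x i" "b = x j" by (simp_all add: i_def j_def ix)
      then have "x i < x j" "y j < y i" "1 \<le> i" "1 \<le> j" "i \<le> n" "j \<le> n"
        using ab(1) inx[of i] inx[of j] by (auto simp: invs_def ix)
      then show "q \<in> ?D"
        unfolding ab(2) f_def i_def[symmetric] j_def[symmetric] prod.case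
        using injx[of i j] by (auto simp: f_def invs_def min_def max_def)
    qed
  qed
  then have "card (invs n ?u) = card ?D" by (metis bij_betw_same_card)
  also have "\<dots> = card (invs n x - invs n y) + card (invs n y - invs n x)"
    by (rule card_Un_disjoint) auto
  finally show ?thesis .
qed

lemma invs_simple_refl:
  assumes "1 \<le> i" "i < n"
  shows "invs n (simple_refl i) = {(i, Suc i)}"
  using assms by (auto simp: invs_def simple_refl_def Transposition.transpose_def split: if_splits)

text \<open>The reflection acts first in \<open>w \<circ> simple_refl i\<close>, so this is the
  quotient formula for \<open>x = simple_refl i\<close>, whose only inversion is
  \<open>(i, Suc i)\<close>.\<close>

lemma card_invs_simple_refl:
  assumes "w permutes {1..n}" "1 \<le> i" "i < n"
  shows "w (Suc i) < w i \<Longrightarrow> Suc (card (invs n (w \<circ> simple_refl i))) = card (invs n w)"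
    and "w i < w (Suc i) \<Longrightarrow> card (invs n (w \<circ> simple_refl i)) = Suc (card (invs n w))"
proof -
  have eq: "card (invs n (w \<circ> simple_refl i)) =
      card ({(i, Suc i)} - invs n w) + card (invs n w - {(i, Suc i)})"
    using card_invs_quotient[OF simple_refl_permutes[OF assms(2,3)] assms(1)]
    by (simp only: invs_simple_refl[OF assms(2,3)] inv_simple_refl)
  show "Suc (card (invs n (w \<circ> simple_refl i))) = card (invs n w)" if "w (Suc i) < w i"
  proof -
    have "(i, Suc i) \<in> invs n w" using that assms by (simp add: invs_def)
    then have "{(i, Suc i)} - invs n w = {}" "Suc (card (invs n w - {(i, Suc i)})) = card (invs n w)"
      by (auto simp: card_Suc_Diff1 simp del: card_Diff_insert)
    then show ?thesis using eq by simp
  qed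
  show "card (invs n (w \<circ> simple_refl i)) = Suc (card (invs n w))" if "w i < w (Suc i)"
  proof -
    have "(i, Suc i) \<notin> invs n w" using that by (simp add: invs_def)
    then have "{(i, Suc i)} - invs n w = {(i, Suc i)}" "invs n w - {(i, Suc i)} = invs n w" by auto
    then show ?thesis using eq by simp
  qed
qed

lemma word_prod_permutes: "set is \<subseteq> {1..<n} \<Longrightarrow> word_prod is permutes {1..n}"
proof (induction "is")
  case (Cons i "is")
  then have "word_prod is \<circ> simple_refl i permutes {1..n}"
    by (intro permutes_compose simple_refl_permutes) auto
  then show ?case by (simp add: comp_def)
qed (simp add: permutes_id)

lemma card_invs_word_prod: "set is \<subseteq> {1..<n} \<Longrightarrow> card (invs n (word_prod is)) \<le> length is"
proof (induction "is")
  case Nil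
  show ?case by simp
next
  case (Cons i "is")
  then have p: "word_prod is permutes {1..n}" and i: "1 \<le> i" "i < n"
    using word_prod_permutes by auto
  have "word_prod is i \<noteq> word_prod is (Suc i)" by (simp add: inj_eq[OF permutes_inj[OF p]])
  then consider "word_prod is (Suc i) < word_prod is i" | "word_prod is i < word_prod is (Suc i)"
    by linarith
  then show ?case using Cons card_invs_simple_refl[OF p i] by cases (auto simp: comp_def)
qed

lemma descent_exists:
  assumes w: "w permutes {1..n}" and "w \<noteq> id"
  obtains i where "1 \<le> i" "i < n" "w (Suc i) < w i"
proof -
  obtain i where i: "1 \<le> i" "i < n" "\<not> w i < w (Suc i)"
    using permutes_strict_imp_id[OF w] assms(2) by blast
  moreover have "w i \<noteq> w (Suc i)" by (simp add: inj_eq[OF permutes_inj[OF w]])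
  ultimately show ?thesis using that by force
qed

lemma word_prod_exists:
  "w permutes {1..n} \<Longrightarrow> \<exists>is. set is \<subseteq> {1..<n} \<and> length is = card (invs n w) \<and> word_prod is = w"
proof (induction "card (invs n w)" arbitrary: w rule: less_induct)
  case less
  show ?case
  proof (cases "w = id")
    case True
    then show ?thesis by (intro exI[of _ "[]"]) auto
  next
    case False
    then obtain i where i: "1 \<le> i" "i < n" "w (Suc i) < w i"
      using descent_exists[OF less.prems] by blast
    let ?w = "w \<circ> simple_refl i"
    have p: "?w permutes {1..n}"
      using permutes_compose[OF simple_refl_permutes[OF i(1,2)] less.prems] .
    have c: "Suc (card (invs n ?w)) = card (invs n w)"
      using card_invs_simple_refl(1)[OF less.prems i] .
    then obtain "is" where "set is \<subseteq> {1..<n}" "length is = card (invs n ?w)" "word_prod is = ?w"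
      using less.hyps[OF _ p] by auto
    moreover have "w = ?w \<circ> simple_refl i" by (simp add: comp_assoc)
    ultimately show ?thesis using c i by (intro exI[of _ "i # is"]) auto
  qed
qed

lemma cox_length_eq:
  assumes "w permutes {1..n}"
  shows "cox_length n w = card (invs n w)"
  unfolding cox_length_def
proof (rule Least_equality)
  show "\<exists>is. set is \<subseteq> {1..<n} \<and> length is = card (invs n w) \<and> word_prod is = w"
    using word_prod_exists[OF assms] .
qed (use card_invs_word_prod in auto)

text \<open>With X and Y the inversion sets, additivity of lengths reads |Y| = |X| + |X - Y| + |Y -
  X|, while |Y| + |X - Y| = |X| + |Y - X| always holds; hence |X - Y| = 0.\<close>

lemma prefix_of_iff:
  assumes x: "x permutes {1..n}" and y: "y permutes {1..n}"
  shows "prefix_of n x y \<longleftrightarrow> invs n x \<subseteq> invs n y"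
proof -
  let ?X = "invs n x" and ?Y = "invs n y"
  have "(inv' x \<cdot> y) permutes {1..n}" using permutes_compose[OF permutes_inv[OF x] y] .
  then have "prefix_of n x y \<longleftrightarrow> card ?Y = card ?X + (card (?X - ?Y) + card (?Y - ?X))"
    using x y by (simp only: prefix_of_def cox_length_eq card_invs_quotient)
  moreover have "card ?Y = card (?Y \<inter> ?X) + card (?Y - ?X)" "card ?X = card (?Y \<inter> ?X) + card (?X - ?Y)"
    by (subst card_Un_disjoint[symmetric]; auto intro: arg_cong[where f = card])+
  ultimately have "prefix_of n x y \<longleftrightarrow> card (?X - ?Y) = 0" by linarith
  then show ?thesis by auto
qed

lemma invs_inject:
  assumes x: "x permutes {1..n}" and y: "y permutes {1..n}" and eq: "invs n x = invs n y"
  shows "x = y"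
proof -
  have p: "(y \<circ> inv' x) permutes {1..n}" using permutes_compose[OF permutes_inv[OF x] y] .
  have "card (invs n (y \<circ> inv' x)) = 0" using card_invs_quotient[OF x y] eq by simp
  then have "invs n (y \<circ> inv' x) = {}" by simp
  then have "\<not> (y \<circ> inv' x) (Suc i) < (y \<circ> inv' x) i" if "1 \<le> i" "i < n" for i
    using that unfolding invs_def by auto
  then have "y \<circ> inv' x = id" using descent_exists[OF p] by blast
  then have "y \<circ> inv' x \<circ> x = x" by simp
  then show ?thesis by (simp add: comp_assoc permutes_inv_o[OF x])
qed

text \<open>Young subgroups are described by a weakly increasing labelling \<open>b\<close> of the positions.\<close>

definition young :: "nat \<Rightarrow> (nat \<Rightarrow> nat) \<Rightarrow> (nat \<Rightarrow> nat) set"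
  where "young n b = {u. u permutes {1..n} \<and> (\<forall>i\<in>{1..n}. b (u i) = b i)}"

lemma simple_refl_young:
  "1 \<le> i \<Longrightarrow> i < n \<Longrightarrow> b i = b (Suc i) \<Longrightarrow> simple_refl i \<in> young n b"
  using simple_refl_permutes[of i n]
  by (auto simp: young_def simple_refl_def Transposition.transpose_def)

text \<open>The monotone labelling is constant between two positions with equal labels, so ascents
  at neighbouring positions suffice.\<close>

lemma increasing_on_blocks:
  fixes b d :: "nat \<Rightarrow> nat"
  assumes b: "mono_on {1..n} b" and d: "\<And>k. 1 \<le> k \<Longrightarrow> k < n \<Longrightarrow> b k = b (Suc k) \<Longrightarrow> d k < d (Suc k)"
    and ij: "1 \<le> i" "i < j" "j \<le> n" "b i = b j"
  shows "d i < d j"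
  using ij(2-4)
proof (induction j)
  case (Suc j)
  have m: "b i \<le> b j" "b j \<le> b (Suc j)"
    using mono_onD[OF b, of i j] mono_onD[OF b, of j "Suc j"] Suc.prems ij(1) by auto
  then have bj: "b j = b (Suc j)" "b i = b j" using Suc.prems(3) by linarith+
  then have "d j < d (Suc j)" using d[of j] Suc.prems ij(1) by auto
  then show ?case using Suc bj by (cases "i = j") auto
qed simp

lemma min_coset_reps_young:
  assumes b: "mono_on {1..n} b"
  shows "min_coset_reps n (young n b) =
    {d. d permutes {1..n} \<and> (\<forall>i j. 1 \<le> i \<and> i < j \<and> j \<le> n \<and> b i = b j \<longrightarrow> d i < d j)}"
proof (intro Set.set_eqI iffI)
  fix d assume d: "d \<in> min_coset_reps n (young n b)"
  then have p: "d permutes {1..n}" by (simp add: min_coset_reps_def)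
  have "d k < d (Suc k)" if k: "1 \<le> k" "k < n" "b k = b (Suc k)" for k
  proof (rule ccontr)
    assume "\<not> d k < d (Suc k)"
    moreover have "d k \<noteq> d (Suc k)" by (simp add: inj_eq[OF permutes_inj[OF p]])
    ultimately have "Suc (card (invs n (d \<circ> simple_refl k))) = card (invs n d)"
      using card_invs_simple_refl(1)[OF p k(1,2)] by simp
    moreover have "cox_length n d \<le> cox_length n (d \<circ> simple_refl k)"
      using d simple_refl_young[OF k] by (simp add: min_coset_reps_def)
    ultimately show False
      using cox_length_eq[OF p] cox_length_eq[OF permutes_compose[OF simple_refl_permutes[OF k(1,2)] p]]
      by simp
  qed
  then show "d \<in> {d. d permutes {1..n} \<and> (\<forall>i j. 1 \<le> i \<and> i < j \<and> j \<le> n \<and> b i = b j \<longrightarrow> d i < d j)}"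
    using p increasing_on_blocks[OF b, of d] by blast
next
  fix d assume "d \<in> {d. d permutes {1..n} \<and> (\<forall>i j. 1 \<le> i \<and> i < j \<and> j \<le> n \<and> b i = b j \<longrightarrow> d i < d j)}"
  then have p: "d permutes {1..n}" and inc: "\<And>i j. 1 \<le> i \<Longrightarrow> i < j \<Longrightarrow> j \<le> n \<Longrightarrow> b i = b j \<Longrightarrow> d i < d j"
    by auto
  have "cox_length n d \<le> cox_length n (u \<cdot> d)" if u: "u \<in> young n b" for u
  proof -
    have pu: "u permutes {1..n}" and bu: "\<And>i. i \<in> {1..n} \<Longrightarrow> b (u i) = b i"
      using u by (auto simp: young_def)
    have iu: "u (inv' u i) = i" for i by (simp add: permutes_inverses[OF pu])
    have inu: "inv' u i \<in> {1..n} \<longleftrightarrow> i \<in> {1..n}" for i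
      using permutes_in_image[OF permutes_inv[OF pu]] by simp
    \<comment> \<open>Inversions of \<open>d\<close> join different blocks. As \<open>inv' u\<close>
      preserves blocks, it keeps the order of such positions, so each inversion of \<open>d\<close>
      is moved to an inversion of \<open>u \<cdot> d\<close>.\<close>
    have "map_prod (inv' u) (inv' u) ` invs n d \<subseteq> invs n (d \<circ> u)"
    proof
      fix q assume "q \<in> map_prod (inv' u) (inv' u) ` invs n d"
      then obtain i j where ij: "(i, j) \<in> invs n d" "q = (inv' u i, inv' u j)" by auto
      then have r: "1 \<le> i" "i < j" "j \<le> n" "d j < d i" by (auto simp: invs_def)
      have "b i \<noteq> b j" using inc[of i j] r by auto
      then have "b i < b j" using mono_onD[OF b, of i j] r by auto
      moreover have "b (inv' u i) = b i" "b (inv' u j) = b j"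
        using bu[of "inv' u i"] bu[of "inv' u j"] inu[of i] inu[of j] r by (auto simp: iu)
      ultimately have "\<not> inv' u j \<le> inv' u i"
        using mono_onD[OF b, of "inv' u j" "inv' u i"] inu[of i] inu[of j] r by auto
      then show "q \<in> invs n (d \<circ> u)"
        using ij(2) r inu[of i] inu[of j] by (auto simp: invs_def iu)
    qed
    moreover have "inj_on (map_prod (inv' u) (inv' u)) (invs n d)"
      using permutes_inj[OF permutes_inv[OF pu]] by (metis inj_on_subset prod.inj_map subset_UNIV)
    ultimately have "card (invs n d) \<le> card (invs n (d \<circ> u))"
      using card_inj_on_le finite_invs by blast
    then show ?thesis using cox_length_eq[OF p] cox_length_eq[OF permutes_compose[OF pu p]] by simp
  qed
  then show "d \<in> min_coset_reps n (young n b)" using p by (simp add: min_coset_reps_def)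
qed

lemma generate_young:
  assumes b: "mono_on {1..n} b"
  shows "generate (sym_group n) {simple_refl i | i. 1 \<le> i \<and> i < n \<and> b i = b (Suc i)} = young n b"
    (is "generate _ ?J = _")
proof (intro Set.set_eqI iffI)
  fix u assume "u \<in> generate (sym_group n) ?J"
  then show "u \<in> young n b"
  proof (induction rule: generate.induct)
    case one
    show ?case unfolding sym_group_one young_def by (intro CollectI conjI ballI permutes_id) simp
  next
    case (incl h)
    then show ?case using simple_refl_young by blast
  next
    case (inv h)
    then obtain i where i: "1 \<le> i" "i < n" "b i = b (Suc i)" "h = simple_refl i" by blast
    have "h \<in> carrier (sym_group n)" using simple_refl_permutes[OF i(1,2)] i(4) by (simp add: sym_group_def)
    then have "inv\<^bsub>sym_group n\<^esub> h = h" using sym_group_inv_equality i(4) by simp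
    then show ?case using simple_refl_young i by simp
  next
    case (eng h1 h2)
    then have h: "h1 permutes {1..n}" "h2 permutes {1..n}" by (auto simp: young_def)
    have "b (h1 (h2 i)) = b i" if "i \<in> {1..n}" for i
      using eng.IH that permutes_in_image[OF h(2), of i] by (simp add: young_def)
    then show ?case
      unfolding sym_group_mult young_def comp_def[symmetric]
      by (intro CollectI conjI ballI permutes_compose[OF h(2,1)]) simp
  qed
next
  fix u assume "u \<in> young n b"
  then show "u \<in> generate (sym_group n) ?J"
  proof (induction "card (invs n u)" arbitrary: u rule: less_induct)
    case less
    have p: "u permutes {1..n}" and bu: "\<And>i. i \<in> {1..n} \<Longrightarrow> b (u i) = b i"
      using less.prems by (auto simp: young_def)
    show ?case
    proof (cases "u = id")
      case True
      then show ?thesis using generate.one[of "sym_group n" ?J] by (simp add: sym_group_def)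
    next
      case False
      then obtain i where i: "1 \<le> i" "i < n" "u (Suc i) < u i" using descent_exists[OF p] by blast
      \<comment> \<open>The values of \<open>u\<close> at \<open>i\<close> and \<open>Suc i\<close>
        carry the labels of these positions, so a descent across a block boundary would contradict
        monotonicity.\<close>
      have "b (u (Suc i)) \<le> b (u i)"
        using mono_onD[OF b, of "u (Suc i)" "u i"] permutes_in_image[OF p, of i]
          permutes_in_image[OF p, of "Suc i"] i by auto
      then have bi: "b i = b (Suc i)"
        using bu[of i] bu[of "Suc i"] mono_onD[OF b, of i "Suc i"] i by auto
      let ?u = "u \<circ> simple_refl i"
      have s: "simple_refl i \<in> young n b" using simple_refl_young[of i n b] i bi by simp
      have "b (u (simple_refl i k)) = b k" if "k \<in> {1..n}" for k
      proof -
        have "simple_refl i k \<in> {1..n}"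
          using that permutes_in_image[OF simple_refl_permutes[OF i(1,2)], of k] by simp
        then show ?thesis using bu s that by (simp add: young_def)
      qed
      then have "?u \<in> young n b"
        using permutes_compose[OF simple_refl_permutes[OF i(1,2)] p] by (simp add: young_def)
      then have "?u \<in> generate (sym_group n) ?J"
        using less.hyps card_invs_simple_refl(1)[OF p i] by simp
      moreover have "simple_refl i \<in> generate (sym_group n) ?J"
        by (rule generate.incl) (use i bi in blast)
      ultimately have "?u \<otimes>\<^bsub>sym_group n\<^esub> simple_refl i \<in> generate (sym_group n) ?J"
        by (rule generate.eng)
      then show ?thesis by (simp add: sym_group_def comp_assoc)
    qed
  qed
qed

section \<open>Blocks of a composition and the longest element of its Young subgroup\<close>

abbreviation psum :: "nat list \<Rightarrow> nat \<Rightarrow> nat"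
  where "psum lam t \<equiv> sum_list (take t lam)"

text \<open>Blocks are numbered from 0. Counting those that end before \<open>i\<close> gives a
  value for every \<open>i\<close> and makes monotonicity in \<open>i\<close> evident.\<close>

definition block :: "nat list \<Rightarrow> nat \<Rightarrow> nat"
  where "block lam i = card {t. t < length lam \<and> psum lam (Suc t) < i}"

lemma psum_mono: "s \<le> t \<Longrightarrow> psum lam s \<le> psum lam t"
  by (metis le_add1 le_add_diff_inverse sum_list_append take_add)

lemma block_mono: "i \<le> j \<Longrightarrow> block lam i \<le> block lam j"
  unfolding block_def by (rule card_mono) auto

lemma block_eqI:
  assumes "b < length lam" "psum lam b < i" "i \<le> psum lam (Suc b)"
  shows "block lam i = b"
proof -
  have "{t. t < length lam \<and> psum lam (Suc t) < i} = {..<b}" (is "?L = _")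
  proof (intro Set.set_eqI iffI)
    fix t assume t: "t \<in> ?L"
    show "t \<in> {..<b}"
    proof (rule ccontr)
      assume "t \<notin> {..<b}"
      then have "psum lam (Suc b) \<le> psum lam (Suc t)"
        by (intro psum_mono) auto
      then show False using t assms(3) by simp
    qed
  next
    fix t assume t: "t \<in> {..<b}"
    then have "psum lam (Suc t) \<le> psum lam b"
      by (intro psum_mono) auto
    then show "t \<in> ?L" using t assms(1,2) by simp
  qed
  then show ?thesis by (simp add: block_def)
qed

lemma block_cases:
  fixes lam :: "nat list"
  assumes "1 \<le> i" "i \<le> sum_list lam"
  obtains b where "b < length lam" "psum lam b < i" "i \<le> psum lam (Suc b)"
proof -
  define m where "m = (LEAST t. i \<le> psum lam t)"
  have "i \<le> psum lam (length lam)" using assms by simp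
  then have m: "i \<le> psum lam m" "m \<le> length lam"
    unfolding m_def by (rule LeastI, rule Least_le)
  have "m \<noteq> 0"
  proof
    assume "m = 0"
    then show False using m(1) assms(1) by simp
  qed
  then obtain b where b: "m = Suc b" by (cases m) auto
  have "\<not> i \<le> psum lam b"
    using not_less_Least[of b "\<lambda>t. i \<le> psum lam t"] b by (simp add: m_def[symmetric])
  then show ?thesis using that[of b] m b by auto
qed

lemma block_iff:
  assumes "1 \<le> i" "i \<le> sum_list lam"
  shows "block lam i = b \<longleftrightarrow>
    b < length lam \<and> psum lam b < i \<and> i \<le> psum lam (Suc b)"
  using block_eqI block_cases[OF assms] by metis

lemma block_set:
  assumes "b < length lam"
  shows "{i \<in> {1..sum_list lam}. block lam i = b} = {psum lam b<..psum lam (Suc b)}"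
proof -
  have "psum lam (Suc b) \<le> sum_list lam"
    using psum_mono[of "Suc b" "length lam" lam] assms by simp
  then have iff: "i \<in> {1..sum_list lam} \<and> block lam i = b \<longleftrightarrow>
      psum lam b < i \<and> i \<le> psum lam (Suc b)" for i
    using block_iff[of i lam b] assms by auto
  show ?thesis by (intro Set.set_eqI) (simp only: mem_Collect_eq greaterThanAtMost_iff iff)
qed

lemma card_block:
  assumes "b < length lam"
  shows "card {i \<in> {1..sum_list lam}. block lam i = b} = lam ! b"
  unfolding block_set[OF assms] using assms by (simp add: take_Suc_conv_app_nth)

lemma block_less_length: "1 \<le> i \<Longrightarrow> i \<le> sum_list lam \<Longrightarrow> block lam i < length lam"
  using block_iff by blast

lemma block_Suc_iff:
  "block lam i = block lam (Suc i) \<longleftrightarrow> (\<forall>t<length lam. psum lam (Suc t) \<noteq> i)"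
proof -
  let ?A = "\<lambda>i. {t. t < length lam \<and> psum lam (Suc t) < i}"
  have sub: "?A i \<subseteq> ?A (Suc i)" "finite (?A (Suc i))" by auto
  then have "block lam i = block lam (Suc i) \<longleftrightarrow> ?A i = ?A (Suc i)"
    unfolding block_def using card_subset_eq[OF sub(2,1)] by (auto simp only:)
  also have "\<dots> \<longleftrightarrow> (\<forall>t<length lam. psum lam (Suc t) \<noteq> i)"
    using less_Suc_eq by blast
  finally show ?thesis .
qed

lemma inj_simple_refl: "inj simple_refl"
proof (rule injI)
  fix i j assume eq: "simple_refl i = simple_refl j"
  have "simple_refl j i = Suc i"
    using fun_cong[OF eq, of i] unfolding simple_refl_def by simp
  then show "i = j" unfolding simple_refl_def Transposition.transpose_def by presburger
qed

lemma J_set_eq: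
  "J_set lam = {simple_refl i | i. 1 \<le> i \<and> i < sum_list lam \<and> block lam i = block lam (Suc i)}"
proof -
  let ?P = "{psum lam k | k. 1 \<le> k \<and> k < length lam}"
  \<comment> \<open>\<open>block_Suc_iff\<close> also treats the last partial sum,
    \<open>sum_list lam\<close>, as a boundary; the bound on \<open>i\<close> excludes it.\<close>
  have iff: "block lam i = block lam (Suc i) \<longleftrightarrow> i \<notin> ?P" if i: "i < sum_list lam" for i
  proof
    assume "block lam i = block lam (Suc i)"
    then have ne: "psum lam (Suc t) \<noteq> i" if "t < length lam" for t
      using that by (auto simp: block_Suc_iff)
    show "i \<notin> ?P"
    proof
      assume "i \<in> ?P"
      then obtain k where "i = psum lam k" "1 \<le> k" "k < length lam" by blast
      moreover from this have "k - 1 < length lam" "Suc (k - 1) = k" by simp_all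
      ultimately show False using ne[of "k - 1"] by simp
    qed
  next
    assume nP: "i \<notin> ?P"
    have "psum lam (Suc t) \<noteq> i" if t: "t < length lam" for t
      using nP i t by (cases "Suc t < length lam") auto
    then show "block lam i = block lam (Suc i)" by (simp add: block_Suc_iff)
  qed
  have "J_set lam = simple_refl ` ({1..<sum_list lam} - ?P)"
    unfolding J_set_def by (rule image_set_diff[symmetric, OF inj_simple_refl])
  also have "\<dots> = {simple_refl i | i. 1 \<le> i \<and> i < sum_list lam \<and> i \<notin> ?P}" by auto
  also have "\<dots> = {simple_refl i | i. 1 \<le> i \<and> i < sum_list lam \<and> block lam i = block lam (Suc i)}"
    using iff by blast
  finally show ?thesis .
qed

lemma mono_on_block: "mono_on A (block lam)"
  by (rule mono_onI) (rule block_mono)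

lemma W_J_eq: "W_J lam = young (sum_list lam) (block lam)"
  unfolding W_J_def J_set_eq by (rule generate_young[OF mono_on_block])

definition block_increasing :: "nat list \<Rightarrow> (nat \<Rightarrow> nat) \<Rightarrow> bool"
  where "block_increasing lam d \<longleftrightarrow> d permutes {1..sum_list lam} \<and>
    (\<forall>i j. 1 \<le> i \<and> i < j \<and> j \<le> sum_list lam \<and> block lam i = block lam j \<longrightarrow> d i < d j)"

lemma X_J_eq: "X_J lam = {d. block_increasing lam d}"
  unfolding X_J_def W_J_eq block_increasing_def by (rule min_coset_reps_young[OF mono_on_block])

text \<open>Reflects each block, the positions from \<open>psum lam b + 1\<close> to
  \<open>psum lam (Suc b)\<close>, in its midpoint. It turns out to be the longest element
  \<open>w_J lam\<close>.\<close>

definition block_reversal :: "nat list \<Rightarrow> nat \<Rightarrow> nat"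
  where "block_reversal lam i = (if i \<in> {1..sum_list lam}
    then psum lam (block lam i) + psum lam (Suc (block lam i)) + 1 - i else i)"

lemma block_reversal:
  assumes i: "1 \<le> i" "i \<le> sum_list lam"
  shows "block_reversal lam i \<in> {1..sum_list lam}" "block lam (block_reversal lam i) = block lam i"
    "block_reversal lam (block_reversal lam i) = i"
proof -
  obtain b where b: "b < length lam" "psum lam b < i" "i \<le> psum lam (Suc b)"
    using block_cases[OF i] by blast
  have bi: "block lam i = b" using b block_eqI by blast
  have "psum lam (Suc b) \<le> sum_list lam"
    using psum_mono[of "Suc b" "length lam" lam] b by simp
  moreover have r: "block_reversal lam i = psum lam b + psum lam (Suc b) + 1 - i"
    using i by (simp add: block_reversal_def bi)
  ultimately show in1: "block_reversal lam i \<in> {1..sum_list lam}" using b by auto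
  have "block lam (block_reversal lam i) = b" by (rule block_eqI) (use b r in auto)
  then show "block lam (block_reversal lam i) = block lam i" using bi by simp
  then show "block_reversal lam (block_reversal lam i) = i"
    using in1 bi r b by (subst block_reversal_def) auto
qed

lemma block_reversal_permutes: "block_reversal lam permutes {1..sum_list lam}"
proof (rule bij_imp_permutes)
  show "bij_betw (block_reversal lam) {1..sum_list lam} {1..sum_list lam}"
    by (rule bij_betw_byWitness[where f' = "block_reversal lam"]) (use block_reversal in auto)
qed (auto simp: block_reversal_def)

lemma block_reversal_decreasing:
  assumes "1 \<le> i" "i < j" "j \<le> sum_list lam" "block lam i = block lam j"
  shows "block_reversal lam j < block_reversal lam i"
proof -
  have "j \<le> psum lam (Suc (block lam i))"
    using block_iff[of j lam "block lam i"] assms by auto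
  then show ?thesis using assms by (auto simp: block_reversal_def)
qed

lemma invs_young:
  assumes "u \<in> young n b" "mono_on {1..n} b"
  shows "invs n u \<subseteq> {(i, j). 1 \<le> i \<and> i < j \<and> j \<le> n \<and> b i = b j}"
proof clarify
  fix i j assume ij: "(i, j) \<in> invs n u"
  have p: "u permutes {1..n}" and bu: "\<And>i. i \<in> {1..n} \<Longrightarrow> b (u i) = b i"
    using assms(1) by (auto simp: young_def)
  have r: "1 \<le> i" "i < j" "j \<le> n" "u j < u i" using ij by (auto simp: invs_def)
  have "u i \<in> {1..n}" "u j \<in> {1..n}" using permutes_in_image[OF p, of i] permutes_in_image[OF p, of j] r by simp_all
  then have "b (u j) \<le> b (u i)" using mono_onD[OF assms(2), of "u j" "u i"] r by simp
  then have "b j \<le> b i" using bu[of i] bu[of j] r by simp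
  moreover have "b i \<le> b j" using mono_onD[OF assms(2), of i j] r by simp
  ultimately show "1 \<le> i \<and> i < j \<and> j \<le> n \<and> b i = b j" using r by simp
qed

text \<open>An element of the Young subgroup inverts only pairs inside blocks. The reversal inverts
  all of them, so it has maximal length, and any element of that length has the same inversion
  set.\<close>

lemma w_J_eq: "w_J lam = block_reversal lam"
proof -
  let ?n = "sum_list lam" and ?r = "block_reversal lam"
  let ?B = "{(i, j). 1 \<le> i \<and> i < j \<and> j \<le> ?n \<and> block lam i = block lam j}"
  have rY: "?r \<in> young ?n (block lam)"
    using block_reversal_permutes block_reversal(2) by (auto simp: young_def)
  have invr: "invs ?n ?r = ?B"
    using invs_young[OF rY mono_on_block] block_reversal_decreasing by (auto simp: invs_def)
  have fin: "finite ?B" using invr finite_invs[of ?n ?r] by simp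
  have len: "cox_length ?n u = card (invs ?n u)" if "u \<in> young ?n (block lam)" for u
    using that cox_length_eq by (auto simp: young_def)
  show ?thesis
    unfolding w_J_def W_J_eq
  proof (rule the_equality, intro conjI ballI)
    show "cox_length ?n u \<le> cox_length ?n ?r" if "u \<in> young ?n (block lam)" for u
      using card_mono[OF fin invs_young[OF that mono_on_block]] len[OF that] len[OF rY] invr by simp
    fix w assume w: "w \<in> young ?n (block lam) \<and>
      (\<forall>u\<in>young ?n (block lam). cox_length ?n u \<le> cox_length ?n w)"
    then have wY: "w \<in> young ?n (block lam)" and "cox_length ?n ?r \<le> cox_length ?n w"
      using rY by blast+
    then have "card ?B \<le> card (invs ?n w)" using len[OF rY] len[OF wY] invr by simp
    then have "invs ?n w = ?B"
      using card_seteq[OF fin invs_young[OF wY mono_on_block]] by blast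
    then show "w = ?r"
      using invs_inject[of w ?n ?r] invr wY block_reversal_permutes by (auto simp: young_def)
  qed (rule rY)
qed

text \<open>\<open>last_to n v\<close> is the element $x_v$ of the context.\<close>

definition last_to :: "nat \<Rightarrow> nat \<Rightarrow> nat \<Rightarrow> nat"
  where "last_to n v i = (if i = Suc n then v else if v \<le> i \<and> i \<le> n then Suc i else i)"

lemma last_to_permutes:
  assumes "1 \<le> v" "v \<le> Suc n"
  shows "last_to n v permutes {1..Suc n}"
proof (rule bij_imp_permutes)
  show "bij_betw (last_to n v) {1..Suc n} {1..Suc n}"
    by (rule bij_betw_byWitness[where f' = "\<lambda>j. if j = v then Suc n else if v < j then j - 1 else j"])
       (use assms in \<open>auto simp: last_to_def split: if_splits\<close>)
qed (use assms in \<open>auto simp: last_to_def\<close>)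

lemma last_to_less_iff: "i \<le> n \<Longrightarrow> j \<le> n \<Longrightarrow> last_to n v i < last_to n v j \<longleftrightarrow> i < j"
  by (auto simp: last_to_def)

lemma last_to_Suc [simp]: "last_to n v (Suc n) = v"
  by (simp add: last_to_def)

lemma v_less_last_to_iff: "i \<le> n \<Longrightarrow> v < last_to n v i \<longleftrightarrow> v \<le> i"
  by (auto simp: last_to_def)

lemma permutes_Suc_decompose:
  assumes y: "y permutes {1..Suc n}"
  obtains z where "z permutes {1..n}" "y = z \<cdot> last_to n (y (Suc n))" "1 \<le> y (Suc n)" "y (Suc n) \<le> Suc n"
proof -
  let ?v = "y (Suc n)"
  have v: "1 \<le> ?v" "?v \<le> Suc n" using permutes_in_image[OF y, of "Suc n"] by auto
  note px = last_to_permutes[OF v]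
  have "inv' (last_to n ?v) \<circ> y permutes {1..Suc n}"
    using permutes_compose[OF y permutes_inv[OF px]] .
  then have "inv' (last_to n ?v) \<circ> y permutes {1..n}"
  proof (rule permutes_superset)
    have "inv' (last_to n ?v) ?v = Suc n"
      using permutes_inverses(2)[OF px, of "Suc n"] by simp
    then show "\<And>i. i \<in> {1..Suc n} - {1..n} \<Longrightarrow> (inv' (last_to n ?v) \<circ> y) i = i"
      by (auto simp: le_Suc_eq)
  qed
  moreover have "y = (inv' (last_to n ?v) \<circ> y) \<cdot> last_to n ?v"
    using permutes_inv_o(1)[OF px] by (simp add: comp_assoc[symmetric])
  ultimately show ?thesis using that v by blast
qed

lemma permutes_atMost_le:
  assumes "z permutes {1..n :: nat}" "i \<le> n"
  shows "z i \<le> n"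
  using permutes_in_image[OF assms(1), of i] permutes_not_in[OF assms(1), of i] assms(2)
  by (cases "i = 0") auto

lemma X'_eq: "X' n = {last_to n v | v. 1 \<le> v \<and> v \<le> Suc n}"
proof -
  \<comment> \<open>The labelling with the two blocks \<open>{1..n}\<close> and
    \<open>{Suc n}\<close>, whose Young subgroup is S_n; minimal representatives are then the
    permutations increasing on \<open>{1..n}\<close>.\<close>
  let ?b = "\<lambda>i. if i \<le> n then 0 else 1 :: nat"
  have "{u. u permutes {1..n}} = young (Suc n) ?b"
  proof (intro Set.set_eqI iffI)
    fix u assume "u \<in> {u. u permutes {1..n}}"
    then have u: "u permutes {1..n}" by simp
    have "u i \<le> n \<longleftrightarrow> i \<le> n" if "i \<in> {1..Suc n}" for i
      using permutes_atMost_le[OF u] permutes_not_in[OF u, of i] by (cases "i \<le> n") auto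
    then show "u \<in> young (Suc n) ?b"
      using permutes_subset[OF u, of "{1..Suc n}"] by (auto simp: young_def)
  next
    fix u assume u: "u \<in> young (Suc n) ?b"
    then have p: "u permutes {1..Suc n}" by (simp add: young_def)
    have "?b (u (Suc n)) = ?b (Suc n)" using u by (simp add: young_def)
    then have "u (Suc n) > n" by (auto split: if_splits)
    then have "u (Suc n) = Suc n" using permutes_in_image[OF p, of "Suc n"] by auto
    then have "\<And>i. i \<in> {1..Suc n} - {1..n} \<Longrightarrow> u i = i" by (auto simp: le_Suc_eq)
    then show "u \<in> {u. u permutes {1..n}}" using permutes_superset[OF p] by blast
  qed
  moreover have "mono_on {1..Suc n} ?b" by (auto intro: mono_onI)
  ultimately have X: "X' n = {d. d permutes {1..Suc n} \<and>
      (\<forall>i j. 1 \<le> i \<and> i < j \<and> j \<le> Suc n \<and> ?b i = ?b j \<longrightarrow> d i < d j)}"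
    unfolding X'_def by (simp only: min_coset_reps_young)
  show ?thesis
  proof (intro Set.set_eqI iffI)
    fix x assume "x \<in> X' n"
    then have p: "x permutes {1..Suc n}" and inc: "\<And>i j. 1 \<le> i \<Longrightarrow> i < j \<Longrightarrow> j \<le> n \<Longrightarrow> x i < x j"
      unfolding X by auto
    obtain z where z: "z permutes {1..n}" "x = z \<cdot> last_to n (x (Suc n))" "1 \<le> x (Suc n)" "x (Suc n) \<le> Suc n"
      using permutes_Suc_decompose[OF p] by blast
    have "z i < z (Suc i)" if "1 \<le> i" "i < n" for i
    proof -
      have "x i < x (Suc i)" using inc that by simp
      then have "last_to n (x (Suc n)) (z i) < last_to n (x (Suc n)) (z (Suc i))"
        using z(2) by (metis comp_apply)
      then show ?thesis using last_to_less_iff permutes_atMost_le[OF z(1)] that by simp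
    qed
    then have "z = id" using permutes_strict_imp_id[OF z(1)] by blast
    then have "x = last_to n (x (Suc n))" using z(2) by simp
    then show "x \<in> {last_to n v | v. 1 \<le> v \<and> v \<le> Suc n}" using z(3,4) by blast
  next
    fix x assume "x \<in> {last_to n v | v. 1 \<le> v \<and> v \<le> Suc n}"
    then obtain v where v: "x = last_to n v" "1 \<le> v" "v \<le> Suc n" by blast
    then show "x \<in> X' n"
      unfolding X using last_to_permutes last_to_less_iff by (auto simp: le_Suc_eq)
  qed
qed

lemma invs_last_to:
  assumes "1 \<le> v"
  shows "invs (Suc n) (last_to n v) = {(i, Suc n) | i. v \<le> i \<and> i \<le> n}"
  using assms by (auto simp: invs_def last_to_def le_Suc_eq split: if_splits)

lemma prefix_of_last_to:
  assumes "1 \<le> u" "u \<le> Suc n" "1 \<le> v" "v \<le> Suc n" "v \<le> u"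
  shows "prefix_of (Suc n) (last_to n u) (last_to n v)"
  unfolding prefix_of_iff[OF last_to_permutes[OF assms(1,2)] last_to_permutes[OF assms(3,4)]]
  using assms by (auto simp: invs_last_to)

text \<open>Separates the inversions that involve the last position from the others. The others
  determine \<open>z\<close>, which gives injectivity and lets prefixes be restricted; those at the
  last position become more as \<open>v\<close> decreases.\<close>

lemma invs_compose_last_to:
  assumes "z permutes {1..n}"
  shows "invs (Suc n) (z \<cdot> last_to n v) \<inter> {(i, j). j \<le> n} = invs n z"
    and "(i, Suc n) \<in> invs (Suc n) (z \<cdot> last_to n v) \<longleftrightarrow> 1 \<le> i \<and> i \<le> n \<and> v \<le> z i"
proof -
  have z: "z i \<le> n" if "i \<le> n" for i using permutes_atMost_le[OF assms that] .
  show "invs (Suc n) (z \<cdot> last_to n v) \<inter> {(i, j). j \<le> n} = invs n z"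
  proof (intro Set.set_eqI)
    fix p :: "nat \<times> nat"
    obtain i j where ij: "p = (i, j)" by fastforce
    have "last_to n v (z j) < last_to n v (z i) \<longleftrightarrow> z j < z i" if "i < j" "j \<le> n"
      using last_to_less_iff[OF z z, of j i v] that by simp
    then show "p \<in> invs (Suc n) (z \<cdot> last_to n v) \<inter> {(i, j). j \<le> n} \<longleftrightarrow> p \<in> invs n z"
      unfolding ij invs_def by auto
  qed
  have "z (Suc n) = Suc n" using permutes_not_in[OF assms, of "Suc n"] by simp
  then show "(i, Suc n) \<in> invs (Suc n) (z \<cdot> last_to n v) \<longleftrightarrow> 1 \<le> i \<and> i \<le> n \<and> v \<le> z i"
    using v_less_last_to_iff[OF z, of i v] by (auto simp: invs_def less_Suc_eq_le)
qed

lemma compose_last_to_permutes: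
  assumes "z permutes {1..n}" "1 \<le> v" "v \<le> Suc n"
  shows "z \<cdot> last_to n v permutes {1..Suc n}"
  using permutes_compose[OF permutes_subset[OF assms(1)] last_to_permutes[OF assms(2,3)]] by auto

lemma prefix_of_compose_last_to:
  assumes "z permutes {1..n}" "1 \<le> u" "u \<le> Suc n" "1 \<le> v" "v \<le> Suc n" "v \<le> u"
  shows "prefix_of (Suc n) (z \<cdot> last_to n u) (z \<cdot> last_to n v)"
proof -
  have "invs (Suc n) (z \<cdot> last_to n u) \<subseteq> invs (Suc n) (z \<cdot> last_to n v)"
  proof
    fix p assume p: "p \<in> invs (Suc n) (z \<cdot> last_to n u)"
    obtain i j where ij: "p = (i, j)" by fastforce
    then consider "j \<le> n" | "j = Suc n" using p by (auto simp: invs_def le_Suc_eq)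
    then show "p \<in> invs (Suc n) (z \<cdot> last_to n v)"
    proof cases
      case 1
      then show ?thesis using invs_compose_last_to(1)[OF assms(1)] p ij by blast
    next
      case 2
      then show ?thesis using p ij assms(6) unfolding ij 2 invs_compose_last_to(2)[OF assms(1)] by simp
    qed
  qed
  then show ?thesis
    unfolding prefix_of_iff[OF compose_last_to_permutes[OF assms(1-3)] compose_last_to_permutes[OF assms(1,4,5)]] .
qed

section \<open>Right cells of longest elements\<close>

definition pos_adj :: "nat list \<Rightarrow> (nat \<Rightarrow> nat) \<Rightarrow> nat \<Rightarrow> nat \<Rightarrow> bool"
  where "pos_adj lam d i j \<longleftrightarrow>
    i \<noteq> j \<and> (block lam i = block lam j \<or> (i < j \<and> d j < d i) \<or> (j < i \<and> d i < d j))"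

text \<open>
  Positions are adjacent if no increasing subsequence of the word of \<open>block_reversal lam \<cdot> d\<close>, in which
  the letters of each block are decreasing, contains both.  Each block is a clique, so
  \<open>min_sum k lam\<close> is the largest conceivable size of a set in the next definition.
\<close>

definition full :: "nat list \<Rightarrow> (nat \<Rightarrow> nat) \<Rightarrow> bool"
  where "full lam d \<longleftrightarrow> (\<forall>k. \<exists>A\<subseteq>{1..sum_list lam}.
    clique_le (pos_adj lam d) k A \<and> card A = min_sum k lam)"

lemma before_map:
  "inj_on f (set xs) \<Longrightarrow> a \<in> set xs \<Longrightarrow> b \<in> set xs \<Longrightarrow> before (map f xs) (f a) (f b) \<longleftrightarrow> before xs a b"
proof (induction xs)
  case (Cons x xs)
  have inj: "inj_on f (set xs)" using Cons.prems(1) by (auto simp: inj_on_def)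
  have x: "f x = f a \<longleftrightarrow> x = a" "f x = f b \<longleftrightarrow> x = b"
    using Cons.prems by (auto simp: inj_on_def)
  have b: "f b \<in> f ` set xs \<longleftrightarrow> b \<in> set xs" "f a \<in> f ` set xs \<longleftrightarrow> a \<in> set xs"
    using Cons.prems inj_on_image_mem_iff[of f "set (x # xs)" _ "set xs"] by auto
  show ?case
  proof (cases "a \<in> set xs \<and> b \<in> set xs")
    case True
    then show ?thesis using Cons.IH[OF inj] x b by auto
  next
    case False
    then have "\<not> before (map f xs) (f a) (f b)" "\<not> before xs a b" using b by (auto dest: before_set)
    then show ?thesis using x b by auto
  qed
qed simp

lemma before_upt: "i \<in> {m..<n} \<Longrightarrow> j \<in> {m..<n} \<Longrightarrow> before [m..<n] i j \<longleftrightarrow> i < j"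
  using before_total[of i "[m..<n]" j] before_sorted_wrt[OF sorted_wrt_upt[of m n], of i j]
    before_sorted_wrt[OF sorted_wrt_upt[of m n], of j i] by auto

definition word_blocks :: "nat list \<Rightarrow> (nat \<Rightarrow> nat) \<Rightarrow> nat list list"
  where "word_blocks lam d = map (\<lambda>b. map (d \<circ> block_reversal lam)
    [Suc (psum lam b)..<Suc (psum lam (Suc b))]) [0..<length lam]"

lemma concat_word_blocks:
  "concat (word_blocks lam d) = row_form (sum_list lam) (block_reversal lam \<cdot> d)"
proof -
  have "concat (map (\<lambda>b. [Suc (psum lam b)..<Suc (psum lam (Suc b))]) [0..<m])
    = [Suc 0..<Suc (psum lam m)]" if "m \<le> length lam" for m
    using that
  proof (induction m)
    case (Suc m)
    have "psum lam m \<le> psum lam (Suc m)" by (rule psum_mono) simp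
    moreover have "[0..<Suc m] = [0..<m] @ [m]" by simp
    ultimately show ?case using Suc upt_add_eq_append[of "Suc 0" "Suc (psum lam m)"
          "psum lam (Suc m) - psum lam m"]
      by (simp del: upt_Suc)
  qed simp
  then have c: "concat (map (\<lambda>b. [Suc (psum lam b)..<Suc (psum lam (Suc b))])
      [0..<length lam]) = [1..<Suc (sum_list lam)]"
    by (simp del: upt_Suc)
  have "word_blocks lam d = map (map (d \<circ> block_reversal lam))
      (map (\<lambda>b. [Suc (psum lam b)..<Suc (psum lam (Suc b))]) [0..<length lam])"
    unfolding word_blocks_def map_map comp_def ..
  then show ?thesis unfolding row_form_def by (simp only: map_concat[symmetric] c)
qed

lemma word_blocks_length: "map length (word_blocks lam d) = lam"
  by (rule nth_equalityI) (auto simp: word_blocks_def take_Suc_conv_app_nth)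

lemma block_between:
  assumes "b < length lam" "psum lam b < i" "i \<le> psum lam (Suc b)"
  shows "1 \<le> i" "i \<le> sum_list lam" "block lam i = b"
  using assms psum_mono[of "Suc b" "length lam" lam] block_eqI by auto

lemma block_increasing_reversal:
  assumes d: "block_increasing lam d" and ij: "1 \<le> i" "i < j" "j \<le> sum_list lam" "block lam i = block lam j"
  shows "d (block_reversal lam j) < d (block_reversal lam i)"
proof -
  have "block_reversal lam i \<in> {1..sum_list lam}" "block_reversal lam j \<in> {1..sum_list lam}"
    "block lam (block_reversal lam i) = block lam i" "block lam (block_reversal lam j) = block lam j"
    using block_reversal[of i lam] block_reversal[of j lam] ij by simp_all
  then show ?thesis
    using d block_reversal_decreasing[OF ij] ij(4) unfolding block_increasing_def by simp
qed

lemma word_blocks_decreasing: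
  assumes d: "block_increasing lam d" and "bl \<in> set (word_blocks lam d)"
  shows "sorted_wrt (>) bl"
proof -
  obtain b where b: "b < length lam" "bl = map (d \<circ> block_reversal lam)
      [Suc (psum lam b)..<Suc (psum lam (Suc b))]"
    using assms(2) by (auto simp: word_blocks_def)
  show ?thesis
    unfolding b(2) sorted_wrt_map comp_apply
  proof (rule sorted_wrt_mono_rel[OF _ sorted_wrt_upt])
    fix i j assume ij: "i \<in> set [Suc (psum lam b)..<Suc (psum lam (Suc b))]"
      "j \<in> set [Suc (psum lam b)..<Suc (psum lam (Suc b))]" "i < j"
    then have "psum lam b < i" "i \<le> psum lam (Suc b)"
        "psum lam b < j" "j \<le> psum lam (Suc b)" by auto
    then have "1 \<le> i" "j \<le> sum_list lam" "block lam i = block lam j"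
      using block_between[OF b(1)] by simp_all
    then show "d (block_reversal lam j) < d (block_reversal lam i)"
      using block_increasing_reversal[OF d] ij(3) by blast
  qed
qed

text \<open>Inside a block the reversal turns the increasing letters of \<open>d\<close> into a
  decreasing run, so every pair is inverted. Between blocks it keeps the order of positions and
  leaves the inversions of \<open>d\<close>.\<close>

lemma inverted_word_iff:
  assumes d: "block_increasing lam d" and pq: "p \<in> {1..sum_list lam}" "q \<in> {1..sum_list lam}"
  shows "inverted (concat (word_blocks lam d)) (d p) (d q) \<longleftrightarrow> pos_adj lam d p q"
proof -
  let ?n = "sum_list lam" and ?r = "block_reversal lam"
  let ?W = "concat (word_blocks lam d)"
  have pd: "d permutes {1..?n}" using d by (simp add: block_increasing_def)
  have injd: "d i = d j \<longleftrightarrow> i = j" for i j using inj_eq[OF permutes_inj[OF pd]] .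
  have perm: "d \<circ> ?r permutes {1..?n}" using permutes_compose[OF block_reversal_permutes pd] .
  have W: "?W = map (d \<circ> ?r) [1..<Suc ?n]" by (simp add: concat_word_blocks row_form_def)
  \<comment> \<open>The letter \<open>d p\<close> stands at position \<open>?r p\<close> of the word
    because \<open>?r\<close> is an involution.\<close>
  have bef: "before ?W (d p) (d q) \<longleftrightarrow> ?r p < ?r q" if pq: "p \<in> {1..?n}" "q \<in> {1..?n}" for p q
  proof -
    have r: "?r p \<in> {1..?n}" "?r q \<in> {1..?n}" "?r (?r p) = p" "?r (?r q) = q"
      using block_reversal pq by simp_all
    have "before ?W ((d \<circ> ?r) (?r p)) ((d \<circ> ?r) (?r q)) \<longleftrightarrow> before [1..<Suc ?n] (?r p) (?r q)"
      unfolding W by (rule before_map[OF permutes_inj_on[OF perm]]) (use r in auto)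
    then show ?thesis using r before_upt[of "?r p" 1 "Suc ?n" "?r q"] by auto
  qed
  have *: "inverted ?W (d p) (d q) \<longleftrightarrow> pos_adj lam d p q"
    if pq: "p \<in> {1..?n}" "q \<in> {1..?n}" "p < q" for p q
  proof (cases "block lam p = block lam q")
    case True
    then have "?r q < ?r p" using block_reversal_decreasing[of p q lam] pq by simp
    moreover have "d p < d q" using d True pq by (simp add: block_increasing_def)
    ultimately show ?thesis using bef pq True by (simp add: inverted_def pos_adj_def)
  next
    case False
    have "block lam (?r p) = block lam p" "block lam (?r q) = block lam q"
      using block_reversal(2) pq by simp_all
    moreover have "block lam p < block lam q" using False block_mono[of p q lam] pq by simp
    ultimately have "?r p < ?r q" using block_mono[of "?r q" "?r p" lam] by linarith
    then show ?thesis using bef pq False by (auto simp: inverted_def pos_adj_def)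
  qed
  have "pos_adj lam d p q = pos_adj lam d q p" "inverted ?W (d p) (d q) = inverted ?W (d q) (d p)"
    by (auto simp: pos_adj_def inverted_def)
  then show ?thesis
    using *[of p q] *[of q p] pq by (cases p q rule: linorder_cases) (auto simp: pos_adj_def inverted_def)
qed

lemma good_card_word_iff:
  assumes d: "block_increasing lam d"
  shows "good_card (concat (word_blocks lam d)) k m \<longleftrightarrow>
    (\<exists>A\<subseteq>{1..sum_list lam}. clique_le (pos_adj lam d) k A \<and> card A = m)"
proof -
  let ?n = "sum_list lam" and ?W = "concat (word_blocks lam d)"
  have pd: "d permutes {1..?n}" using d by (simp add: block_increasing_def)
  note inj = permutes_inj[OF pd]
  have perm: "d \<circ> block_reversal lam permutes {1..?n}"
    using permutes_compose[OF block_reversal_permutes pd] .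
  have "set [1..<Suc ?n] = {1..?n}" by auto
  then have setW: "set ?W = {1..?n}"
    using permutes_image[OF perm] by (simp add: concat_word_blocks row_form_def del: upt_Suc)
  show ?thesis
  proof
    assume "good_card ?W k m"
    then obtain A where A: "A \<subseteq> {1..?n}" "clique_le (inverted ?W) k A" "card A = m"
      using setW by (auto simp: good_card_def)
    have inn: "inv' d a \<in> {1..?n}" if "a \<in> A" for a
      using permutes_in_image[OF permutes_inv[OF pd], of a] that A(1) by blast
    have injd': "inj_on (inv' d) A" using permutes_inj_on[OF permutes_inv[OF pd]] .
    have "clique_le (pos_adj lam d) k (inv' d ` A)"
    proof (rule clique_le_image[OF A(2) injd'])
      fix a b assume ab: "a \<in> A" "b \<in> A" "pos_adj lam d (inv' d a) (inv' d b)"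
      then have "inverted ?W (d (inv' d a)) (d (inv' d b))"
        using inverted_word_iff[OF d inn inn] by blast
      then show "inverted ?W a b" using permutes_inverses(1)[OF pd] by simp
    qed
    moreover have "card (inv' d ` A) = m" using A(3) injd' card_image by blast
    moreover have "inv' d ` A \<subseteq> {1..?n}" using inn by blast
    ultimately show "\<exists>A\<subseteq>{1..?n}. clique_le (pos_adj lam d) k A \<and> card A = m" by blast
  next
    assume "\<exists>A\<subseteq>{1..?n}. clique_le (pos_adj lam d) k A \<and> card A = m"
    then obtain A where A: "A \<subseteq> {1..?n}" "clique_le (pos_adj lam d) k A" "card A = m" by blast
    have injA: "inj_on d A" using permutes_inj_on[OF pd] .
    have "clique_le (inverted ?W) k (d ` A)"
    proof (rule clique_le_image[OF A(2) injA])
      fix a b assume ab: "a \<in> A" "b \<in> A" "inverted ?W (d a) (d b)"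
      then show "pos_adj lam d a b" using inverted_word_iff[OF d] A(1) by blast
    qed
    moreover have "card (d ` A) = m" using A(3) injA card_image by blast
    moreover have "d ` A \<subseteq> set ?W"
      unfolding setW using A(1) permutes_image[OF pd] by blast
    ultimately show "good_card ?W k m" unfolding good_card_def by blast
  qed
qed

lemma min_sum_eq: "min_sum k ls = (\<Sum>b<length ls. min k (ls ! b))"
  by (simp add: min_sum_def sum_list_sum_nth atLeast0LessThan)

lemma block_increasing_id: "block_increasing lam id"
  by (simp add: block_increasing_def permutes_id del: id_apply) (simp add: id_def)

text \<open>For the identity every clique stays inside one block, so the first
  \<open>min k (lam ! b)\<close> positions of all blocks \<open>b\<close> together form an optimal
  set.\<close>

lemma full_id: "full lam id"
  unfolding full_def
proof
  fix k
  define I where "I b = {psum lam b<..psum lam b + min k (lam ! b)}" for b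
  define A where "A = (\<Union>b<length lam. I b)"
  have I: "i \<in> {1..sum_list lam} \<and> block lam i = b" if "b < length lam" "i \<in> I b" for i b
    using block_between[OF that(1), of i] that by (auto simp: I_def take_Suc_conv_app_nth)
  have "card A = (\<Sum>b<length lam. card (I b))"
    unfolding A_def
  proof (rule card_UN_disjoint)
    show "\<forall>b\<in>{..<length lam}. \<forall>b'\<in>{..<length lam}. b \<noteq> b' \<longrightarrow> I b \<inter> I b' = {}"
    proof (intro ballI impI equals0I)
      fix b b' i assume b: "b \<in> {..<length lam}" "b' \<in> {..<length lam}" "b \<noteq> b'" "i \<in> I b \<inter> I b'"
      then show False using I[of b i] I[of b' i] by simp
    qed
  qed (simp_all add: I_def)
  then have "card A = min_sum k lam" by (simp add: I_def min_sum_eq)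
  moreover have "A \<subseteq> {1..sum_list lam}" using I by (auto simp: A_def)
  moreover have "clique_le (pos_adj lam id) k A"
    unfolding clique_le_def
  proof (intro conjI allI impI)
    show "finite A" by (simp add: A_def I_def)
    fix C assume C: "C \<subseteq> A" "pairwise (pos_adj lam id) C"
    show "card C \<le> k"
    proof (cases "C = {}")
      case False
      then obtain c where c: "c \<in> C" by blast
      then obtain b where b: "b < length lam" "c \<in> I b" using C(1) by (auto simp: A_def)
      have "C \<subseteq> I b"
      proof
        fix a assume a: "a \<in> C"
        then obtain b' where b': "b' < length lam" "a \<in> I b'" using C(1) by (auto simp: A_def)
        have "block lam a = block lam c"
        proof (cases "a = c")
          case False
          then have "pos_adj lam id a c" using C(2) a c by (simp add: pairwise_def)
          then show ?thesis by (auto simp: pos_adj_def)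
        qed simp
        then show "a \<in> I b" using I[OF b(1,2)] I[OF b'] b'(2) by simp
      qed
      then have "card C \<le> card (I b)" by (intro card_mono) (simp_all add: I_def)
      then show ?thesis by (simp add: I_def)
    qed simp
  qed
  ultimately show "\<exists>A\<subseteq>{1..sum_list lam}. clique_le (pos_adj lam id) k A \<and> card A = min_sum k lam"
    by blast
qed

text \<open>\<open>w_J lam\<close> is the product of \<open>block_reversal lam\<close> with the
  identity, which is full; it serves as the reference in
  \<open>recording_tableau_eq_iff\<close>.\<close>

lemma Z_set_eq: "Z_set lam = {d. block_increasing lam d \<and> full lam d}"
proof -
  let ?n = "sum_list lam" and ?r = "block_reversal lam"
  have Q: "Q_tab ?n (?r \<cdot> d) = add_boxes 1 (boxes [] (concat (word_blocks lam d))) []" for d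
    by (simp add: Q_tab_def robinson_schensted_def fold_rs_step concat_word_blocks)
  have dist: "distinct (concat (word_blocks lam d))" if "block_increasing lam d" for d
  proof -
    have "d permutes {1..?n}" using that by (simp add: block_increasing_def)
    then have "inj (d \<circ> ?r)"
      using permutes_compose[OF block_reversal_permutes] permutes_inj by blast
    then have "inj_on (d \<circ> ?r) (set [1..<Suc ?n])" using inj_on_subset by blast
    then show ?thesis unfolding concat_word_blocks row_form_def distinct_map by simp
  qed
  have "right_cell_equiv ?n (?r \<cdot> d) ?r \<longleftrightarrow> full lam d" if d: "block_increasing lam d" for d
  proof -
    have "right_cell_equiv ?n (?r \<cdot> d) ?r \<longleftrightarrow> Q_tab ?n (?r \<cdot> d) = Q_tab ?n (?r \<cdot> id)"
      by (simp only: right_cell_equiv_def id_comp)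
    also have "\<dots> \<longleftrightarrow> (\<forall>k. good_card (concat (word_blocks lam d)) k (min_sum k (map length (word_blocks lam d))))"
      unfolding Q
    proof (rule recording_tableau_eq_iff)
      show "good_card (concat (word_blocks lam id)) k (min_sum k (map length (word_blocks lam id)))" for k
        using full_id[of lam] good_card_word_iff[OF block_increasing_id]
        unfolding full_def word_blocks_length by blast
    qed (use dist d block_increasing_id word_blocks_decreasing[OF d]
        word_blocks_decreasing[OF block_increasing_id] word_blocks_length in \<open>simp_all\<close>)
    also have "\<dots> \<longleftrightarrow> full lam d"
      by (simp only: word_blocks_length good_card_word_iff[OF d] full_def)
    finally show ?thesis .
  qed
  then show ?thesis by (auto simp: Z_set_def X_J_eq w_J_eq)
qed

section \<open>Admissible diagrams\<close>

text \<open>Row filling and column filling are ranks of the nodes in two linear orders, one by rows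
  and one by columns.\<close>

lemma rank_bij:
  fixes le :: "'a \<Rightarrow> 'a \<Rightarrow> bool"
  assumes fin: "finite D" and refl: "\<And>p. le p p" and trans: "\<And>p q r. le p q \<Longrightarrow> le q r \<Longrightarrow> le p r"
    and antisym: "\<And>p q. le p q \<Longrightarrow> le q p \<Longrightarrow> p = q" and total: "\<And>p q. le p q \<or> le q p"
  defines "rank \<equiv> \<lambda>p. card {q \<in> D. le q p}"
  shows "bij_betw rank D {1..card D}"
    and "p \<in> D \<Longrightarrow> q \<in> D \<Longrightarrow> rank p < rank q \<longleftrightarrow> \<not> le q p"
proof -
  have le_rank: "rank p \<le> rank q" if "le p q" for p q
    unfolding rank_def by (rule card_mono) (use fin trans that in auto)
  have less: "rank p < rank q" if "q \<in> D" "\<not> le q p" for p q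
    unfolding rank_def
  proof (rule psubset_card_mono)
    have "le p q" using total that(2) by blast
    then show "{r \<in> D. le r p} \<subset> {r \<in> D. le r q}" using trans refl that by blast
  qed (use fin in simp)
  show "rank p < rank q \<longleftrightarrow> \<not> le q p" if "p \<in> D" "q \<in> D" for p q
    using less[OF that(2)] le_rank by (meson leD)
  have inj: "inj_on rank D"
    by (rule inj_onI) (metis antisym less less_irrefl)
  have "rank p \<in> {1..card D}" if "p \<in> D" for p
  proof -
    have "0 < rank p" unfolding rank_def using fin refl that by (auto simp: card_gt_0_iff)
    moreover have "rank p \<le> card D" unfolding rank_def by (rule card_mono) (use fin in auto)
    ultimately show ?thesis by simp
  qed
  then have "rank ` D \<subseteq> {1..card D}" by blast
  moreover have "card (rank ` D) = card {1..card D}" using inj by (simp add: card_image)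
  ultimately have "rank ` D = {1..card D}" by (simp add: card_subset_eq)
  then show "bij_betw rank D {1..card D}" using inj by (simp add: bij_betw_def)
qed

lemma row_filling_bij:
  assumes "finite D"
  shows "bij_betw (row_filling D) D {1..card D}"
  unfolding row_filling_def[abs_def]
  by (rule rank_bij(1)[where le = "\<lambda>q p. fst q < fst p \<or> (fst q = fst p \<and> snd q \<le> snd p)"]) (use assms in \<open>auto simp: prod_eq_iff\<close>)

lemma row_filling_less:
  assumes "finite D" "p \<in> D" "q \<in> D"
  shows "row_filling D p < row_filling D q \<longleftrightarrow> fst p < fst q \<or> (fst p = fst q \<and> snd p < snd q)"
proof -
  have "row_filling D p < row_filling D q \<longleftrightarrow> \<not> (fst q < fst p \<or> (fst q = fst p \<and> snd q \<le> snd p))"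
    unfolding row_filling_def
    by (rule rank_bij(2)[where le = "\<lambda>q p. fst q < fst p \<or> (fst q = fst p \<and> snd q \<le> snd p)"]) (use assms in \<open>auto simp: prod_eq_iff\<close>)
  then show ?thesis by linarith
qed

lemma col_filling_bij:
  assumes "finite D"
  shows "bij_betw (col_filling D) D {1..card D}"
  unfolding col_filling_def[abs_def]
  by (rule rank_bij(1)[where le = "\<lambda>q p. snd q < snd p \<or> (snd q = snd p \<and> fst q \<le> fst p)"]) (use assms in \<open>auto simp: prod_eq_iff\<close>)

lemma col_filling_less:
  assumes "finite D" "p \<in> D" "q \<in> D"
  shows "col_filling D p < col_filling D q \<longleftrightarrow> snd p < snd q \<or> (snd p = snd q \<and> fst p < fst q)"
proof -
  have "col_filling D p < col_filling D q \<longleftrightarrow> \<not> (snd q < snd p \<or> (snd q = snd p \<and> fst q \<le> fst p))"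
    unfolding col_filling_def
    by (rule rank_bij(2)[where le = "\<lambda>q p. snd q < snd p \<or> (snd q = snd p \<and> fst q \<le> fst p)"]) (use assms in \<open>auto simp: prod_eq_iff\<close>)
  then show ?thesis by linarith
qed

lemma diagram_perm_unique:
  assumes fin: "finite D" and w: "w permutes {1..card D}" "\<And>p. p \<in> D \<Longrightarrow> w (row_filling D p) = col_filling D p"
  shows "diagram_perm D = w"
  unfolding diagram_perm_def
proof (rule the_equality)
  show "w permutes {1..card D} \<and> (\<forall>p\<in>D. w (row_filling D p) = col_filling D p)" using w by blast
  fix v assume v: "v permutes {1..card D} \<and> (\<forall>p\<in>D. v (row_filling D p) = col_filling D p)"
  show "v = w"
  proof
    fix i show "v i = w i"
    proof (cases "i \<in> {1..card D}")
      case True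
      then obtain p where "p \<in> D" "i = row_filling D p"
        using row_filling_bij[OF fin] by (metis bij_betw_imp_surj_on imageE)
      then show ?thesis using v w(2) by simp
    next
      case False
      then show ?thesis using v w(1) permutes_not_in by metis
    qed
  qed
qed

lemma diagram_perm:
  assumes fin: "finite D"
  shows "diagram_perm D permutes {1..card D}"
    and "p \<in> D \<Longrightarrow> diagram_perm D (row_filling D p) = col_filling D p"
proof -
  let ?n = "card D"
  define w where "w i = (if i \<in> {1..?n} then col_filling D (inv_into D (row_filling D) i) else i)" for i
  note rb = row_filling_bij[OF fin]
  have "bij_betw (col_filling D \<circ> inv_into D (row_filling D)) {1..?n} {1..?n}"
    using bij_betw_trans[OF bij_betw_inv_into[OF rb] col_filling_bij[OF fin]] .
  moreover have "bij_betw w {1..?n} {1..?n} \<longleftrightarrow>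
      bij_betw (col_filling D \<circ> inv_into D (row_filling D)) {1..?n} {1..?n}"
    by (rule bij_betw_cong) (simp add: w_def)
  ultimately have "bij_betw w {1..?n} {1..?n}" by simp
  then have w: "w permutes {1..?n}" by (rule bij_imp_permutes) (auto simp: w_def)
  have wp: "w (row_filling D p) = col_filling D p" if "p \<in> D" for p
    using that bij_betwE[OF rb] bij_betw_inv_into_left[OF rb that] by (simp add: w_def)
  have "diagram_perm D = w" using diagram_perm_unique[OF fin w wp] .
  then show "diagram_perm D permutes {1..card D}"
    "p \<in> D \<Longrightarrow> diagram_perm D (row_filling D p) = col_filling D p"
    using w wp by simp_all
qed

lemma diagramsD:
  assumes "D \<in> diagrams lam"
  shows "finite D" "num_rows D = length lam" "fst ` D = {1..length lam}" "snd ` D = {1..num_cols D}"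
    "a < length lam \<Longrightarrow> card {b. (Suc a, b) \<in> D} = lam ! a"
proof -
  have D: "principal_diagram D" "row_comp D = lam" using assms by (auto simp: diagrams_def)
  then show r: "num_rows D = length lam" by (auto simp: row_comp_def)
  show "finite D" "fst ` D = {1..length lam}" "snd ` D = {1..num_cols D}"
    using D(1) r by (auto simp: principal_diagram_def)
  show "card {b. (Suc a, b) \<in> D} = lam ! a" if "a < length lam"
  proof -
    have "row_comp D ! a = card {b. (Suc a, b) \<in> D}"
      using that r by (simp add: row_comp_def del: upt_Suc)
    then show ?thesis using D(2) by simp
  qed
qed

lemma diagram_rows_card:
  assumes D: "D \<in> diagrams lam" and "t \<le> length lam"
  shows "card {q \<in> D. fst q \<le> t} = psum lam t"
  using assms(2)
proof (induction t)
  case 0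
  have "{q \<in> D. fst q \<le> 0} = {}" using diagramsD(3)[OF D] by force
  then show ?case by (simp only: card.empty take_0 sum_list.Nil)
next
  case (Suc t)
  have "{q \<in> D. fst q \<le> Suc t} = {q \<in> D. fst q \<le> t} \<union> Pair (Suc t) ` {b. (Suc t, b) \<in> D}"
    by (auto simp: le_Suc_eq)
  moreover have "{q \<in> D. fst q \<le> t} \<inter> Pair (Suc t) ` {b. (Suc t, b) \<in> D} = {}" by auto
  moreover have "finite (Pair (Suc t) ` {b. (Suc t, b) \<in> D})"
    using diagramsD(1)[OF D] by (rule finite_subset[rotated]) auto
  moreover have "card (Pair (Suc t) ` {b. (Suc t, b) \<in> D}) = lam ! t"
    using diagramsD(5)[OF D] Suc.prems by (simp add: card_image inj_on_def)
  ultimately have "card {q \<in> D. fst q \<le> Suc t} = card {q \<in> D. fst q \<le> t} + lam ! t"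
    using diagramsD(1)[OF D]
      card_Un_disjoint[of "{q \<in> D. fst q \<le> t}" "Pair (Suc t) ` {b. (Suc t, b) \<in> D}"]
    by auto
  then show ?case using Suc by (simp add: take_Suc_conv_app_nth)
qed

lemma diagram_card:
  assumes D: "D \<in> diagrams lam"
  shows "card D = sum_list lam"
proof -
  have "{q \<in> D. fst q \<le> length lam} = D" using diagramsD(3)[OF D] by force
  then show ?thesis using diagram_rows_card[OF D, of "length lam"] by simp
qed

lemma block_row_filling:
  assumes D: "D \<in> diagrams lam" and p: "p \<in> D"
  shows "Suc (block lam (row_filling D p)) = fst p"
proof -
  have "fst p \<in> {1..length lam}" using diagramsD(3)[OF D] p by blast
  then obtain a where a: "fst p = Suc a" "a < length lam" by (cases "fst p") auto
  have fin: "finite D" using diagramsD(1)[OF D] .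
  have "{q \<in> D. fst q \<le> a} \<subset> {q \<in> D. fst q < fst p \<or> (fst q = fst p \<and> snd q \<le> snd p)}"
    (is "?L \<subset> ?R")
  proof (rule psubsetI)
    show "?L \<subseteq> ?R" using a by auto
    have "p \<in> ?R" "p \<notin> ?L" using a p by auto
    then show "?L \<noteq> ?R" by blast
  qed
  then have "psum lam a < row_filling D p"
    unfolding row_filling_def diagram_rows_card[OF D less_imp_le[OF a(2)], symmetric]
    by (intro psubset_card_mono) (use fin in auto)
  moreover have "row_filling D p \<le> card {q \<in> D. fst q \<le> Suc a}"
    unfolding row_filling_def by (rule card_mono) (use fin a in auto)
  then have "row_filling D p \<le> psum lam (Suc a)"
    using diagram_rows_card[OF D, of "Suc a"] a(2) by simp
  ultimately have "block lam (row_filling D p) = a" using block_eqI a(2) by blast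
  then show ?thesis using a(1) by simp
qed

section \<open>Paths and cliques of incomparable nodes\<close>

definition path_lt :: "nat \<times> nat \<Rightarrow> nat \<times> nat \<Rightarrow> bool"
  where "path_lt p q \<longleftrightarrow> fst p < fst q \<and> snd p \<le> snd q"

definition node_adj :: "nat \<times> nat \<Rightarrow> nat \<times> nat \<Rightarrow> bool"
  where "node_adj p q \<longleftrightarrow> p \<noteq> q \<and> \<not> path_lt p q \<and> \<not> path_lt q p"

text \<open>Nodes of one row are incomparable and belong to one block. Other nodes are incomparable
  exactly if the two fillings order them differently; within a column both fillings go downwards, in
  accordance with the weak inequality of columns in a path.\<close>

lemma pos_adj_row_filling:
  assumes D: "D \<in> diagrams lam" and pq: "p \<in> D" "q \<in> D"
  shows "pos_adj lam (diagram_perm D) (row_filling D p) (row_filling D q) \<longleftrightarrow> node_adj p q"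
proof -
  have fin: "finite D" using diagramsD(1)[OF D] .
  have eq: "row_filling D p = row_filling D q \<longleftrightarrow> p = q"
    using row_filling_bij[OF fin] pq by (auto simp: bij_betw_def inj_on_def)
  have bl: "block lam (row_filling D p) = block lam (row_filling D q) \<longleftrightarrow> fst p = fst q"
    using block_row_filling[OF D pq(1)] block_row_filling[OF D pq(2)] by auto
  have ineq: "(a = a' \<or> (a < a' \<or> a = a' \<and> b < b') \<and> (b' < b \<or> b' = b \<and> a' < a)
      \<or> (a' < a \<or> a' = a \<and> b' < b) \<and> (b < b' \<or> b = b' \<and> a < a')) \<longleftrightarrow>
      \<not> (a < a' \<and> b \<le> b') \<and> \<not> (a' < a \<and> b' \<le> b)" for a a' b b' :: nat
    by linarith
  show ?thesis
    unfolding pos_adj_def node_adj_def path_lt_def eq bl diagram_perm(2)[OF fin pq(1)]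
      diagram_perm(2)[OF fin pq(2)] row_filling_less[OF fin pq] row_filling_less[OF fin pq(2,1)]
      col_filling_less[OF fin pq] col_filling_less[OF fin pq(2,1)] ineq ..
qed

lemma is_path_iff: "is_path D p \<longleftrightarrow> set p \<subseteq> D \<and> sorted_wrt path_lt p"
proof -
  have "transp path_lt" by (rule transpI) (auto simp: path_lt_def)
  moreover have "(\<lambda>(a, b) (a', b'). a < a' \<and> b \<le> b') = path_lt"
    by (auto simp: path_lt_def fun_eq_iff)
  ultimately show ?thesis by (simp add: is_path_def successively_conv_sorted_wrt)
qed

lemma path_distinct: "sorted_wrt path_lt p \<Longrightarrow> distinct p"
  by (induction p) (auto simp: path_lt_def)

text \<open>Two nodes of a path are comparable, so a clique meets each of the \<open>k\<close> paths
  at most once.\<close>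

lemma kpath_clique_le:
  assumes ps: "is_kpath D k ps" and fin: "finite D"
  shows "\<exists>A\<subseteq>D. clique_le node_adj k A \<and> card A = kpath_length ps"
proof -
  define A where "A = (\<Union>i<k. set (ps ! i))"
  have len: "length ps = k" using ps by (simp add: is_kpath_def)
  have path: "set (ps ! i) \<subseteq> D" "sorted_wrt path_lt (ps ! i)" if "i < k" for i
    using ps that by (auto simp: is_kpath_def is_path_iff)
  have disj: "set (ps ! i) \<inter> set (ps ! j) = {}" if "i < k" "j < k" "i \<noteq> j" for i j
    using ps that by (auto simp: is_kpath_def)
  have "card A = (\<Sum>i<k. card (set (ps ! i)))"
    unfolding A_def by (rule card_UN_disjoint) (use disj in auto)
  also have "\<dots> = (\<Sum>i<k. length (ps ! i))"
    by (rule sum.cong) (use distinct_card[OF path_distinct[OF path(2)]] in auto)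
  also have "\<dots> = kpath_length ps"
    by (simp add: kpath_length_def sum_list_sum_nth len atLeast0LessThan)
  finally have "card A = kpath_length ps" .
  moreover have AD: "A \<subseteq> D" using path by (auto simp: A_def)
  moreover have "clique_le node_adj k A"
    unfolding clique_le_def
  proof (intro conjI allI impI)
    show "finite A" using AD fin finite_subset by blast
    fix C assume C: "C \<subseteq> A" "pairwise node_adj C"
    have "C = (\<Union>i<k. C \<inter> set (ps ! i))" using C(1) by (auto simp: A_def)
    then have "card C \<le> (\<Sum>i<k. card (C \<inter> set (ps ! i)))"
      by (metis card_UN_le finite_lessThan)
    also have "\<dots> \<le> (\<Sum>i<k. 1)"
    proof (rule sum_mono)
      fix i assume i: "i \<in> {..<k}"
      have "a = b" if ab: "a \<in> C \<inter> set (ps ! i)" "b \<in> C \<inter> set (ps ! i)" for a b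
      proof (rule ccontr)
        assume "a \<noteq> b"
        then have "path_lt a b \<or> path_lt b a"
          using before_total[of a "ps ! i" b] before_sorted_wrt[OF path(2)] ab i by blast
        moreover have "node_adj a b" using C(2) ab \<open>a \<noteq> b\<close> by (auto simp: pairwise_def)
        ultimately show False by (auto simp: node_adj_def)
      qed
      then show "card (C \<inter> set (ps ! i)) \<le> 1"
        using card_le_Suc0_iff_eq[of "C \<inter> set (ps ! i)"] by auto
    qed
    finally show "card C \<le> k" by simp
  qed
  ultimately show ?thesis by blast
qed

lemma path_of_set:
  assumes "finite L" "\<And>p q. p \<in> L \<Longrightarrow> q \<in> L \<Longrightarrow> p \<noteq> q \<Longrightarrow> path_lt p q \<or> path_lt q p"
  shows "\<exists>xs. set xs = L \<and> sorted_wrt path_lt xs"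
proof -
  obtain xs where xs: "set xs = L" "distinct xs" using finite_distinct_list[OF assms(1)] by blast
  let ?ys = "sort_key fst xs"
  have ys: "set ?ys = L" "distinct ?ys" "sorted (map fst ?ys)" using xs by simp_all
  have "sorted_wrt path_lt ?ys"
    unfolding sorted_wrt_iff_nth_less
  proof (intro allI impI)
    fix i j assume ij: "i < j" "j < length ?ys"
    then have "?ys ! i \<noteq> ?ys ! j" using ys(2) by (simp add: nth_eq_iff_index_eq)
    then have "path_lt (?ys ! i) (?ys ! j) \<or> path_lt (?ys ! j) (?ys ! i)"
      using assms(2) ij ys(1) by (metis less_trans nth_mem)
    moreover have "map fst ?ys ! i \<le> map fst ?ys ! j"
      by (rule sorted_nth_mono[OF ys(3)]) (use ij in auto)
    ultimately show "path_lt (?ys ! i) (?ys ! j)" using ij by (auto simp: path_lt_def)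
  qed
  then show ?thesis using ys(1) by blast
qed

text \<open>
  Cliques are linearly ordered from south-west to north-east, so the length of a longest clique of
  \<open>A\<close> ending at a given node splits \<open>A\<close> into \<open>k\<close> paths.
\<close>

lemma clique_le_kpath:
  assumes A: "A \<subseteq> D" "clique_le node_adj k A"
  shows "\<exists>ps. is_kpath D k ps \<and> kpath_length ps = card A"
proof -
  have finA: "finite A" using A(2) by (simp add: clique_le_def)
  define lt where "lt p q \<longleftrightarrow> fst q \<le> fst p \<and> snd p < snd q" for p q :: "nat \<times> nat"
  define CC where "CC p = {C. C \<subseteq> A \<and> pairwise node_adj C \<and> p \<in> C \<and> (\<forall>c\<in>C. c = p \<or> lt c p)}" for p
  define h where "h p = Max (card ` CC p)" for p
  have adj_lt: "node_adj p q \<longleftrightarrow> lt p q \<or> lt q p" for p q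
    by (cases p; cases q) (auto simp: node_adj_def lt_def path_lt_def)
  have lt_trans: "lt p q \<Longrightarrow> lt q r \<Longrightarrow> lt p r" for p q r by (auto simp: lt_def)
  have finCC: "finite (CC p)" for p
    by (rule finite_subset[of _ "Pow A"]) (use finA in \<open>auto simp: CC_def\<close>)
  have single: "{p} \<in> CC p" if "p \<in> A" for p using that by (auto simp: CC_def)
  have h_in: "h p \<in> card ` CC p" if "p \<in> A" for p
    unfolding h_def by (rule Max_in) (use finCC single[OF that] in auto)
  have h_ge: "card C \<le> h p" if "C \<in> CC p" for C p
    unfolding h_def by (rule Max_ge) (use finCC that in auto)
  have h1: "1 \<le> h p" if "p \<in> A" for p using h_ge[OF single[OF that]] by simp
  have hk: "h p \<le> k" if "p \<in> A" for p
    using h_in[OF that] clique_leD[OF A(2)] by (auto simp: CC_def)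
  have h_lt: "h p < h q" if pq: "p \<in> A" "q \<in> A" "lt p q" for p q
  proof -
    obtain C where C: "C \<in> CC p" "card C = h p" using h_in[OF pq(1)] by auto
    have cq: "lt c q" if "c \<in> C" for c using C(1) that pq(3) lt_trans[of c p q] by (auto simp: CC_def)
    from this[of q] have "q \<notin> C" by (auto simp: lt_def)
    moreover have "finite C" using C(1) finA finite_subset by (auto simp: CC_def)
    ultimately have "card (insert q C) = Suc (h p)" using C(2) by simp
    moreover have "insert q C \<in> CC q"
      using C(1) cq pq(2) by (auto simp: CC_def pairwise_insert adj_lt)
    ultimately show ?thesis using h_ge[of "insert q C" q] by simp
  qed
  \<comment> \<open>Nodes of equal height \<open>h\<close> are not adjacent and so form a path.
    Heights run from 1 to \<open>k\<close>, whereas the paths are indexed from 0.\<close>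
  define L where "L i = {p \<in> A. h p = Suc i}" for i
  have "\<exists>xs. set xs = L i \<and> sorted_wrt path_lt xs" for i
  proof (rule path_of_set)
    show "finite (L i)" using finA by (simp add: L_def)
    show "path_lt p q \<or> path_lt q p" if "p \<in> L i" "q \<in> L i" "p \<noteq> q" for p q
      using that h_lt[of p q] h_lt[of q p] adj_lt[of p q] by (auto simp: L_def node_adj_def)
  qed
  then obtain f where f: "\<And>i. set (f i) = L i" "\<And>i. sorted_wrt path_lt (f i)" by metis
  let ?ps = "map f [0..<k]"
  have "is_kpath D k ?ps"
    using A(1) by (auto simp: is_kpath_def is_path_iff f) (auto simp: L_def)
  moreover have "kpath_length ?ps = card A"
  proof -
    have "A = (\<Union>i<k. L i)"
    proof (intro Set.set_eqI iffI)
      fix p assume p: "p \<in> A"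
      then obtain i where "h p = Suc i" using h1[OF p] by (cases "h p") auto
      then show "p \<in> (\<Union>i<k. L i)" using p hk[OF p] by (auto simp: L_def)
    qed (auto simp: L_def)
    moreover have "card (\<Union>i<k. L i) = (\<Sum>i<k. card (L i))"
      by (rule card_UN_disjoint) (use finA in \<open>auto simp: L_def\<close>)
    ultimately have "card A = (\<Sum>i<k. card (L i))" by simp
    also have "\<dots> = (\<Sum>i<k. length (f i))"
      by (rule sum.cong) (use f path_distinct distinct_card in metis)+
    also have "\<dots> = kpath_length ?ps"
      by (simp add: kpath_length_def sum_list_sum_nth atLeast0LessThan)
    finally show ?thesis by simp
  qed
  ultimately show ?thesis by blast
qed

text \<open>Each block is a clique, so the bound holds block by block, and equality of the totals
  forces equality in every block. This is how an optimal set is known to meet the last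
  block.\<close>

lemma pos_clique_le_blocks:
  assumes A: "A \<subseteq> {1..sum_list lam}" "clique_le (pos_adj lam d) k A"
  shows "b < length lam \<Longrightarrow> card {i \<in> A. block lam i = b} \<le> min k (lam ! b)"
    and "card A = (\<Sum>b<length lam. card {i \<in> A. block lam i = b})"
    and "card A \<le> min_sum k lam"
    and "card A = min_sum k lam \<Longrightarrow> b < length lam \<Longrightarrow> card {i \<in> A. block lam i = b} = min k (lam ! b)"
proof -
  have fin: "finite A" using A(2) by (simp add: clique_le_def)
  have le: "card {i \<in> A. block lam i = b} \<le> min k (lam ! b)" if "b < length lam" for b
  proof -
    have "card {i \<in> A. block lam i = b} \<le> k"
      by (rule clique_leD[OF A(2)]) (auto simp: pairwise_def pos_adj_def)
    moreover have "card {i \<in> A. block lam i = b} \<le> card {i \<in> {1..sum_list lam}. block lam i = b}"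
      by (rule card_mono) (use A(1) in auto)
    ultimately show ?thesis using card_block[OF that] by simp
  qed
  have "A = (\<Union>b<length lam. {i \<in> A. block lam i = b})"
    using A(1) block_less_length by force
  then have "card A = card (\<Union>b<length lam. {i \<in> A. block lam i = b})" by simp
  also have "\<dots> = (\<Sum>b<length lam. card {i \<in> A. block lam i = b})"
    by (rule card_UN_disjoint) (use fin in auto)
  finally show sum: "card A = (\<Sum>b<length lam. card {i \<in> A. block lam i = b})" .
  show "card A \<le> min_sum k lam"
    unfolding sum min_sum_eq by (rule sum_mono) (use le in auto)
  show "b < length lam \<Longrightarrow> card {i \<in> A. block lam i = b} \<le> min k (lam ! b)" using le .
  show "card {i \<in> A. block lam i = b} = min k (lam ! b)" if "card A = min_sum k lam" "b < length lam"
    by (rule sum_mono_inv[where I = "{..<length lam}"])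
       (use that le in \<open>auto simp: min_sum_eq sum[symmetric]\<close>)
qed

lemma node_clique_le_iff:
  assumes D: "D \<in> diagrams lam"
  shows "(\<exists>A\<subseteq>D. clique_le node_adj k A \<and> card A = m) \<longleftrightarrow>
    (\<exists>A\<subseteq>{1..sum_list lam}. clique_le (pos_adj lam (diagram_perm D)) k A \<and> card A = m)"
proof
  have fin: "finite D" using diagramsD(1)[OF D] .
  have bij: "bij_betw (row_filling D) D {1..sum_list lam}"
    using row_filling_bij[OF fin] diagram_card[OF D] by simp
  let ?g = "inv_into D (row_filling D)"
  {
    assume "\<exists>A\<subseteq>D. clique_le node_adj k A \<and> card A = m"
    then obtain A where A: "A \<subseteq> D" "clique_le node_adj k A" "card A = m" by blast
    have inj: "inj_on (row_filling D) A" using bij A(1) by (meson bij_betw_def inj_on_subset)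
    have "clique_le (pos_adj lam (diagram_perm D)) k (row_filling D ` A)"
      by (rule clique_le_image[OF A(2) inj]) (use A(1) pos_adj_row_filling[OF D] in blast)
    moreover have "row_filling D ` A \<subseteq> {1..sum_list lam}" using bij A(1) by (auto simp: bij_betw_def)
    ultimately show "\<exists>A\<subseteq>{1..sum_list lam}. clique_le (pos_adj lam (diagram_perm D)) k A \<and> card A = m"
      using A(3) card_image[OF inj] by blast
  }
  {
    assume "\<exists>A\<subseteq>{1..sum_list lam}. clique_le (pos_adj lam (diagram_perm D)) k A \<and> card A = m"
    then obtain A where A: "A \<subseteq> {1..sum_list lam}" "clique_le (pos_adj lam (diagram_perm D)) k A" "card A = m"
      by blast
    have g: "?g i \<in> D" "row_filling D (?g i) = i" if "i \<in> A" for i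
      using that A(1) bij by (auto simp: bij_betw_def inv_into_into f_inv_into_f)
    have inj: "inj_on ?g A" by (rule inj_onI) (metis g(2))
    have "clique_le node_adj k (?g ` A)"
    proof (rule clique_le_image[OF A(2) inj])
      fix a b assume ab: "a \<in> A" "b \<in> A" "node_adj (?g a) (?g b)"
      then show "pos_adj lam (diagram_perm D) a b"
        using pos_adj_row_filling[OF D g(1)[OF ab(1)] g(1)[OF ab(2)]] g(2) by simp
    qed
    moreover have "?g ` A \<subseteq> D" using g by blast
    ultimately show "\<exists>A\<subseteq>D. clique_le node_adj k A \<and> card A = m"
      using A(3) card_image[OF inj] by blast
  }
qed

lemma max_kpath_length_iff:
  assumes D: "D \<in> diagrams lam"
  shows "max_kpath_length D k = min_sum k lam \<longleftrightarrow>
    (\<exists>A\<subseteq>{1..sum_list lam}. clique_le (pos_adj lam (diagram_perm D)) k A \<and> card A = min_sum k lam)"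
proof -
  have fin: "finite D" using diagramsD(1)[OF D] .
  let ?S = "{kpath_length ps | ps. is_kpath D k ps}"
  have S: "m \<in> ?S \<longleftrightarrow>
      (\<exists>A\<subseteq>{1..sum_list lam}. clique_le (pos_adj lam (diagram_perm D)) k A \<and> card A = m)" for m
  proof -
    have "m \<in> ?S \<longleftrightarrow> (\<exists>A\<subseteq>D. clique_le node_adj k A \<and> card A = m)"
    proof
      assume "m \<in> ?S"
      then obtain ps where "is_kpath D k ps" "m = kpath_length ps" by blast
      then show "\<exists>A\<subseteq>D. clique_le node_adj k A \<and> card A = m" using kpath_clique_le[OF _ fin] by blast
    next
      assume "\<exists>A\<subseteq>D. clique_le node_adj k A \<and> card A = m"
      then obtain A where A: "A \<subseteq> D" "clique_le node_adj k A" "card A = m" by blast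
      from clique_le_kpath[OF A(1,2)] obtain ps where "is_kpath D k ps" "kpath_length ps = m"
        using A(3) by blast
      then show "m \<in> ?S" by blast
    qed
    then show ?thesis using node_clique_le_iff[OF D] by simp
  qed
  have le: "m \<le> min_sum k lam" if "m \<in> ?S" for m
    using that pos_clique_le_blocks(3) unfolding S by blast
  have finS: "finite ?S" by (rule finite_subset[of _ "{..min_sum k lam}"]) (use le in blast, simp)
  have "clique_le (pos_adj lam (diagram_perm D)) k {}" by (simp add: clique_le_def)
  then have "0 \<in> ?S" unfolding S by (intro exI[of _ "{}"]) simp
  then have ne: "?S \<noteq> {}" by blast
  have "Max ?S = min_sum k lam \<longleftrightarrow> min_sum k lam \<in> ?S"
  proof
    assume "Max ?S = min_sum k lam"
    then show "min_sum k lam \<in> ?S" using Max_in[OF finS ne] by simp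
  next
    assume "min_sum k lam \<in> ?S"
    then show "Max ?S = min_sum k lam" by (intro Max_eqI[OF finS]) (use le in auto)
  qed
  then show ?thesis unfolding max_kpath_length_def using S[of "min_sum k lam"] by simp
qed

text \<open>Both sides count the cells in the first \<open>k\<close> columns of the left-justified
  array with rows \<open>lam\<close>, once by columns and once by rows.\<close>

lemma sum_list_take_conj_partition:
  assumes "k \<le> length (conj_partition lam)"
  shows "sum_list (take k (conj_partition lam)) = min_sum k lam"
proof -
  have "sum_list (take k (conj_partition lam)) =
      (\<Sum>i<k. card {j. j < length lam \<and> Suc i \<le> lam ! j})"
    using assms by (simp add: sum_list_sum_nth conj_partition_def atLeast0LessThan del: upt_Suc)
  also have "\<dots> = (\<Sum>i<k. \<Sum>j<length lam. if Suc i \<le> lam ! j then 1 else 0)"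
  proof (rule sum.cong[OF refl])
    fix i
    have "{j. j < length lam \<and> Suc i \<le> lam ! j} = {j \<in> {..<length lam}. Suc i \<le> lam ! j}" by auto
    then show "card {j. j < length lam \<and> Suc i \<le> lam ! j} =
        (\<Sum>j<length lam. if Suc i \<le> lam ! j then 1 else 0)"
      by (simp only: sum.inter_filter[symmetric] finite_lessThan card_eq_sum)
  qed
  also have "\<dots> = (\<Sum>j<length lam. \<Sum>i<k. if Suc i \<le> lam ! j then 1 else 0)" by (rule sum.swap)
  also have "\<dots> = (\<Sum>j<length lam. min k (lam ! j))"
  proof (rule sum.cong[OF refl])
    fix j
    have "{i \<in> {..<k}. Suc i \<le> lam ! j} = {..<min k (lam ! j)}" by auto
    then show "(\<Sum>i<k. if Suc i \<le> lam ! j then 1 else 0) = min k (lam ! j)"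
      by (simp add: sum.inter_filter[symmetric])
  qed
  finally show ?thesis by (simp add: min_sum_eq)
qed

lemma min_sum_Max:
  assumes "Max (insert 0 (set lam)) \<le> k"
  shows "min_sum k lam = sum_list lam"
proof -
  have le: "l \<le> k" if "l \<in> set lam" for l
    using that assms by (meson List.finite_set Max_ge finite_insert insertCI le_trans)
  then have "map (min k) lam = lam" by (intro map_idI) (simp add: min_absorb2 le)
  then show ?thesis by (simp add: min_sum_def)
qed

lemma conj_partition_partition: "partition_of (sum_list lam) (conj_partition lam)"
proof -
  let ?M = "Max (insert 0 (set lam))"
  have len: "length (conj_partition lam) = ?M" by (simp add: conj_partition_def)
  have pos: "0 < card {j. j < length lam \<and> i \<le> lam ! j}" if "1 \<le> i" "i \<le> ?M" for i
  proof -
    have "?M \<in> insert 0 (set lam)" by (rule Max_in) auto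
    then have "?M \<in> set lam" using that by auto
    then obtain j where "j < length lam" "lam ! j = ?M" by (auto simp: in_set_conv_nth)
    then have "j \<in> {j. j < length lam \<and> i \<le> lam ! j}" using that(2) by simp
    then show ?thesis by (auto simp: card_gt_0_iff)
  qed
  have "\<forall>a\<in>set (conj_partition lam). 0 < a"
    using pos by (auto simp: conj_partition_def simp del: upt_Suc)
  moreover have "sum_list (conj_partition lam) = sum_list lam"
    using sum_list_take_conj_partition[of ?M lam] min_sum_Max[of lam ?M] len by simp
  moreover have "sorted_wrt (\<ge>) (conj_partition lam)"
    unfolding conj_partition_def sorted_wrt_map
  proof (rule sorted_wrt_mono_rel[OF _ sorted_wrt_upt])
    fix i i' :: nat assume "i < i'"
    then show "card {j. j < length lam \<and> i \<le> lam ! j} \<ge> card {j. j < length lam \<and> i' \<le> lam ! j}"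
      by (intro card_mono) auto
  qed
  ultimately show ?thesis by (simp add: partition_of_def composition_of_def)
qed

text \<open>Admissibility tests only \<open>k\<close> from 1 to the largest part. The empty set
  settles \<open>k = 0\<close>, and for larger \<open>k\<close> the set for the largest part, which
  already has \<open>sum_list lam\<close> elements, remains a witness.\<close>

lemma admissible_iff_full:
  assumes D: "D \<in> diagrams lam"
  shows "admissible D \<longleftrightarrow> full lam (diagram_perm D)"
proof -
  let ?M = "Max (insert 0 (set lam))"
  let ?P = "\<lambda>k. \<exists>A\<subseteq>{1..sum_list lam}. clique_le (pos_adj lam (diagram_perm D)) k A \<and> card A = min_sum k lam"
  have rc: "row_comp D = lam" using D by (simp add: diagrams_def)
  have len: "length (conj_partition lam) = ?M" by (simp add: conj_partition_def)
  have "admissible D \<longleftrightarrow> (\<forall>k\<in>{1..?M}. max_kpath_length D k = min_sum k lam)"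
    unfolding admissible_def subsequence_type_def rc len diagram_card[OF D]
    using conj_partition_partition sum_list_take_conj_partition[of _ lam] len by auto
  also have "\<dots> \<longleftrightarrow> (\<forall>k\<in>{1..?M}. ?P k)" by (simp only: max_kpath_length_iff[OF D])
  also have "\<dots> \<longleftrightarrow> (\<forall>k. ?P k)"
  proof
    assume P: "\<forall>k\<in>{1..?M}. ?P k"
    have P0: "?P 0" by (intro exI[of _ "{}"]) (simp add: clique_le_def min_sum_def)
    have PM: "?P ?M" using P P0 by (cases "?M = 0") auto
    show "\<forall>k. ?P k"
    proof
      fix k
      consider "k = 0" | "k \<in> {1..?M}" | "?M \<le> k" by fastforce
      then show "?P k"
      proof cases
        case 3
        obtain A where A: "A \<subseteq> {1..sum_list lam}" "clique_le (pos_adj lam (diagram_perm D)) ?M A"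
            "card A = min_sum ?M lam"
          using PM by blast
        then have "clique_le (pos_adj lam (diagram_perm D)) k A"
          using 3 unfolding clique_le_def by (meson le_trans)
        then show ?thesis using A min_sum_Max[OF 3] min_sum_Max[OF order_refl, of lam] by auto
      qed (use P P0 in blast)+
    qed
  qed blast
  finally show ?thesis by (simp only: full_def)
qed

section \<open>The diagram with fewest columns\<close>

lemma card_enumerated:
  fixes f :: "nat \<Rightarrow> 'a" and le :: "'a \<Rightarrow> 'a \<Rightarrow> bool"
  assumes f: "\<And>i j. i \<in> {1..n} \<Longrightarrow> j \<in> {1..n} \<Longrightarrow> le (f i) (f j) \<longleftrightarrow> i \<le> j"
    and inj: "inj_on f {1..n}" and t: "t \<in> {1..n}"
  shows "card {q \<in> f ` {1..n}. le q (f t)} = t"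
proof -
  have "{q \<in> f ` {1..n}. le q (f t)} = f ` {1..t}" using f t by auto
  moreover have "inj_on f {1..t}" by (rule inj_on_subset[OF inj]) (use t in auto)
  ultimately show ?thesis by (simp add: card_image)
qed

text \<open>In a diagram with row-composition \<open>lam\<close> and permutation \<open>d\<close>,
  the node with column filling \<open>t\<close> has row filling \<open>inv' d t\<close>, so its row
  is forced; only the columns are free.\<close>

definition row_of :: "nat list \<Rightarrow> (nat \<Rightarrow> nat) \<Rightarrow> nat \<Rightarrow> nat"
  where "row_of lam d t = Suc (block lam (inv' d t))"

text \<open>
  The column of the value \<open>t\<close> in the diagram with fewest columns: a new column starts only where
  it has to.
\<close>

definition min_col :: "nat list \<Rightarrow> (nat \<Rightarrow> nat) \<Rightarrow> nat \<Rightarrow> nat"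
  where "min_col lam d t = Suc (card {s \<in> {1..<t}. row_of lam d (Suc s) \<le> row_of lam d s})"

definition min_node :: "nat list \<Rightarrow> (nat \<Rightarrow> nat) \<Rightarrow> nat \<Rightarrow> nat \<times> nat"
  where "min_node lam d t = (row_of lam d t, min_col lam d t)"

lemma min_col_1: "min_col lam d 1 = 1"
  by (simp add: min_col_def)

lemma min_col_Suc:
  assumes "1 \<le> t"
  shows "min_col lam d (Suc t) = min_col lam d t + (if row_of lam d (Suc t) \<le> row_of lam d t then 1 else 0)"
proof -
  have "{s \<in> {1..<Suc t}. row_of lam d (Suc s) \<le> row_of lam d s} =
      (if row_of lam d (Suc t) \<le> row_of lam d t
       then insert t {s \<in> {1..<t}. row_of lam d (Suc s) \<le> row_of lam d s}
       else {s \<in> {1..<t}. row_of lam d (Suc s) \<le> row_of lam d s})"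
    using assms by (auto simp: less_Suc_eq)
  then show ?thesis by (simp add: min_col_def)
qed

lemma min_node_less:
  assumes "1 \<le> s" "s < t"
  shows "min_col lam d s < min_col lam d t \<or>
    (min_col lam d s = min_col lam d t \<and> row_of lam d s < row_of lam d t)"
  using assms(2)
proof (induction t)
  case (Suc t)
  have step: "min_col lam d t < min_col lam d (Suc t) \<or>
      (min_col lam d t = min_col lam d (Suc t) \<and> row_of lam d t < row_of lam d (Suc t))"
    using min_col_Suc[of t lam d] assms(1) Suc.prems by auto
  show ?case
  proof (cases "s = t")
    case False
    then show ?thesis using Suc step by linarith
  qed (use step in simp)
qed simp

lemma min_col_image:
  assumes "1 \<le> n"
  shows "min_col lam d ` {1..n} = {1..min_col lam d n}"
  using assms
proof (induction n rule: dec_induct)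
  case base
  show ?case using min_col_1[of lam d] by simp
next
  case (step n)
  have "{1..Suc n} = insert (Suc n) {1..n}" using step(1) by auto
  then have "min_col lam d ` {1..Suc n} = insert (min_col lam d (Suc n)) {1..min_col lam d n}"
    using step by simp
  also have "\<dots> = {1..min_col lam d (Suc n)}"
    using min_col_Suc[OF step(1), of lam d] by (auto simp: min_col_def)
  finally show ?case .
qed

context
  fixes lam :: "nat list" and d :: "nat \<Rightarrow> nat"
  assumes pos: "\<And>a. a \<in> set lam \<Longrightarrow> 0 < a" and n1: "1 \<le> sum_list lam"
    and d: "block_increasing lam d"
begin

lemma d_permutes: "d permutes {1..sum_list lam}"
  using d by (simp add: block_increasing_def)

lemma d_row_of: "row_of lam d (d i) = Suc (block lam i)"
  by (simp add: row_of_def permutes_inverses(2)[OF d_permutes])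

lemma min_node_inj: "inj_on (min_node lam d) {1..sum_list lam}"
proof (rule inj_onI)
  fix s t assume st: "s \<in> {1..sum_list lam}" "t \<in> {1..sum_list lam}" "min_node lam d s = min_node lam d t"
  then show "s = t"
    using min_node_less[of s t lam d] min_node_less[of t s lam d]
    by (cases s t rule: linorder_cases) (auto simp: min_node_def)
qed

definition "min_dia = min_node lam d ` {1..sum_list lam}"

text \<open>Listing the nodes by values gives the order of the column filling, listing them by
  positions that of the row filling.\<close>

lemma min_dia_eq: "min_dia = (min_node lam d \<circ> d) ` {1..sum_list lam}"
  unfolding min_dia_def image_comp[symmetric] permutes_image[OF d_permutes] ..

lemma min_dia_rows: "fst ` min_dia = {1..length lam}"
proof -
  have "fst ` min_dia = Suc ` block lam ` {1..sum_list lam}"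
    by (simp add: min_dia_eq image_image min_node_def d_row_of)
  also have "block lam ` {1..sum_list lam} = {..<length lam}"
  proof (intro Set.set_eqI iffI)
    fix b assume b: "b \<in> {..<length lam}"
    then have "card {i \<in> {1..sum_list lam}. block lam i = b} \<noteq> 0" using card_block[of b lam] pos by simp
    then have "{i \<in> {1..sum_list lam}. block lam i = b} \<noteq> {}" by (metis card.empty)
    then show "b \<in> block lam ` {1..sum_list lam}" by blast
  qed (use block_less_length in auto)
  also have "Suc ` {..<length lam} = {1..length lam}" by (simp add: image_Suc_lessThan)
  finally show ?thesis .
qed

lemma min_dia_cols: "snd ` min_dia = {1..min_col lam d (sum_list lam)}"
proof -
  have "snd ` min_dia = min_col lam d ` {1..sum_list lam}"
    by (simp add: min_dia_def image_image min_node_def)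
  then show ?thesis using min_col_image[OF n1] by simp
qed

lemma min_dia_num: "num_rows min_dia = length lam" "num_cols min_dia = min_col lam d (sum_list lam)"
  by (simp_all add: num_rows_def num_cols_def min_dia_rows min_dia_cols)

lemma min_node_d_less:
  assumes "1 \<le> i" "i < j" "j \<le> sum_list lam"
  shows "block lam i < block lam j \<or>
    (block lam i = block lam j \<and> min_col lam d (d i) < min_col lam d (d j))"
proof (cases "block lam i = block lam j")
  case True
  then have "d i < d j" using d assms by (simp add: block_increasing_def)
  moreover have "1 \<le> d i" using permutes_in_image[OF d_permutes, of i] assms by simp
  ultimately show ?thesis using min_node_less[of "d i" "d j" lam d] True by (simp add: d_row_of)
next
  case False
  then show ?thesis using block_mono[of i j lam] assms by simp
qed

lemma min_dia_in_diagrams: "min_dia \<in> diagrams lam"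
proof -
  have "principal_diagram min_dia"
    unfolding principal_diagram_def min_dia_rows min_dia_cols min_dia_num by (simp add: min_dia_def)
  moreover have "row_comp min_dia = lam"
  proof (rule nth_equalityI)
    show "length (row_comp min_dia) = length lam"
      by (simp add: row_comp_def min_dia_num del: upt_Suc)
    fix a assume "a < length (row_comp min_dia)"
    then have a: "a < length lam" by (simp add: row_comp_def min_dia_num del: upt_Suc)
    have eq: "{b. (Suc a, b) \<in> min_dia} = (min_col lam d \<circ> d) ` {i \<in> {1..sum_list lam}. block lam i = a}"
      unfolding min_dia_eq by (auto simp: min_node_def d_row_of)
    have inj: "inj_on (min_col lam d \<circ> d) {i \<in> {1..sum_list lam}. block lam i = a}"
    proof (rule inj_onI)
      fix i j assume ij: "i \<in> {i \<in> {1..sum_list lam}. block lam i = a}"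
        "j \<in> {i \<in> {1..sum_list lam}. block lam i = a}" "(min_col lam d \<circ> d) i = (min_col lam d \<circ> d) j"
      then show "i = j"
        using min_node_d_less[of i j] min_node_d_less[of j i] by (cases i j rule: linorder_cases) auto
    qed
    have "card {b. (Suc a, b) \<in> min_dia} = lam ! a"
      unfolding eq card_image[OF inj] by (rule card_block[OF a])
    then show "row_comp min_dia ! a = lam ! a"
      using a by (simp add: row_comp_def min_dia_num del: upt_Suc)
  qed
  ultimately show ?thesis by (simp add: diagrams_def)
qed

lemma min_dia_perm: "diagram_perm min_dia = d"
proof (rule diagram_perm_unique)
  show fin: "finite min_dia" by (simp add: min_dia_def)
  show "d permutes {1..card min_dia}"
    using d_permutes diagram_card[OF min_dia_in_diagrams] by simp
  fix p assume "p \<in> min_dia"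
  then obtain i where i: "i \<in> {1..sum_list lam}" "p = min_node lam d (d i)" by (auto simp: min_dia_eq)
  have di: "d i \<in> {1..sum_list lam}" using permutes_in_image[OF d_permutes] i(1) by blast
  let ?rle = "\<lambda>q p :: nat \<times> nat. fst q < fst p \<or> (fst q = fst p \<and> snd q \<le> snd p)"
  let ?cle = "\<lambda>q p :: nat \<times> nat. snd q < snd p \<or> (snd q = snd p \<and> fst q \<le> fst p)"
  have "card {q \<in> (min_node lam d \<circ> d) ` {1..sum_list lam}. ?rle q ((min_node lam d \<circ> d) i)} = i"
  proof (rule card_enumerated[OF _ _ i(1)])
    fix i j assume "i \<in> {1..sum_list lam}" "j \<in> {1..sum_list lam}"
    then show "?rle ((min_node lam d \<circ> d) i) ((min_node lam d \<circ> d) j) \<longleftrightarrow> i \<le> j"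
      using min_node_d_less[of i j] min_node_d_less[of j i]
      by (cases i j rule: linorder_cases) (auto simp: min_node_def d_row_of)
  next
    show "inj_on (min_node lam d \<circ> d) {1..sum_list lam}"
      by (rule comp_inj_on[OF permutes_inj_on[OF d_permutes]])
         (simp only: permutes_image[OF d_permutes] min_node_inj)
  qed
  then have r: "row_filling min_dia p = i" by (simp add: row_filling_def min_dia_eq i(2))
  have "card {q \<in> min_node lam d ` {1..sum_list lam}. ?cle q (min_node lam d (d i))} = d i"
  proof (rule card_enumerated[OF _ min_node_inj di])
    fix s t assume "s \<in> {1..sum_list lam}" "t \<in> {1..sum_list lam}"
    then show "?cle (min_node lam d s) (min_node lam d t) \<longleftrightarrow> s \<le> t"
      using min_node_less[of s t lam d] min_node_less[of t s lam d]
      by (cases s t rule: linorder_cases) (auto simp: min_node_def)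
  qed
  then have "col_filling min_dia p = d i" by (simp add: col_filling_def min_dia_def i(2))
  then show "d (row_filling min_dia p) = col_filling min_dia p" using r by simp
qed

text \<open>Let \<open>N t\<close> be the node of \<open>D\<close> with column filling
  \<open>t\<close>. The excess of its column over \<open>min_col lam d t\<close> cannot drop as
  \<open>t\<close> grows, because \<open>D\<close> has to advance wherever \<open>min_col\<close>
  does. It is nonnegative at the start; if the numbers of columns agree, it is 0 at the end and
  hence throughout.\<close>

lemma diagram_cols_ge:
  assumes D: "D \<in> diagrams lam" and perm: "diagram_perm D = d"
  shows "num_cols min_dia \<le> num_cols D"
    and "num_cols D = num_cols min_dia \<Longrightarrow> D = min_dia"
proof -
  let ?n = "sum_list lam"
  have fin: "finite D" using diagramsD(1)[OF D] .
  have bij: "bij_betw (col_filling D) D {1..?n}"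
    using col_filling_bij[OF fin] diagram_card[OF D] by simp
  define N where "N = inv_into D (col_filling D)"
  have N: "N t \<in> D" "col_filling D (N t) = t" if "t \<in> {1..?n}" for t
    using that bij by (auto simp: N_def bij_betw_def inv_into_into f_inv_into_f)
  have D_eq: "D = N ` {1..?n}"
    using bij_betw_inv_into[OF bij] by (simp add: N_def bij_betw_def)
  have row: "fst (N t) = row_of lam d t" if "t \<in> {1..?n}" for t
  proof -
    have "d (row_filling D (N t)) = t" using diagram_perm(2)[OF fin N(1)[OF that]] N(2)[OF that] perm by simp
    then have "inv' d t = row_filling D (N t)" using permutes_inverses(2)[OF d_permutes] by metis
    then show ?thesis using block_row_filling[OF D N(1)[OF that]] by (simp add: row_of_def)
  qed
  \<comment> \<open>Stated additively to avoid truncated subtraction of columns.\<close>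
  have stepN: "snd (N t) + min_col lam d (Suc t) \<le> snd (N (Suc t)) + min_col lam d t"
    if t: "1 \<le> t" "Suc t \<le> ?n" for t
  proof -
    have t': "t \<in> {1..?n}" "Suc t \<in> {1..?n}" using t by auto
    have "col_filling D (N t) < col_filling D (N (Suc t))" using N(2) t' by simp
    then have "snd (N t) < snd (N (Suc t)) \<or> (snd (N t) = snd (N (Suc t)) \<and> row_of lam d t < row_of lam d (Suc t))"
      using col_filling_less[OF fin N(1)[OF t'(1)] N(1)[OF t'(2)]] row t' by simp
    then show ?thesis using min_col_Suc[OF t(1), of lam d] by auto
  qed
  have mono: "snd (N s) + min_col lam d t \<le> snd (N t) + min_col lam d s"
    if "1 \<le> s" "s \<le> t" "t \<le> ?n" for s t
    using that(2,3)
  proof (induction t rule: dec_induct)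
    case (step t)
    then show ?case using stepN[of t] that(1) by simp
  qed simp
  have sndN: "snd (N t) \<in> {1..num_cols D}" if "t \<in> {1..?n}" for t
    using diagramsD(4)[OF D] N(1)[OF that] by blast
  have n_in: "1 \<in> {1..?n}" "?n \<in> {1..?n}" using n1 by auto
  have ge: "min_col lam d t \<le> snd (N t)" if "t \<in> {1..?n}" for t
    using mono[of 1 t] that sndN[OF n_in(1)] min_col_1[of lam d] by simp
  show "num_cols min_dia \<le> num_cols D"
    using ge[OF n_in(2)] sndN[OF n_in(2)] min_dia_num by simp
  assume eq: "num_cols D = num_cols min_dia"
  have "snd (N ?n) = min_col lam d ?n"
    using ge[OF n_in(2)] sndN[OF n_in(2)] min_dia_num eq by simp
  then have "snd (N t) = min_col lam d t" if "t \<in> {1..?n}" for t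
    using mono[of t ?n] ge[OF that] that by simp
  then have "N t = min_node lam d t" if "t \<in> {1..?n}" for t
    using row that by (simp add: min_node_def prod_eq_iff)
  then show "D = min_dia" unfolding D_eq min_dia_def by (rule image_cong[OF refl])
qed

lemma ex1_min_diagram: "\<exists>!D. is_min_diagram d lam D"
proof (rule ex1I[of _ min_dia])
  show "is_min_diagram d lam min_dia"
    unfolding is_min_diagram_def using min_dia_in_diagrams min_dia_perm diagram_cols_ge(1) by blast
  fix D assume "is_min_diagram d lam D"
  then have D: "D \<in> diagrams lam" "diagram_perm D = d" "num_cols D \<le> num_cols min_dia"
    using min_dia_in_diagrams min_dia_perm by (auto simp: is_min_diagram_def)
  then show "D = min_dia" using diagram_cols_ge[OF D(1,2)] by simp
qed

end

section \<open>Extension by one node\<close>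

text \<open>The new node is the lowest in column \<open>j\<close>. In the column filling it follows
  all nodes of the columns up to \<open>j\<close> and pushes the later ones up by one, which is what
  \<open>last_to\<close> does.\<close>

lemma ext_diagram:
  assumes D: "D \<in> diagrams lam" and j: "j \<in> {1..num_cols D}"
  shows "ext_diagram D j \<in> diagrams (lam @ [1])"
    and "diagram_perm (ext_diagram D j) =
      diagram_perm D \<cdot> last_to (sum_list lam) (Suc (card {q \<in> D. snd q \<le> j}))"
proof -
  let ?E = "ext_diagram D j" and ?n = "sum_list lam" and ?r = "length lam"
  let ?new = "(Suc ?r, j)" and ?m = "card {q \<in> D. snd q \<le> j}"
  have fin: "finite D" and rows: "num_rows D = ?r" "fst ` D = {1..?r}"
    and cols: "snd ` D = {1..num_cols D}" and row_card: "\<And>a. a < ?r \<Longrightarrow> card {b. (Suc a, b) \<in> D} = lam ! a"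
    using diagramsD[OF D] by auto
  have E: "?E = insert ?new D" by (simp add: ext_diagram_def rows)
  have fst_le: "1 \<le> fst p \<and> fst p \<le> ?r" if "p \<in> D" for p using rows(2) that by (metis atLeastAtMost_iff imageI)
  have new: "?new \<notin> D" using fst_le[of ?new] by auto
  have fst_E: "fst ` ?E = {1..Suc ?r}" unfolding E by (auto simp: rows(2))
  have snd_E: "snd ` ?E = {1..num_cols D}" unfolding E using j by (auto simp: cols)
  have num: "num_rows ?E = Suc ?r" "num_cols ?E = num_cols D"
    by (simp_all add: num_rows_def num_cols_def fst_E snd_E)
  have finE: "finite ?E" using fin by (simp add: E)
  have "principal_diagram ?E"
    unfolding principal_diagram_def num fst_E snd_E using finE by simp
  moreover have "row_comp ?E = lam @ [1]"
  proof (rule nth_equalityI)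
    show "length (row_comp ?E) = length (lam @ [1])" by (simp add: row_comp_def num del: upt_Suc)
    fix a assume "a < length (row_comp ?E)"
    then have a: "a < Suc ?r" by (simp add: row_comp_def num del: upt_Suc)
    have "{b. (Suc a, b) \<in> ?E} = (if a < ?r then {b. (Suc a, b) \<in> D} else {j})"
    proof -
      have "(Suc a, b) \<notin> D" if "\<not> a < ?r" for b using fst_le[of "(Suc a, b)"] that by auto
      then show ?thesis using a by (auto simp: E)
    qed
    moreover have "row_comp ?E ! a = card {b. (Suc a, b) \<in> ?E}"
      using a by (simp add: row_comp_def num del: upt_Suc)
    ultimately show "row_comp ?E ! a = (lam @ [1]) ! a"
      using a row_card[of a] by (cases "a < ?r") (simp_all add: nth_append less_Suc_eq)
  qed
  ultimately show ED: "?E \<in> diagrams (lam @ [1])" by (simp add: diagrams_def)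
  have cD: "card D = ?n" using diagram_card[OF D] .
  have cE: "card ?E = Suc ?n" using new fin cD by (simp add: E)
  have m_le: "?m \<le> ?n" unfolding cD[symmetric] by (rule card_mono) (use fin in auto)
  show "diagram_perm ?E = diagram_perm D \<cdot> last_to ?n (Suc ?m)"
  proof (rule diagram_perm_unique[OF finE])
    have "diagram_perm D permutes {1..?n}" using diagram_perm(1)[OF fin] cD by simp
    then show "diagram_perm D \<cdot> last_to ?n (Suc ?m) permutes {1..card ?E}"
      unfolding cE using compose_last_to_permutes m_le by simp
    fix p assume "p \<in> ?E"
    then consider "p \<in> D" | "p = ?new" unfolding E by blast
    then show "(diagram_perm D \<cdot> last_to ?n (Suc ?m)) (row_filling ?E p) = col_filling ?E p"
    proof cases
      case 1
      have "{q \<in> ?E. fst q < fst p \<or> (fst q = fst p \<and> snd q \<le> snd p)} =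
          {q \<in> D. fst q < fst p \<or> (fst q = fst p \<and> snd q \<le> snd p)}"
        using fst_le[OF 1] unfolding E by auto
      then have rf: "row_filling ?E p = row_filling D p" by (simp add: row_filling_def)
      have "{q \<in> ?E. snd q < snd p \<or> (snd q = snd p \<and> fst q \<le> fst p)} =
          (if j < snd p then insert ?new {q \<in> D. snd q < snd p \<or> (snd q = snd p \<and> fst q \<le> fst p)}
           else {q \<in> D. snd q < snd p \<or> (snd q = snd p \<and> fst q \<le> fst p)})"
        using fst_le[OF 1] unfolding E by auto
      then have cf: "col_filling ?E p = (if j < snd p then Suc (col_filling D p) else col_filling D p)"
        using fin new by (simp add: col_filling_def)
      have "?m < col_filling D p \<longleftrightarrow> j < snd p"
      proof (cases "j < snd p")
        case True
        have "{q \<in> D. snd q \<le> j} \<subset> {q \<in> D. snd q < snd p \<or> (snd q = snd p \<and> fst q \<le> fst p)}"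
          (is "?L \<subset> ?R")
        proof (rule psubsetI)
          show "?L \<subseteq> ?R" using True by auto
          have "p \<in> ?R" "p \<notin> ?L" using 1 True by auto
          then show "?L \<noteq> ?R" by blast
        qed
        then show ?thesis unfolding col_filling_def using fin True by (simp add: psubset_card_mono)
      next
        case False
        have "col_filling D p \<le> ?m" unfolding col_filling_def by (rule card_mono) (use fin False in auto)
        then show ?thesis using False by simp
      qed
      moreover have "col_filling D p \<le> ?n"
        using bij_betwE[OF col_filling_bij[OF fin]] 1 cD by simp
      ultimately show ?thesis
        using diagram_perm(2)[OF fin 1] by (auto simp: rf cf last_to_def)
    next
      case 2
      have "{q \<in> ?E. fst q < fst p \<or> (fst q = fst p \<and> snd q \<le> snd p)} = ?E"
        using fst_le unfolding E 2 by force
      then have rf: "row_filling ?E p = Suc ?n" using cE by (simp add: row_filling_def)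
      have "{q \<in> ?E. snd q < snd p \<or> (snd q = snd p \<and> fst q \<le> fst p)} = insert ?new {q \<in> D. snd q \<le> j}"
        using fst_le unfolding E 2 by force
      then have cf: "col_filling ?E p = Suc ?m" using fin new by (simp add: col_filling_def)
      have "diagram_perm D (Suc ?n) = Suc ?n"
        using permutes_not_in[OF diagram_perm(1)[OF fin], of "Suc ?n"] cD by simp
      then show ?thesis by (simp add: rf cf)
    qed
  qed
qed

section \<open>Appending a block of length one\<close>

lemma block_snoc: "1 \<le> i \<Longrightarrow> i \<le> sum_list lam \<Longrightarrow> block (lam @ [1]) i = block lam i"
proof -
  assume i: "1 \<le> i" "i \<le> sum_list lam"
  obtain b where b: "b < length lam" "psum lam b < i" "i \<le> psum lam (Suc b)"
    using block_cases[OF i] by blast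
  then have "block (lam @ [1]) i = b" by (intro block_eqI) auto
  then show ?thesis using block_eqI[OF b] by simp
qed

lemma block_snoc_last: "block (lam @ [1]) (Suc (sum_list lam)) = length lam"
  by (rule block_eqI) auto

text \<open>The added block is a single position and imposes nothing; on the old positions
  \<open>last_to\<close> preserves the order of values.\<close>

lemma block_increasing_last_to:
  assumes v: "1 \<le> v" "v \<le> Suc (sum_list lam)" and z: "z permutes {1..sum_list lam}"
  shows "block_increasing (lam @ [1]) (z \<cdot> last_to (sum_list lam) v) \<longleftrightarrow> block_increasing lam z"
proof -
  let ?n = "sum_list lam"
  have p: "z \<cdot> last_to ?n v permutes {1..Suc ?n}" using compose_last_to_permutes[OF z v] .
  have less: "(z \<cdot> last_to ?n v) i < (z \<cdot> last_to ?n v) j \<longleftrightarrow> z i < z j" if "i \<le> ?n" "j \<le> ?n" for i j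
    using last_to_less_iff permutes_atMost_le[OF z] that by simp
  have "block (lam @ [1]) i \<noteq> block (lam @ [1]) (Suc ?n)" if "1 \<le> i" "i \<le> ?n" for i
    using block_snoc[OF that] block_less_length[OF that] block_snoc_last[of lam] by simp
  then have "(\<forall>i j. 1 \<le> i \<and> i < j \<and> j \<le> Suc ?n \<and> block (lam @ [1]) i = block (lam @ [1]) j \<longrightarrow>
        (z \<cdot> last_to ?n v) i < (z \<cdot> last_to ?n v) j) \<longleftrightarrow>
      (\<forall>i j. 1 \<le> i \<and> i < j \<and> j \<le> ?n \<and> block (lam @ [1]) i = block (lam @ [1]) j \<longrightarrow>
        (z \<cdot> last_to ?n v) i < (z \<cdot> last_to ?n v) j)"
    by (metis le_Suc_eq less_Suc_eq_le)
  also have "\<dots> \<longleftrightarrow> (\<forall>i j. 1 \<le> i \<and> i < j \<and> j \<le> ?n \<and> block lam i = block lam j \<longrightarrow> z i < z j)"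
    using less block_snoc by (smt (verit) le_trans less_imp_le_nat)
  finally show ?thesis using p z by (simp add: block_increasing_def del: comp_apply)
qed

text \<open>
  The condition under which \<open>z \<cdot> last_to (sum_list lam) v\<close> is full for \<open>lam @ [1]\<close>, expressed on the
  positions of \<open>z\<close>: the last letter can be added to \<open>A\<close>, as it is adjacent exactly to the
  positions \<open>i\<close> with \<open>v \<le> z i\<close>.
\<close>

definition extendable :: "nat list \<Rightarrow> (nat \<Rightarrow> nat) \<Rightarrow> nat \<Rightarrow> bool"
  where "extendable lam z v \<longleftrightarrow> (\<forall>k\<ge>1. \<exists>A\<subseteq>{1..sum_list lam}.
    clique_le (pos_adj lam z) k A \<and> card A = min_sum k lam \<and>
    (\<forall>C\<subseteq>A. pairwise (pos_adj lam z) C \<and> (\<forall>i\<in>C. v \<le> z i) \<longrightarrow> card C < k))"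

lemma full_last_to:
  assumes v: "1 \<le> v" "v \<le> Suc (sum_list lam)" and z: "z permutes {1..sum_list lam}"
  shows "full (lam @ [1]) (z \<cdot> last_to (sum_list lam) v) \<longleftrightarrow> extendable lam z v"
proof -
  let ?n = "sum_list lam" and ?lam = "lam @ [1]"
  let ?y = "z \<cdot> last_to ?n v"
  let ?adj = "pos_adj lam z" and ?adj' = "pos_adj ?lam ?y"
  have less: "?y i < ?y j \<longleftrightarrow> z i < z j" if "i \<le> ?n" "j \<le> ?n" for i j
    using last_to_less_iff permutes_atMost_le[OF z] that by simp
  have adj: "?adj' i j \<longleftrightarrow> ?adj i j" if "i \<in> {1..?n}" "j \<in> {1..?n}" for i j
    using that by (simp only: pos_adj_def block_snoc less atLeastAtMost_iff)
  have zl: "z (Suc ?n) = Suc ?n" using permutes_not_in[OF z, of "Suc ?n"] by simp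
  have adj_last: "?adj' i (Suc ?n) \<longleftrightarrow> v \<le> z i" "?adj' (Suc ?n) i \<longleftrightarrow> v \<le> z i" if i: "i \<in> {1..?n}" for i
  proof -
    have "block ?lam i \<noteq> block ?lam (Suc ?n)"
      using i block_snoc[of i lam] block_less_length[of i lam] block_snoc_last[of lam] by simp
    moreover have "v < last_to ?n v (z i) \<longleftrightarrow> v \<le> z i"
      using v_less_last_to_iff permutes_atMost_le[OF z] i by simp
    ultimately show "?adj' i (Suc ?n) \<longleftrightarrow> v \<le> z i" "?adj' (Suc ?n) i \<longleftrightarrow> v \<le> z i"
      using i zl by (auto simp: pos_adj_def)
  qed
  have pw: "pairwise ?adj' C \<longleftrightarrow> pairwise ?adj C" if "C \<subseteq> {1..?n}" for C
    using adj that unfolding pairwise_def by blast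
  have pw_insert: "pairwise ?adj' (insert (Suc ?n) C) \<longleftrightarrow> pairwise ?adj C \<and> (\<forall>i\<in>C. v \<le> z i)"
    if "C \<subseteq> {1..?n}" for C
  proof -
    have "i \<noteq> Suc ?n" if "i \<in> C" for i using that \<open>C \<subseteq> {1..?n}\<close> by auto
    then show ?thesis unfolding pairwise_insert pw[OF that] using adj_last that by blast
  qed
  have ms: "min_sum k ?lam = Suc (min_sum k lam)" if "1 \<le> k" for k
    using that by (simp add: min_sum_def)
  have step: "(\<exists>A\<subseteq>{1..sum_list ?lam}. clique_le ?adj' k A \<and> card A = min_sum k ?lam) \<longleftrightarrow>
    (\<exists>A\<subseteq>{1..?n}. clique_le ?adj k A \<and> card A = min_sum k lam \<and>
      (\<forall>C\<subseteq>A. pairwise ?adj C \<and> (\<forall>i\<in>C. v \<le> z i) \<longrightarrow> card C < k))" (is "?L \<longleftrightarrow> ?R") if k: "1 \<le> k" for k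
  proof
    assume ?L
    then obtain A where A: "A \<subseteq> {1..sum_list ?lam}" "clique_le ?adj' k A" "card A = min_sum k ?lam" by blast
    define B where "B = A - {Suc ?n}"
    have finA: "finite A" using A(2) by (simp add: clique_le_def)
    have B: "B \<subseteq> {1..?n}" using A(1) by (auto simp: B_def le_Suc_eq)
    \<comment> \<open>An optimal set takes the full bound from every block, and the last block
      consists of a single position; as \<open>k\<close> is at least 1, that position lies in
      \<open>A\<close>.\<close>
    have "card {i \<in> A. block ?lam i = length lam} = 1"
      using pos_clique_le_blocks(4)[OF A(1,2,3), of "length lam"] k by simp
    then obtain i where "i \<in> A" "block ?lam i = length lam" by (metis (mono_tags, lifting) card_1_singletonE insertI1 mem_Collect_eq)
    moreover have "block ?lam i < length lam" if "i \<in> {1..?n}" for i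
      using that block_snoc[of i lam] block_less_length[of i lam] by simp
    ultimately have "i \<notin> {1..?n}" by fastforce
    then have "i \<notin> B" using B by blast
    then have last: "Suc ?n \<in> A" using \<open>i \<in> A\<close> by (simp add: B_def)
    have "card B = min_sum k lam"
      using A(3) ms[OF k] last finA by (simp add: B_def)
    moreover have "clique_le ?adj k B"
    proof (rule clique_le_antimono)
      show "clique_le ?adj' k B" by (rule clique_le_subset[OF A(2)]) (auto simp: B_def)
    qed (use adj B in blast)
    moreover have "card C < k" if C: "C \<subseteq> B" "pairwise ?adj C" "\<forall>i\<in>C. v \<le> z i" for C
    proof -
      have "C \<subseteq> {1..?n}" using C(1) B by blast
      then have "pairwise ?adj' (insert (Suc ?n) C)" using pw_insert C by blast
      moreover have "insert (Suc ?n) C \<subseteq> A" using C(1) last by (auto simp: B_def)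
      ultimately have "card (insert (Suc ?n) C) \<le> k" using clique_leD[OF A(2)] by blast
      moreover have "Suc ?n \<notin> C" "finite C" using C(1) finA finite_subset by (auto simp: B_def)
      ultimately show ?thesis by simp
    qed
    ultimately show ?R using B by blast
  next
    assume ?R
    then obtain B where B: "B \<subseteq> {1..?n}" "clique_le ?adj k B" "card B = min_sum k lam"
      "\<And>C. C \<subseteq> B \<Longrightarrow> pairwise ?adj C \<Longrightarrow> \<forall>i\<in>C. v \<le> z i \<Longrightarrow> card C < k" by blast
    have finB: "finite B" using B(2) by (simp add: clique_le_def)
    have nB: "Suc ?n \<notin> B" using B(1) by auto
    let ?A = "insert (Suc ?n) B"
    have "clique_le ?adj' k ?A"
      unfolding clique_le_def
    proof (intro conjI allI impI)
      show "finite ?A" using finB by simp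
      fix C assume C: "C \<subseteq> ?A" "pairwise ?adj' C"
      define C' where "C' = C - {Suc ?n}"
      have C': "C' \<subseteq> B" "C' \<subseteq> {1..?n}" using C(1) B(1) by (auto simp: C'_def)
      have finC': "finite C'" using C'(1) finB finite_subset by blast
      show "card C \<le> k"
      proof (cases "Suc ?n \<in> C")
        case True
        then have eq: "C = insert (Suc ?n) C'" by (auto simp: C'_def)
        then have "pairwise ?adj C' \<and> (\<forall>i\<in>C'. v \<le> z i)" using C(2) pw_insert[OF C'(2)] by simp
        then have "card C' < k" using B(4)[OF C'(1)] by blast
        moreover have "Suc ?n \<notin> C'" by (simp add: C'_def)
        then have "card C = Suc (card C')" using eq finC' by (metis card_insert_disjoint)
        ultimately show ?thesis by simp
      next
        case False
        then have "C = C'" by (auto simp: C'_def)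
        then show ?thesis using C(2) pw[OF C'(2)] clique_leD[OF B(2) C'(1)] by simp
      qed
    qed
    moreover have "card ?A = min_sum k ?lam" using B(3) ms[OF k] finB nB by simp
    moreover have "?A \<subseteq> {1..sum_list ?lam}" using B(1) by auto
    ultimately show ?L by blast
  qed
  \<comment> \<open>\<open>k = 0\<close> is exempt in \<open>extendable\<close>, since not even the
    empty clique has fewer than 0 vertices; for \<open>full\<close> the empty set settles this
    case.\<close>
  have zero: "\<exists>A\<subseteq>{1..sum_list ?lam}. clique_le ?adj' 0 A \<and> card A = min_sum 0 ?lam"
    by (intro exI[of _ "{}"]) (simp add: clique_le_def min_sum_def)
  show ?thesis
  proof
    assume "full ?lam ?y"
    then show "extendable lam z v"
      unfolding extendable_def full_def by (intro allI impI) (rule iffD1[OF step], assumption, erule spec)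
  next
    assume ex: "extendable lam z v"
    show "full ?lam ?y"
      unfolding full_def
    proof
      fix k
      show "\<exists>A\<subseteq>{1..sum_list ?lam}. clique_le ?adj' k A \<and> card A = min_sum k ?lam"
      proof (cases "1 \<le> k")
        case True
        show ?thesis
          by (rule iffD2[OF step[OF True]]) (rule ex[unfolded extendable_def, rule_format, OF True])
      next
        case False
        then have "k = 0" by simp
        then show ?thesis using zero by simp
      qed
    qed
  qed
qed

lemma extendable_imp_full:
  assumes "extendable lam z v"
  shows "full lam z"
  unfolding full_def
proof
  fix k
  show "\<exists>A\<subseteq>{1..sum_list lam}. clique_le (pos_adj lam z) k A \<and> card A = min_sum k lam"
  proof (cases "1 \<le> k")
    case True
    then show ?thesis using assms unfolding extendable_def by blast
  next
    case False
    then show ?thesis by (intro exI[of _ "{}"]) (simp add: clique_le_def min_sum_def)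
  qed
qed

text \<open>A last letter larger than all others is adjacent to nothing. This supplies a candidate
  for the least \<open>v\<close>, namely the one that the last column realises.\<close>

lemma extendable_Suc_sum:
  assumes "full lam z" and z: "z permutes {1..sum_list lam}"
  shows "extendable lam z (Suc (sum_list lam))"
  unfolding extendable_def
proof (intro allI impI)
  fix k :: nat assume k: "1 \<le> k"
  obtain A where A: "A \<subseteq> {1..sum_list lam}" "clique_le (pos_adj lam z) k A" "card A = min_sum k lam"
    using assms(1) by (auto simp: full_def)
  have "card C < k" if C: "C \<subseteq> A" "\<forall>i\<in>C. Suc (sum_list lam) \<le> z i" for C
  proof -
    have "\<not> Suc (sum_list lam) \<le> z i" if "i \<in> C" for i
      using permutes_atMost_le[OF z, of i] that C(1) A(1) by auto
    then have "C = {}" using C(2) by blast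
    then show ?thesis using k by simp
  qed
  then show "\<exists>A\<subseteq>{1..sum_list lam}. clique_le (pos_adj lam z) k A \<and> card A = min_sum k lam \<and>
      (\<forall>C\<subseteq>A. pairwise (pos_adj lam z) C \<and> (\<forall>i\<in>C. Suc (sum_list lam) \<le> z i) \<longrightarrow> card C < k)"
    using A by blast
qed

text \<open>
  If the last letter can take the value \<open>v\<close>, then some chosen node of the last row lies strictly to
  the left of the column of \<open>v\<close>.  It is adjacent to every node in the columns from that one on, so
  the cliques there have fewer than \<open>k\<close> nodes, and \<open>v\<close> can be lowered to the end of the previous
  column.
\<close>

lemma extendable_lower:
  assumes D: "D \<in> diagrams lam" and lam: "lam \<noteq> []" "\<And>a. a \<in> set lam \<Longrightarrow> 0 < a"
    and ex: "extendable lam (diagram_perm D) v" and v: "1 \<le> v" "v \<le> sum_list lam"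
  shows "\<exists>j\<in>{1..num_cols D}. card {q \<in> D. snd q \<le> j} < v \<and>
    extendable lam (diagram_perm D) (Suc (card {q \<in> D. snd q \<le> j}))"
proof -
  let ?n = "sum_list lam" and ?z = "diagram_perm D"
  let ?adj = "pos_adj lam ?z"
  have fin: "finite D" using diagramsD(1)[OF D] .
  have cD: "card D = ?n" using diagram_card[OF D] .
  define r where "r = length lam - 1"
  have r: "r < length lam" using lam(1) by (simp add: r_def)
  have lamr: "1 \<le> lam ! r" using lam(2) nth_mem[OF r] by fastforce
  define N where "N = inv_into D (row_filling D)"
  have rb: "bij_betw (row_filling D) D {1..?n}" using row_filling_bij[OF fin] cD by simp
  have N: "N i \<in> D" "row_filling D (N i) = i" if "i \<in> {1..?n}" for i
    using that rb by (auto simp: N_def bij_betw_def inv_into_into f_inv_into_f)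
  have zN: "?z i = col_filling D (N i)" if "i \<in> {1..?n}" for i
    using diagram_perm(2)[OF fin N(1)[OF that]] N(2)[OF that] by simp
  have rowN: "fst (N i) = Suc (block lam i)" if "i \<in> {1..?n}" for i
    using block_row_filling[OF D N(1)[OF that]] N(2)[OF that] by simp
  have adjN: "?adj i i' \<longleftrightarrow> node_adj (N i) (N i')" if "i \<in> {1..?n}" "i' \<in> {1..?n}" for i i'
    using pos_adj_row_filling[OF D N(1)[OF that(1)] N(1)[OF that(2)]] N(2) that by simp
  have le_r: "block lam i \<le> r" if "i \<in> {1..?n}" for i
    using block_less_length[of i lam] that by (simp add: r_def)
  have "v \<in> col_filling D ` D" using col_filling_bij[OF fin] cD v by (simp add: bij_betw_def)
  then obtain p where p: "p \<in> D" "col_filling D p = v" by blast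
  \<comment> \<open>The column before the one of \<open>v\<close>; that it is not 0 follows below
    from the node of \<open>t1\<close>.\<close>
  define j where "j = snd p - 1"
  have sndp: "snd p \<in> {1..num_cols D}" using diagramsD(4)[OF D] p(1) by blast
  have "fst p \<in> {1..length lam}" using diagramsD(3)[OF D] p(1) by blast
  then have fstp: "fst p \<le> Suc r" using r unfolding r_def atLeastAtMost_iff by arith
  \<comment> \<open>\<open>p\<close> is not below the last row, so a node of the last row that
    precedes \<open>p\<close> in the column filling cannot share its column.\<close>
  have left: "snd (N i) \<le> j" if i: "i \<in> {1..?n}" "block lam i = r" "?z i < v" for i
  proof -
    have "col_filling D (N i) < col_filling D p" using zN i p(2) by simp
    then have "snd (N i) < snd p \<or> (snd (N i) = snd p \<and> fst (N i) < fst p)"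
      using col_filling_less[OF fin N(1)[OF i(1)] p(1)] by simp
    moreover have "fst (N i) = Suc r" using rowN i by simp
    ultimately show ?thesis using fstp by (auto simp: j_def)
  qed
  \<comment> \<open>For such \<open>k\<close> an optimal set has \<open>k\<close> positions in the
    last block, and they form a clique; if all their values were at least \<open>v\<close>, the
    strict bound would fail.\<close>
  have B: "\<exists>i\<in>A. block lam i = r \<and> ?z i < v" if A: "A \<subseteq> {1..?n}" "clique_le ?adj k A" "card A = min_sum k lam"
      "\<And>C. C \<subseteq> A \<Longrightarrow> pairwise ?adj C \<Longrightarrow> \<forall>i\<in>C. v \<le> ?z i \<Longrightarrow> card C < k" and k: "k \<le> lam ! r" for A k
  proof (rule ccontr)
    assume "\<not> (\<exists>i\<in>A. block lam i = r \<and> ?z i < v)"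
    then have "\<forall>i\<in>{i \<in> A. block lam i = r}. v \<le> ?z i" by (auto simp: not_less)
    moreover have "pairwise ?adj {i \<in> A. block lam i = r}" by (auto simp: pairwise_def pos_adj_def)
    ultimately have "card {i \<in> A. block lam i = r} < k" using A(4)[of "{i \<in> A. block lam i = r}"] by blast
    moreover have "card {i \<in> A. block lam i = r} = min k (lam ! r)"
      using pos_clique_le_blocks(4)[OF A(1-3) r] .
    ultimately show False using k by simp
  qed
  have get: "\<exists>A\<subseteq>{1..?n}. clique_le ?adj k A \<and> card A = min_sum k lam \<and>
      (\<forall>C\<subseteq>A. pairwise ?adj C \<and> (\<forall>i\<in>C. v \<le> ?z i) \<longrightarrow> card C < k)" if "1 \<le> k" for k
    using ex that by (simp add: extendable_def)
  obtain A1 where A1: "A1 \<subseteq> {1..?n}" "clique_le ?adj 1 A1" "card A1 = min_sum 1 lam"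
      "\<And>C. C \<subseteq> A1 \<Longrightarrow> pairwise ?adj C \<Longrightarrow> \<forall>i\<in>C. v \<le> ?z i \<Longrightarrow> card C < 1"
    using get[OF order_refl] by blast
  obtain t1 where t1: "t1 \<in> {1..?n}" "block lam t1 = r" "?z t1 < v"
    using B[OF A1 lamr] A1(1) by blast
  \<comment> \<open>For larger \<open>k\<close> an optimal set contains the whole last block, hence
    the position \<open>t1\<close> found with \<open>k = 1\<close>.\<close>
  have t: "\<exists>i\<in>A. block lam i = r \<and> ?z i < v" if A: "A \<subseteq> {1..?n}" "clique_le ?adj k A" "card A = min_sum k lam"
      "\<And>C. C \<subseteq> A \<Longrightarrow> pairwise ?adj C \<Longrightarrow> \<forall>i\<in>C. v \<le> ?z i \<Longrightarrow> card C < k" for A k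
  proof (cases "k \<le> lam ! r")
    case True
    then show ?thesis using B[OF A(1-3)] A(4) by blast
  next
    case False
    have "card {i \<in> A. block lam i = r} = min k (lam ! r)"
      using pos_clique_le_blocks(4)[OF A(1-3) r] .
    then have "card {i \<in> A. block lam i = r} = card {i \<in> {1..?n}. block lam i = r}"
      using False card_block[OF r] by simp
    moreover have "{i \<in> A. block lam i = r} \<subseteq> {i \<in> {1..?n}. block lam i = r}" using A(1) by blast
    ultimately have "{i \<in> A. block lam i = r} = {i \<in> {1..?n}. block lam i = r}"
      by (intro card_subset_eq) auto
    then show ?thesis using t1 by blast
  qed
  have "1 \<le> snd (N t1)" using diagramsD(4)[OF D] N(1)[OF t1(1)] by force
  then have j: "j \<in> {1..num_cols D}" using left[OF t1] sndp by (auto simp: j_def)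
  let ?m = "card {q \<in> D. snd q \<le> j}"
  have right: "j < snd q" if q: "q \<in> D" "?m < col_filling D q" for q
  proof (rule ccontr)
    assume "\<not> j < snd q"
    then have "col_filling D q \<le> ?m" unfolding col_filling_def by (intro card_mono) (use fin in auto)
    then show False using q by simp
  qed
  have "?m < v"
  proof -
    have "{q \<in> D. snd q \<le> j} \<subset> {q \<in> D. snd q < snd p \<or> (snd q = snd p \<and> fst q \<le> fst p)}"
      (is "?L \<subset> ?R")
    proof (rule psubsetI)
      show "?L \<subseteq> ?R" using j by (auto simp: j_def)
      have "p \<in> ?R" "p \<notin> ?L" using p(1) sndp by (auto simp: j_def)
      then show "?L \<noteq> ?R" by blast
    qed
    then have "?m < col_filling D p" unfolding col_filling_def using fin by (intro psubset_card_mono) auto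
    then show ?thesis using p(2) by simp
  qed
  moreover have "extendable lam ?z (Suc ?m)"
    unfolding extendable_def
  proof (intro allI impI)
    fix k :: nat assume k: "1 \<le> k"
    obtain A where A: "A \<subseteq> {1..?n}" "clique_le ?adj k A" "card A = min_sum k lam"
      "\<And>C. C \<subseteq> A \<Longrightarrow> pairwise ?adj C \<Longrightarrow> \<forall>i\<in>C. v \<le> ?z i \<Longrightarrow> card C < k"
      using get[OF k] by blast
    obtain t where tA: "t \<in> A" "block lam t = r" "?z t < v" using t[OF A] by blast
    then have tn: "t \<in> {1..?n}" using A(1) by blast
    have "card C < k" if C: "C \<subseteq> A" "pairwise ?adj C" "\<forall>i\<in>C. Suc ?m \<le> ?z i" for C
    proof -
      have sndC: "j < snd (N c)" if "c \<in> C" for c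
      proof -
        have "c \<in> {1..?n}" using that C(1) A(1) by blast
        moreover have "Suc ?m \<le> ?z c" using that C(3) by blast
        ultimately show ?thesis using right[OF N(1), of c] zN[of c] by (simp add: Suc_le_eq)
      qed
      have sndt: "snd (N t) \<le> j" using left[OF tn tA(2,3)] .
      have tC: "t \<notin> C" using sndC sndt by force
      have adjt: "?adj t c \<and> ?adj c t" if c: "c \<in> C" for c
      proof -
        have cn: "c \<in> {1..?n}" using c C(1) A(1) by blast
        have "fst (N c) \<le> fst (N t)" using rowN[OF cn] rowN[OF tn] le_r[OF cn] tA(2) by simp
        then have "node_adj (N t) (N c)" "node_adj (N c) (N t)"
          using sndC[OF c] sndt by (auto simp: node_adj_def path_lt_def)
        then show ?thesis using adjN[OF tn cn] adjN[OF cn tn] by simp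
      qed
      have "pairwise ?adj (insert t C)" using C(2) adjt by (auto simp: pairwise_insert)
      moreover have "insert t C \<subseteq> A" using C(1) tA(1) by simp
      ultimately have "card (insert t C) \<le> k" using clique_leD[OF A(2)] by blast
      moreover have "finite C" using C(1) clique_le_finite[OF A(2)] finite_subset by blast
      ultimately show ?thesis using tC by simp
    qed
    then show "\<exists>A\<subseteq>{1..?n}. clique_le ?adj k A \<and> card A = min_sum k lam \<and>
        (\<forall>C\<subseteq>A. pairwise ?adj C \<and> (\<forall>i\<in>C. Suc ?m \<le> ?z i) \<longrightarrow> card C < k)"
      using A(1-3) by blast
  qed
  ultimately show ?thesis using j by blast
qed

lemma Z_set_snoc_decompose:
  assumes "y \<in> Z_set (lam @ [1])"
  obtains z u where "z \<in> Z_set lam" "1 \<le> u" "u \<le> Suc (sum_list lam)" "y = z \<cdot> last_to (sum_list lam) u"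
proof -
  let ?n = "sum_list lam"
  have y: "block_increasing (lam @ [1]) y" "full (lam @ [1]) y" using assms by (auto simp: Z_set_eq)
  then have "y permutes {1..Suc ?n}" by (simp add: block_increasing_def)
  then obtain z where z: "z permutes {1..?n}" "y = z \<cdot> last_to ?n (y (Suc ?n))"
      "1 \<le> y (Suc ?n)" "y (Suc ?n) \<le> Suc ?n"
    using permutes_Suc_decompose by blast
  have "block_increasing lam z" using y(1) block_increasing_last_to[OF z(3,4,1)] z(2) by simp
  moreover have "full lam z"
    using y(2) full_last_to[OF z(3,4,1)] z(2) extendable_imp_full by simp
  ultimately show ?thesis using that[of z] z by (simp add: Z_set_eq)
qed

lemma Z_set_permutes: "z \<in> Z_set lam \<Longrightarrow> z permutes {1..sum_list lam}"
  by (simp add: Z_set_eq block_increasing_def)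

lemma Z_set_last_to_iff:
  assumes "z \<in> Z_set lam" "1 \<le> v" "v \<le> Suc (sum_list lam)"
  shows "z \<cdot> last_to (sum_list lam) v \<in> Z_set (lam @ [1]) \<longleftrightarrow> extendable lam z v"
  using assms block_increasing_last_to[OF assms(2,3) Z_set_permutes[OF assms(1)]]
    full_last_to[OF assms(2,3) Z_set_permutes[OF assms(1)]]
  by (simp add: Z_set_eq)

text \<open>Column \<open>j\<close> realises the value \<open>Suc (m j)\<close>, and
  \<open>m\<close> is monotone, so the least admissible column gives the least of these values; by
  \<open>extendable_lower\<close> no other value undercuts it.\<close>

lemma theta_star_least:
  assumes n: "1 \<le> sum_list lam" and pos: "\<And>a. a \<in> set lam \<Longrightarrow> 0 < a" and z: "z \<in> Z_set lam"
  shows "\<exists>!D. is_min_diagram z lam D" and "ext_cols (min_diagram z lam) \<noteq> {}"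
    and "\<exists>v. 1 \<le> v \<and> v \<le> Suc (sum_list lam) \<and> theta_star lam z = z \<cdot> last_to (sum_list lam) v \<and>
      extendable lam z v \<and> (\<forall>u. 1 \<le> u \<and> u \<le> Suc (sum_list lam) \<and> extendable lam z u \<longrightarrow> v \<le> u)"
proof -
  let ?n = "sum_list lam" and ?D = "min_diagram z lam"
  define m where "m j = card {q \<in> ?D. snd q \<le> j}" for j
  have z_inc: "block_increasing lam z" "full lam z" using z by (auto simp: Z_set_eq)
  note zp = Z_set_permutes[OF z]
  show ex1: "\<exists>!D. is_min_diagram z lam D" using ex1_min_diagram[OF pos n z_inc(1)] .
  then have "is_min_diagram z lam ?D" unfolding min_diagram_def by (rule theI')
  then have D: "?D \<in> diagrams lam" "diagram_perm ?D = z" by (auto simp: is_min_diagram_def)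
  have fin: "finite ?D" and cols: "snd ` ?D = {1..num_cols ?D}" using diagramsD[OF D(1)] by auto
  have m_le: "m j \<le> ?n" for j
    unfolding m_def diagram_card[OF D(1), symmetric] by (rule card_mono) (use fin in auto)
  have m_mono: "m i \<le> m j" if "i \<le> j" for i j
    unfolding m_def by (rule card_mono) (use fin that in auto)
  have ext: "ext_diagram ?D j \<in> diagrams (lam @ [1])"
      "diagram_perm (ext_diagram ?D j) = z \<cdot> last_to ?n (Suc (m j))" if "j \<in> {1..num_cols ?D}" for j
    using ext_diagram[OF D(1) that] D(2) by (simp_all add: m_def)
  have adm: "admissible (ext_diagram ?D j) \<longleftrightarrow> extendable lam z (Suc (m j))"
    if "j \<in> {1..num_cols ?D}" for j
    using admissible_iff_full[OF ext(1)[OF that]] full_last_to[of "Suc (m j)" lam z] zp m_le ext(2)[OF that]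
    by simp
  have cols_eq: "ext_cols ?D = {j \<in> {1..num_cols ?D}. extendable lam z (Suc (m j))}"
    using adm by (auto simp: ext_cols_def)
  have "?D \<noteq> {}" using diagram_card[OF D(1)] n by (metis card.empty not_one_le_zero)
  then have c1: "num_cols ?D \<in> {1..num_cols ?D}" using cols by auto
  have "{q \<in> ?D. snd q \<le> num_cols ?D} = ?D" using cols by force
  \<comment> \<open>A node in the last column makes the last letter the largest, which is always
    possible; so \<open>q_col\<close> is the minimum of a nonempty set.\<close>
  then have "m (num_cols ?D) = ?n" using diagram_card[OF D(1)] by (simp add: m_def)
  then have "num_cols ?D \<in> ext_cols ?D"
    using c1 extendable_Suc_sum[OF z_inc(2) zp] by (simp add: cols_eq)
  then show ne: "ext_cols ?D \<noteq> {}" by blast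
  let ?q = "q_col ?D"
  have fin_ext: "finite (ext_cols ?D)" by (simp add: cols_eq)
  have q: "?q \<in> ext_cols ?D" unfolding q_col_def by (rule Min_in[OF fin_ext ne])
  have q_least: "?q \<le> j" if "j \<in> ext_cols ?D" for j
    unfolding q_col_def by (rule Min_le[OF fin_ext that])
  show "\<exists>v. 1 \<le> v \<and> v \<le> Suc ?n \<and> theta_star lam z = z \<cdot> last_to ?n v \<and>
      extendable lam z v \<and> (\<forall>u. 1 \<le> u \<and> u \<le> Suc ?n \<and> extendable lam z u \<longrightarrow> v \<le> u)"
  proof (intro exI[of _ "Suc (m ?q)"] conjI allI impI)
    show "theta_star lam z = z \<cdot> last_to ?n (Suc (m ?q))"
      using q ext(2)[of ?q] by (simp add: theta_star_def cols_eq Let_def)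
    show "extendable lam z (Suc (m ?q))" using q by (simp add: cols_eq)
    fix u assume u: "1 \<le> u \<and> u \<le> Suc ?n \<and> extendable lam z u"
    show "Suc (m ?q) \<le> u"
    proof (cases "u = Suc ?n")
      case True
      then show ?thesis using m_le by simp
    next
      case False
      have "lam \<noteq> []" using n by auto
      then obtain j where "j \<in> {1..num_cols ?D}" "m j < u" "extendable lam z (Suc (m j))"
        using extendable_lower[OF D(1) _ pos, of u] u False D(2) unfolding m_def by auto
      then show ?thesis using q_least[of j] m_mono[of ?q j] by (simp add: cols_eq)
    qed
  qed (use m_le in simp_all)
qed

section \<open>Comparison of prefixes\<close>

lemma prefix_of_antisym:
  assumes "x permutes {1..n}" "y permutes {1..n}" "prefix_of n x y" "prefix_of n y x"
  shows "x = y"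
  using assms invs_inject prefix_of_iff by blast

text \<open>Among the first \<open>n\<close> positions \<open>last_to\<close> changes no inversion,
  so the inclusion of inversion sets restricts to these positions.\<close>

lemma prefix_of_restrict:
  assumes "y permutes {1..n}" "z permutes {1..n}" "1 \<le> u" "u \<le> Suc n" "1 \<le> v" "v \<le> Suc n"
    and "prefix_of (Suc n) (y \<cdot> last_to n u) (z \<cdot> last_to n v)"
  shows "prefix_of n y z"
proof -
  have "invs (Suc n) (y \<cdot> last_to n u) \<subseteq> invs (Suc n) (z \<cdot> last_to n v)"
    using assms(7) prefix_of_iff[OF compose_last_to_permutes[OF assms(1,3,4)] compose_last_to_permutes[OF assms(2,5,6)]]
    by blast
  then have "invs n y \<subseteq> invs n z"
    unfolding invs_compose_last_to(1)[OF assms(1), of u, symmetric]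
      invs_compose_last_to(1)[OF assms(2), of v, symmetric] by blast
  then show ?thesis using prefix_of_iff[OF assms(1,2)] by blast
qed

theorem theorem4p3:
  fixes n :: nat and lam :: "nat list"
  assumes "n \<ge> 1" and "composition_of n lam"
  shows
    "(\<forall>z\<in>Z_set lam. (\<exists>!D. is_min_diagram z lam D) \<and> ext_cols (min_diagram z lam) \<noteq> {}) \<and>
     theta_star lam ` Z_set lam \<subseteq> Z_set (comp_star lam) \<and>
     inj_on (theta_star lam) (Z_set lam) \<and>
     (\<forall>z\<in>Z_set lam. inv' z \<cdot> theta_star lam z \<in> X' n \<and>
        (\<forall>x\<in>X' n. z \<cdot> x \<in> Z_set (comp_star lam) \<longrightarrow>
           prefix_of (n + 1) x (inv' z \<cdot> theta_star lam z))) \<and>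
     theta_star lam ` Y_set lam \<subseteq> Y_set (comp_star lam) \<and>
     Y_set (comp_star lam) \<subseteq> theta_star lam ` Z_set lam"
proof -
  have n: "sum_list lam = n" and pos: "\<And>a. a \<in> set lam \<Longrightarrow> 0 < a"
    using assms(2) by (auto simp: composition_of_def)
  have star: "comp_star lam = lam @ [1]" "sum_list (comp_star lam) = Suc n"
    by (simp_all add: comp_star_def n)
  let ?Z = "Z_set lam" and ?Zs = "Z_set (comp_star lam)" and ?th = "theta_star lam"
  have "\<exists>v. \<forall>z\<in>?Z. 1 \<le> v z \<and> v z \<le> Suc n \<and> ?th z = z \<cdot> last_to n (v z) \<and> extendable lam z (v z) \<and>
      (\<forall>u. 1 \<le> u \<and> u \<le> Suc n \<and> extendable lam z u \<longrightarrow> v z \<le> u)"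
    by (intro bchoice ballI theta_star_least(3)[of lam, unfolded n, OF assms(1) pos])
  then obtain v where v: "\<And>z. z \<in> ?Z \<Longrightarrow> 1 \<le> v z" "\<And>z. z \<in> ?Z \<Longrightarrow> v z \<le> Suc n"
      "\<And>z. z \<in> ?Z \<Longrightarrow> ?th z = z \<cdot> last_to n (v z)" "\<And>z. z \<in> ?Z \<Longrightarrow> extendable lam z (v z)"
      "\<And>z u. z \<in> ?Z \<Longrightarrow> 1 \<le> u \<Longrightarrow> u \<le> Suc n \<Longrightarrow> extendable lam z u \<Longrightarrow> v z \<le> u"
    by blast
  have perm: "z permutes {1..n}" if "z \<in> ?Z" for z using Z_set_permutes[OF that] n by simp
  have perm_s: "y permutes {1..Suc n}" if "y \<in> ?Zs" for y using Z_set_permutes[OF that] star(2) by simp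
  have mem_iff: "z \<cdot> last_to n u \<in> ?Zs \<longleftrightarrow> extendable lam z u" if "z \<in> ?Z" "1 \<le> u" "u \<le> Suc n" for z u
    using Z_set_last_to_iff[OF that(1), of u] that n star(1) by simp
  have th_mem: "?th z \<in> ?Zs" if "z \<in> ?Z" for z
    using mem_iff[OF that] v that by simp
  have restrict: "\<exists>z u. z \<in> ?Z \<and> 1 \<le> u \<and> u \<le> Suc n \<and> y = z \<cdot> last_to n u" if "y \<in> ?Zs" for y
    using that Z_set_snoc_decompose[of y lam] unfolding star(1) n by blast
  \<comment> \<open>\<open>theta_star lam z\<close> has every element of its fibre over
    \<open>z\<close> as a prefix, because it uses the least value.\<close>
  have prefix_th: "prefix_of (Suc n) (z \<cdot> last_to n u) (?th z)"
    if "z \<in> ?Z" "1 \<le> u" "u \<le> Suc n" "z \<cdot> last_to n u \<in> ?Zs" for z u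
    unfolding v(3)[OF that(1)]
    using prefix_of_compose_last_to[OF perm[OF that(1)] that(2,3) v(1,2)[OF that(1)]]
      v(5)[OF that(1-3)] mem_iff[OF that(1-3)] that(4) by blast
  have quot: "inv' z \<cdot> ?th z = last_to n (v z)" if "z \<in> ?Z" for z
    unfolding v(3)[OF that] by (simp add: comp_assoc permutes_inv_o(1)[OF perm[OF that]])
  \<comment> \<open>This makes the definite description and the minimum behind
    \<open>theta_star\<close> meaningful.\<close>
  have exists: "\<forall>z\<in>?Z. (\<exists>!D. is_min_diagram z lam D) \<and> ext_cols (min_diagram z lam) \<noteq> {}"
    using theta_star_least(1,2)[of lam] assms(1) pos n by blast
  have inj: "inj_on ?th ?Z"
  proof (rule inj_onI)
    fix z z' assume z: "z \<in> ?Z" "z' \<in> ?Z" "?th z = ?th z'"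
    have "invs n z = invs n z'"
      unfolding invs_compose_last_to(1)[OF perm[OF z(1)], of "v z", symmetric]
        invs_compose_last_to(1)[OF perm[OF z(2)], of "v z'", symmetric]
      using z(3) v(3)[OF z(1)] v(3)[OF z(2)] by simp
    then show "z = z'" using invs_inject[OF perm[OF z(1)] perm[OF z(2)]] by blast
  qed
  have i: "\<forall>z\<in>?Z. inv' z \<cdot> ?th z \<in> X' n \<and>
      (\<forall>x\<in>X' n. z \<cdot> x \<in> ?Zs \<longrightarrow> prefix_of (n + 1) x (inv' z \<cdot> ?th z))"
  proof (intro ballI conjI impI)
    fix z assume z: "z \<in> ?Z"
    show "inv' z \<cdot> ?th z \<in> X' n" unfolding quot[OF z] X'_eq using v(1,2)[OF z] by blast
    fix x assume x: "x \<in> X' n" "z \<cdot> x \<in> ?Zs"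
    then obtain u where u: "x = last_to n u" "1 \<le> u" "u \<le> Suc n" by (auto simp: X'_eq)
    then have "v z \<le> u" using v(5)[OF z] mem_iff[OF z] x(2) by blast
    then show "prefix_of (n + 1) x (inv' z \<cdot> ?th z)"
      unfolding quot[OF z] u(1) using prefix_of_last_to[OF u(2,3) v(1,2)[OF z]] by simp
  qed
  have Y1: "?th ` Y_set lam \<subseteq> Y_set (comp_star lam)"
  proof
    fix w assume "w \<in> ?th ` Y_set lam"
    then obtain z where z: "z \<in> ?Z" "w = ?th z"
      "\<And>y. y \<in> ?Z \<Longrightarrow> prefix_of n z y \<Longrightarrow> y = z" by (auto simp: Y_set_def n)
    have "y = w" if y: "y \<in> ?Zs" "prefix_of (Suc n) w y" for y
    proof -
      obtain z' u where z': "z' \<in> ?Z" "1 \<le> u" "u \<le> Suc n" "y = z' \<cdot> last_to n u"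
        using restrict[OF y(1)] by blast
      \<comment> \<open>Restriction to the first \<open>n\<close> positions and maximality of
        \<open>z\<close> put \<open>y\<close> into the fibre over \<open>z\<close>, where
        \<open>w\<close> is the largest element.\<close>
      have "prefix_of n z z'"
        using prefix_of_restrict[OF perm[OF z(1)] perm[OF z'(1)] v(1,2)[OF z(1)] z'(2,3)]
          y(2) z(2) v(3)[OF z(1)] z'(4) by simp
      then have "z' = z" using z(3)[OF z'(1)] by blast
      then have "prefix_of (Suc n) y w" using prefix_th[OF z(1) z'(2,3)] z'(4) z(2) y(1) by simp
      then show "y = w" using prefix_of_antisym[OF perm_s perm_s] y th_mem[OF z(1)] z(2) by blast
    qed
    then show "w \<in> Y_set (comp_star lam)"
      using th_mem[OF z(1)] z(2) unfolding Y_set_def star(2) by blast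
  qed
  have Y2: "Y_set (comp_star lam) \<subseteq> ?th ` ?Z"
  proof
    fix y assume y: "y \<in> Y_set (comp_star lam)"
    then have yZ: "y \<in> ?Zs" and max: "\<And>w. w \<in> ?Zs \<Longrightarrow> prefix_of (Suc n) y w \<Longrightarrow> w = y"
      unfolding Y_set_def star(2) by blast+
    obtain z u where z: "z \<in> ?Z" "1 \<le> u" "u \<le> Suc n" "y = z \<cdot> last_to n u"
      using restrict[OF yZ] by blast
    \<comment> \<open>Being maximal, \<open>y\<close> has to be the largest element of its own
      fibre.\<close>
    then have "prefix_of (Suc n) y (?th z)" using prefix_th yZ by blast
    then have "?th z = y" using max th_mem[OF z(1)] by blast
    then show "y \<in> ?th ` ?Z" using z(1) by blast
  qed
  show ?thesis using exists th_mem inj i Y1 Y2 by blast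
qed

end
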